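(* Let $\beta\in[0,\frac1{\mathrm e}]$ and let $\lambda_1\le\lambda_2$ be the two roots in $[0,1]$ of $-\lambda\ln\lambda=\beta$ (with $0\ln0=0$). Let $\kappa\approx0.804$ be the positive solution of $\sum_{k=1}^\infty\frac{\kappa^k}{k!\,k}=1$. Then for every number of values $n$ there is an algorithm for optimal stopping with a predicted prior that is $\alpha$-consistent and $\beta$-robust for the MaxProb objective, where $$\alpha=\beta+\int_{\lambda_1}^{\lambda_2}\int_s^1\frac{\mathrm e^{-\frac{\kappa t}{1-s}}}{t}\,\mathrm dt\,\mathrm ds.$$
   Context: Optimal stopping with a predicted prior: let $\mathcal D$ be the set of probability distributions on $[0,\infty)$ (identified with their cdfs). There are $n$ values $x_1,\dots,x_n$ drawn i.i.d. from an unknown prior $F\in\mathcal D$; each value $x_i$ has an arrival time $t_i$ drawn independently and uniformly from $[0,1]$, independent of the values. Values are revealed in increasing order of arrival time; upon seeing a value, an online algorithm must irrevocably accept it (and stop) or reject it; at most one value can be accepted. The algorithm knows $n$ and a predicted prior $\tilde F\in\mathcal D$ and may use the observed history and internal randomness. Let $x_{\mathrm{ALG}}$ be the accepted value ($0$ if none) and $x_{\mathrm{OPT}}=\max_i x_i$. For the MaxProb objective the competitive ratio is $\Pr[x_{\mathrm{ALG}}=x_{\mathrm{OPT}}]$. An algorithm is $\Gamma$-competitive if its ratio is at least $\Gamma$. It is $\alpha$-consistent if for every $F\in\mathcal D$ it is $\alpha$-competitive when $\tilde F=F$, and $\beta$-robust if for every $F\in\mathcal D$ it is $\beta$-competitive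 regardless of which $\tilde F\in\mathcal D$ is given. *)

theory Defs
  imports "HOL-Probability.Probability"
begin

definition negxlnx :: "real \<Rightarrow> real" where
  "negxlnx y = (if y = 0 then 0 else - y * ln y)"

definition nonneg_dist :: "real measure \<Rightarrow> bool" where
  "nonneg_dist F \<longleftrightarrow> prob_space F \<and> sets F = sets borel \<and> measure F {0..} = 1"

text \<open>An online (randomized) stopping rule: given a uniform random seed r in [0,1]
  and the observed history (list of (arrival time, value) pairs in arrival order,
  the last entry being the current value), decide whether to accept the current value.\<close>
type_synonym stop_rule = "real \<Rightarrow> (real \<times> real) list \<Rightarrow> bool"

text \<open>Indices sorted by arrival time (ties, a null event, broken by index).\<close>
definition arrival_order :: "nat \<Rightarrow> (nat \<Rightarrow> real) \<Rightarrow> nat list" where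
  "arrival_order n t = sort_key t [0..<n]"

definition history :: "nat \<Rightarrow> (nat \<Rightarrow> real) \<Rightarrow> (nat \<Rightarrow> real) \<Rightarrow> nat \<Rightarrow> (real \<times> real) list" where
  "history n x t k = map (\<lambda>j. (t j, x j)) (take (Suc k) (arrival_order n t))"

definition accepted_value ::
  "nat \<Rightarrow> stop_rule \<Rightarrow> real \<Rightarrow> (nat \<Rightarrow> real) \<Rightarrow> (nat \<Rightarrow> real) \<Rightarrow> real" where
  "accepted_value n A r x t =
     (if \<exists>k<n. A r (history n x t k)
      then x (arrival_order n t ! (LEAST k. k < n \<and> A r (history n x t k)))
      else 0)"

definition opt_value :: "nat \<Rightarrow> (nat \<Rightarrow> real) \<Rightarrow> real" where
  "opt_value n x = Max (insert 0 (x ` {..<n}))"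

definition unif01 :: "real measure" where
  "unif01 = uniform_measure lborel {0..1}"

text \<open>Values i.i.d. from F, arrival times i.i.d. uniform on [0,1], independent seed.\<close>
definition instance_space ::
  "nat \<Rightarrow> real measure \<Rightarrow> (((nat \<Rightarrow> real) \<times> (nat \<Rightarrow> real)) \<times> real) measure" where
  "instance_space n F = (PiM {..<n} (\<lambda>_. F) \<Otimes>\<^sub>M PiM {..<n} (\<lambda>_. unif01)) \<Otimes>\<^sub>M unif01"

definition maxprob_ratio :: "nat \<Rightarrow> stop_rule \<Rightarrow> real measure \<Rightarrow> real" where
  "maxprob_ratio n A F = measure (instance_space n F)
     {\<omega> \<in> space (instance_space n F).
        accepted_value n A (snd \<omega>) (fst (fst \<omega>)) (snd (fst \<omega>)) = opt_value n (fst (fst \<omega>))}"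

text \<open>An algorithm for n values maps the predicted prior to a stopping rule.\<close>
definition consistent :: "nat \<Rightarrow> (real measure \<Rightarrow> stop_rule) \<Rightarrow> real \<Rightarrow> bool" where
  "consistent n ALG \<alpha> \<longleftrightarrow> (\<forall>F. nonneg_dist F \<longrightarrow> maxprob_ratio n (ALG F) F \<ge> \<alpha>)"

definition robust :: "nat \<Rightarrow> (real measure \<Rightarrow> stop_rule) \<Rightarrow> real \<Rightarrow> bool" where
  "robust n ALG \<beta> \<longleftrightarrow>
     (\<forall>F Fp. nonneg_dist F \<longrightarrow> nonneg_dist Fp \<longrightarrow> maxprob_ratio n (ALG Fp) F \<ge> \<beta>)"

end

theory Submission
  imports Defs
begin

text \<open>
  Break ties by attaching to each value an independent uniform label, and accept the first item that is
  better than everything before it and arrives no earlier than a threshold time in \<open>[l1, l2]\<close> that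
  is antitone in the (randomized) quantile of the item under the predicted prior. Conditionally on the values, the
  rule wins iff the best item arrives at some \<open>\<tau>\<close> past its threshold and the best item before \<open>\<tau>\<close> arrived
  before its own threshold; the latter has probability
  \<open>(1/\<tau>) \<integral>\<^sub>0\<^sup>\<tau> \<Prod>\<^sub>j (1 - \<tau> [T j \<le> s]) ds\<close>.

  Robustness: the integrand is 1 while \<open>s\<close> is below the threshold \<open>T\<close> of the best item, so the winning probability
  is at least \<open>- T ln T\<close>, which is at least \<open>\<beta>\<close> on \<open>[l1, l2]\<close> by concavity.

  Consistency: for a correct prediction the quantiles are i.i.d. uniform, so averaging turns the product into a power.
  With the quantile threshold \<open>exp (- \<kappa> / (n (1 - s)))\<close> at time \<open>s\<close>, the remaining
  integrals are bounded below, for every \<open>n\<close>, by their limits for \<open>n \<rightarrow> \<infinity>\<close>.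
\<close>

section \<open>Independent uniform labels from one uniform seed\<close>

text \<open>The product formula has a direct meaning. Given which items arrive before \<tau>, the
  best of them arrives at a time s uniform on [0, \<tau>], whichever item it is. As it has the
  smallest threshold among them, s lies below that threshold iff no item with
  \<open>T j \<le> s\<close> arrives before \<tau>.

  Origin of \<kappa>: in the limit let exp (- c) be the n-th power of the quantile threshold at time
  s. Its contribution is the integral over \<tau> in (s, 1) of exp (- c \<tau>) / \<tau> + (exp (- c
  \<tau>) - exp (- c)) / (1 - \<tau>), minus exp (- c). The derivative in c vanishes iff the second
  summand integrates to exp (- c); expanded in powers of 1 - \<tau>, this says that c (1 - s)
  satisfies the equation of \<kappa>. At that c the second summand cancels against exp (- c), which
  leaves the integrand of the theorem. The times before l1, where nothing is accepted, contribute
  the summand \<beta>.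

  The obstacle in the model is that a stopping rule sees a single seed and no item indices. Labels
  are therefore cut from the digits of the seed and numbered by arrival position, and must be shown
  to be i.i.d. over the items.\<close>

lemma sets_unif01 [simp, measurable_cong]: "sets unif01 = sets borel"
  by (simp add: unif01_def)

lemma space_unif01 [simp]: "space unif01 = UNIV"
  by (simp add: unif01_def)

lemma prob_space_unif01: "prob_space unif01"
  unfolding unif01_def by (rule prob_space_uniform_measure) simp_all

interpretation unif01: prob_space unif01
  by (rule prob_space_unif01)

lemma nn_integral_unif01:
  assumes [measurable]: "f \<in> borel_measurable borel"
  shows "(\<integral>\<^sup>+x. f x \<partial>unif01) = (\<integral>\<^sup>+x. f x * indicator {0..1} x \<partial>lborel)"
  unfolding unif01_def by (subst nn_integral_uniform_measure) (auto simp: divide_ennreal_def)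

lemma AE_unif01: "AE x in unif01. 0 < x \<and> x < 1"
  unfolding unif01_def
proof (subst AE_uniform_measure)
  have "AE x in lborel. x \<noteq> (0::real)" "AE x in lborel. x \<noteq> (1::real)"
    by (rule AE_lborel_singleton)+
  then show "AE x in lborel. x \<in> {0..1} \<longrightarrow> 0 < x \<and> x < (1::real)"
    by eventually_elim auto
qed simp_all

lemma emeasure_unif01_singleton: "emeasure unif01 {a} = 0"
proof -
  have "emeasure lborel ({0..1} \<inter> {a}) \<le> emeasure lborel {a}"
    by (rule emeasure_mono) auto
  then show ?thesis
    unfolding unif01_def by (subst emeasure_uniform_measure) simp_all
qed

text \<open>The digit of weight 2 ^ -(k + 1) in the binary expansion of \<open>r\<close>. The parity
  of a floor is total and measurable, and it fixes one expansion at dyadic points.\<close>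

definition bit_at :: "real \<Rightarrow> nat \<Rightarrow> bool" where
  "bit_at r k \<longleftrightarrow> odd \<lfloor>2 ^ Suc k * r\<rfloor>"

lemma measurable_bit_at [measurable]: "Measurable.pred borel (\<lambda>r. bit_at r k)"
proof -
  have "Measurable.pred (count_space UNIV) (odd :: int \<Rightarrow> bool)" by simp
  moreover have "(\<lambda>r::real. \<lfloor>2 ^ Suc k * r\<rfloor>) \<in> borel \<rightarrow>\<^sub>M count_space UNIV"
    by measurable
  ultimately show ?thesis unfolding bit_at_def by measurable
qed

text \<open>The doubling map shifts the digit sequence: the discarded integer part enters with the
  even factor \<open>2 ^ Suc k\<close>, so the parity is unchanged.\<close>

lemma bit_at_Suc: "bit_at r (Suc k) \<longleftrightarrow> bit_at (frac (2 * r)) k"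
proof -
  have "2 ^ Suc k * frac (2 * r) = 2 ^ Suc (Suc k) * r - of_int (2 ^ Suc k * \<lfloor>2 * r\<rfloor>)"
    by (simp add: frac_def algebra_simps)
  then have "\<lfloor>2 ^ Suc k * frac (2 * r)\<rfloor> = \<lfloor>2 ^ Suc (Suc k) * r\<rfloor> - 2 ^ Suc k * \<lfloor>2 * r\<rfloor>"
    by (metis floor_diff_of_int)
  then show ?thesis unfolding bit_at_def by simp
qed

text \<open>Each half of the unit interval is stretched affinely onto the whole, so the leading
  digit is a fair coin independent of \<open>frac (2 * r)\<close>, which is again uniform. This
  peels off one digit at a time.\<close>

lemma nn_integral_unif01_bit:
  assumes [measurable]: "\<And>b. f b \<in> borel_measurable borel"
  shows "(\<integral>\<^sup>+r. f (bit_at r 0) (frac (2 * r)) \<partial>unif01)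
    = (\<Sum>b\<in>UNIV. \<integral>\<^sup>+r. f b r \<partial>unif01) / 2"
proof -
  \<comment> \<open>\<open>c\<close> is the leading digit as a real number, \<open>b\<close> the
    same digit as a truth value.\<close>
  have *: "(\<integral>\<^sup>+r. f b r * indicator {0..<1} r \<partial>lborel) = 2 * (\<integral>\<^sup>+r. f (bit_at r 0) (frac (2 * r)) * indicator {c/2..<(c+1)/2} r \<partial>lborel)"
    if "b = (c = 1)" "c = 0 \<or> c = (1::real)" for b c
  proof -
    have pt: "f b (-c + 2 * r) * indicator {0..<1} (-c + 2 * r)
       = f (bit_at r 0) (frac (2 * r)) * indicator {c/2..<(c+1)/2} r" for r
    proof (cases "c \<le> 2 * r \<and> 2 * r < c + 1")
      case True
      with that have "\<lfloor>2 * r\<rfloor> = (if c = 1 then 1 else 0)"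
        by (auto simp: floor_eq_iff)
      with that have "bit_at r 0 = b" "frac (2 * r) = -c + 2 * r"
        by (auto simp: bit_at_def frac_def)
      then show ?thesis using True by (simp add: indicator_def)
    next
      case False
      then have "-c + 2 * r \<notin> {0..<1}" "r \<notin> {c/2..<(c+1)/2}" by auto
      then show ?thesis by simp
    qed
    have "(\<integral>\<^sup>+r. f b r * indicator {0..<1} r \<partial>lborel) = ennreal \<bar>2\<bar> * (\<integral>\<^sup>+r. f b (-c + 2 * r) * indicator {0..<1} (-c + 2 * r) \<partial>lborel)"
      by (rule nn_integral_real_affine) auto
    also have "\<dots> = ennreal \<bar>2\<bar> * (\<integral>\<^sup>+r. f (bit_at r 0) (frac (2 * r)) * indicator {c/2..<(c+1)/2} r \<partial>lborel)"
      by (simp only: pt)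
    finally show ?thesis by simp
  qed
  \<comment> \<open>On half-open halves \<open>\<lfloor>2 * r\<rfloor>\<close> is constant; the
    endpoint 1 is a null set.\<close>
  have co: "(\<integral>\<^sup>+r. g r \<partial>unif01) = (\<integral>\<^sup>+r. g r * indicator {0..<1} r \<partial>lborel)"
    if [measurable]: "g \<in> borel_measurable borel" for g
    unfolding nn_integral_unif01[OF that]
    by (rule nn_integral_cong_AE, rule eventually_mono[OF AE_lborel_singleton[of 1]]) (auto simp: indicator_def)
  have fr[measurable]: "frac \<in> borel_measurable (borel :: real measure)"
    unfolding frac_def by measurable
  have m[measurable]: "(\<lambda>r. f (bit_at r 0) (frac (2 * r))) \<in> borel_measurable borel"
  proof -
    have "(\<lambda>r. if bit_at r 0 then f True (frac (2*r)) else f False (frac (2 * r))) \<in> borel_measurable borel"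
      by measurable
    then show ?thesis by (rule measurable_cong[THEN iffD1, rotated]) auto
  qed
  let ?g = "\<lambda>c r. f (bit_at r 0) (frac (2 * r)) * indicator {c/2..<(c+1)/2} r"
  have "2 * (\<integral>\<^sup>+r. f (bit_at r 0) (frac (2 * r)) \<partial>unif01) = 2 * (\<integral>\<^sup>+r. ?g 0 r + ?g 1 r \<partial>lborel)"
    unfolding co[OF m] by (intro arg_cong[where f="\<lambda>x. 2 * x"] nn_integral_cong) (auto simp: indicator_def)
  also have "\<dots> = (\<Sum>b\<in>UNIV. \<integral>\<^sup>+r. f b r \<partial>unif01)"
    unfolding UNIV_bool using *[of False 0] *[of True 1]
    by (subst nn_integral_add) (auto simp: co distrib_left)
  finally have "(\<Sum>b\<in>UNIV. \<integral>\<^sup>+r. f b r \<partial>unif01) / 2 = (\<integral>\<^sup>+r. f (bit_at r 0) (frac (2 * r)) \<partial>unif01) * 2 / 2"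
    by (simp only: mult.commute)
  also have "\<dots> = (\<integral>\<^sup>+r. f (bit_at r 0) (frac (2 * r)) \<partial>unif01)"
    by (rule ennreal_mult_divide_eq) auto
  finally show ?thesis by simp
qed


section \<open>Binary digits as fair coin tosses\<close>

abbreviation coin :: "bool measure" where
  "coin \<equiv> measure_pmf (bernoulli_pmf (1/2))"

lemma emeasure_coin: "emeasure coin A = (\<Sum>b\<in>UNIV. indicator A b) / 2"
proof -
  have "emeasure coin A = (\<integral>\<^sup>+b. indicator A b \<partial>coin)" by simp
  also have "\<dots> = indicator A True * ennreal (1/2) + indicator A False * ennreal (1/2)"
    by (subst nn_integral_bernoulli_pmf) simp_all
  also have "ennreal (1/2) = inverse 2"
    by (metis ennreal_numeral inverse_ennreal inverse_eq_divide zero_le_numeral zero_less_numeral)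
  finally show ?thesis
    by (simp add: UNIV_bool divide_ennreal_def distrib_right add.commute)
qed

text \<open>All digits after the first are digits of \<open>frac (2 * r)\<close>, so the induction
  hypothesis is used for the family \<open>A\<close> shifted by one.\<close>

lemma nn_integral_bits:
  "(\<integral>\<^sup>+r. (\<Prod>j<m. indicator (A j) (bit_at r j)) \<partial>unif01) = (\<Prod>j<m. emeasure coin (A j))"
proof (induction m arbitrary: A)
  case 0
  then show ?case by (simp add: unif01.emeasure_space_1[simplified])
next
  case (Suc m)
  have [measurable]: "Measurable.pred borel (\<lambda>r. bit_at r j \<in> B)" for j B
  proof -
    have "Measurable.pred (count_space UNIV) (\<lambda>b::bool. b \<in> B)" by simp
    then show ?thesis by measurable
  qed
  have [measurable]: "(\<lambda>r. indicator B (bit_at r j) :: ennreal) \<in> borel_measurable borel" for B j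
    unfolding indicator_def by measurable
  let ?f = "\<lambda>b r. indicator (A 0) b * (\<Prod>j<m. indicator (A (Suc j)) (bit_at r j)) :: ennreal"
  have "(\<integral>\<^sup>+r. (\<Prod>j<Suc m. indicator (A j) (bit_at r j)) \<partial>unif01)
     = (\<integral>\<^sup>+r. ?f (bit_at r 0) (frac (2 * r)) \<partial>unif01)"
    by (simp only: prod.lessThan_Suc_shift bit_at_Suc)
  also have "\<dots> = (\<Sum>b\<in>UNIV. \<integral>\<^sup>+r. ?f b r \<partial>unif01) / 2"
    by (rule nn_integral_unif01_bit) measurable
  also have "\<dots> = (\<Sum>b\<in>UNIV. indicator (A 0) b * (\<Prod>j<m. emeasure coin (A (Suc j)))) / 2"
    by (subst nn_integral_cmult) (simp_all only: Suc.IH[of "\<lambda>j. A (Suc j)"], measurable)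
  also have "\<dots> = emeasure coin (A 0) * (\<Prod>j<m. emeasure coin (A (Suc j)))"
    by (simp add: emeasure_coin sum_distrib_right divide_ennreal_def ac_simps)
  finally show ?case by (simp only: prod.lessThan_Suc_shift)
qed


lemma distr_bit_at:
  "distr unif01 (PiM UNIV (\<lambda>_. coin)) bit_at = PiM UNIV (\<lambda>_. coin)"
proof (rule measure_eqI_PiM_infinite)
  have m: "bit_at \<in> unif01 \<rightarrow>\<^sub>M PiM UNIV (\<lambda>_. coin)"
    by (rule measurable_PiM_single') auto
  interpret product_prob_space "\<lambda>_::nat. coin" UNIV
    by unfold_locales
  show "finite_measure (distr unif01 (PiM UNIV (\<lambda>_. coin)) bit_at)"
    by (intro finite_measure.finite_measure_distr m) unfold_locales
  fix J :: "nat set" and F :: "nat \<Rightarrow> bool set"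
  assume J: "finite J" "J \<subseteq> UNIV" "\<And>j. j \<in> J \<Longrightarrow> F j \<in> sets coin"
  obtain m where m: "J \<subseteq> {..<m}" using J(1) finite_nat_iff_bounded by blast
  \<comment> \<open>\<open>J\<close> is an arbitrary finite set of positions, while
    \<open>nn_integral_bits\<close> speaks of an initial segment; padding with \<open>UNIV\<close>
    adds only factors 1.\<close>
  define A where "A j = (if j \<in> J then F j else UNIV)" for j
  have emb: "prod_emb UNIV (\<lambda>_. coin) J (Pi\<^sub>E J F) = {\<omega>. \<forall>j<m. \<omega> j \<in> A j}"
    using m by (auto simp: prod_emb_def A_def PiE_def Pi_def)
  have meas: "prod_emb UNIV (\<lambda>_. coin) J (Pi\<^sub>E J F) \<in> sets (PiM UNIV (\<lambda>_. coin))"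
    using J by (intro sets_PiM_I) auto
  have "emeasure (distr unif01 (PiM UNIV (\<lambda>_. coin)) bit_at) (prod_emb UNIV (\<lambda>_. coin) J (Pi\<^sub>E J F))
     = emeasure unif01 {r. \<forall>j<m. bit_at r j \<in> A j}"
    using emeasure_distr[OF \<open>bit_at \<in> _\<close> meas] by (simp add: emb vimage_def)
  also have "\<dots> = (\<integral>\<^sup>+r. indicator {r. \<forall>j<m. bit_at r j \<in> A j} r \<partial>unif01)"
    by (subst nn_integral_indicator) auto
  also have "\<dots> = (\<integral>\<^sup>+r. (\<Prod>j<m. indicator (A j) (bit_at r j)) \<partial>unif01)"
    by (intro nn_integral_cong) (auto simp: indicator_def intro: prod_zero)
  also have "\<dots> = (\<Prod>j<m. emeasure coin (A j))" by (rule nn_integral_bits)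
  also have "\<dots> = (\<Prod>j\<in>J. emeasure coin (A j))"
    using m by (intro prod.mono_neutral_right) (auto simp: A_def measure_pmf.emeasure_space_1[simplified])
  also have "\<dots> = emeasure (PiM UNIV (\<lambda>_. coin)) (prod_emb UNIV (\<lambda>_. coin) J (Pi\<^sub>E J F))"
    using J by (subst emeasure_PiM_emb) (auto simp: A_def)
  finally show "emeasure (distr unif01 (PiM UNIV (\<lambda>_. coin)) bit_at) (prod_emb UNIV (\<lambda>_. coin) J (Pi\<^sub>E J F))
    = emeasure (PiM UNIV (\<lambda>_. coin)) (prod_emb UNIV (\<lambda>_. coin) J (Pi\<^sub>E J F))" .
qed simp_all

definition of_bits :: "(nat \<Rightarrow> bool) \<Rightarrow> real" where
  "of_bits \<omega> = (\<Sum>k. of_bool (\<omega> k) / 2 ^ Suc k)"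

lemma measurable_of_bits [measurable]: "of_bits \<in> borel_measurable (PiM UNIV (\<lambda>_. coin))"
proof -
  have [measurable]: "(\<lambda>\<omega>. of_bool (\<omega> k) :: real) \<in> borel_measurable (PiM UNIV (\<lambda>_. coin))" for k
    by (rule measurable_compose[OF measurable_component_singleton[of k]]) auto
  show ?thesis unfolding of_bits_def by measurable
qed

lemma of_bits_bit_at:
  assumes "0 \<le> r" "r < 1"
  shows "of_bits (bit_at r) = r"
proof -
  \<comment> \<open>The partial sums are the dyadic truncations of \<open>r\<close>, at distance at
    most 2 ^ -m from \<open>r\<close>. Digits do not see the integer part, which is why
    \<open>r\<close> is restricted to \<open>[0, 1)\<close>.\<close>
  have part: "(\<Sum>k<m. of_bool (bit_at r k) / 2 ^ Suc k) = of_int \<lfloor>2 ^ m * r\<rfloor> / (2 ^ m :: real)" for m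
  proof (induction m)
    case 0
    have "\<lfloor>r\<rfloor> = 0" using assms by linarith
    then show ?case by simp
  next
    case (Suc m)
    let ?y = "2 ^ m * r"
    have "\<lfloor>2 * ?y\<rfloor> = 2 * \<lfloor>?y\<rfloor> \<or> \<lfloor>2 * ?y\<rfloor> = 2 * \<lfloor>?y\<rfloor> + 1"
      by linarith
    then have "\<lfloor>2 * ?y\<rfloor> = 2 * \<lfloor>?y\<rfloor> + of_bool (bit_at r m)"
      by (auto simp: bit_at_def mult.assoc)
    then have "real_of_int \<lfloor>2 ^ Suc m * r\<rfloor> = 2 * real_of_int \<lfloor>?y\<rfloor> + of_bool (bit_at r m)"
      by (simp add: mult.assoc)
    then show ?case using Suc by (simp add: field_simps)
  qed
  have "(\<lambda>m. of_int \<lfloor>2 ^ m * r\<rfloor> / (2 ^ m :: real)) \<longlonglongrightarrow> r"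
  proof (rule tendsto_sandwich)
    show "\<forall>\<^sub>F m in sequentially. r - (1/2) ^ m \<le> of_int \<lfloor>2 ^ m * r\<rfloor> / (2 ^ m :: real)"
    proof (intro always_eventually allI)
      fix m
      have "2 ^ m * r - 1 \<le> of_int \<lfloor>2 ^ m * r\<rfloor>" by linarith
      then have "(2 ^ m * r - 1) / 2 ^ m \<le> of_int \<lfloor>2 ^ m * r\<rfloor> / (2 ^ m :: real)"
        by (rule divide_right_mono) simp
      then show "r - (1/2) ^ m \<le> of_int \<lfloor>2 ^ m * r\<rfloor> / (2 ^ m :: real)"
        by (simp add: diff_divide_distrib power_one_over inverse_eq_divide)
    qed
    show "\<forall>\<^sub>F m in sequentially. of_int \<lfloor>2 ^ m * r\<rfloor> / (2 ^ m :: real) \<le> r"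
      by (intro always_eventually allI) (simp add: field_simps)
    have "(\<lambda>m. r - (1/2) ^ m) \<longlonglongrightarrow> r - 0"
      by (intro tendsto_intros LIMSEQ_power_zero) simp
    then show "(\<lambda>m. r - (1/2) ^ m) \<longlonglongrightarrow> r" by simp
  qed simp
  then have "(\<lambda>k. of_bool (bit_at r k) / 2 ^ Suc k) sums r"
    unfolding sums_def part .
  then show ?thesis unfolding of_bits_def by (rule sums_unique[symmetric])
qed

text \<open>The seed is split into countably many independent uniform labels by distributing its binary
  digits along the pairing function.\<close>

definition label :: "nat \<Rightarrow> real \<Rightarrow> real" where
  "label i r = of_bits (\<lambda>k. bit_at r (prod_encode (i, k)))"

lemma measurable_bits: "bit_at \<in> unif01 \<rightarrow>\<^sub>M PiM UNIV (\<lambda>_. coin)"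
  by (rule measurable_PiM_single') auto

lemma measurable_sub_bits:
  "(\<lambda>r k. bit_at r (prod_encode (i, k))) \<in> unif01 \<rightarrow>\<^sub>M PiM UNIV (\<lambda>_. coin)"
  by (rule measurable_PiM_single') auto

lemma measurable_label [measurable]: "label i \<in> borel_measurable borel"
proof -
  have "label i \<in> borel_measurable unif01"
    unfolding label_def
    by (rule measurable_compose[OF measurable_sub_bits measurable_of_bits])
  then show ?thesis by simp
qed

text \<open>Reading a seed into digits and back is the identity almost everywhere, so fair digits
  assemble to a uniform number.\<close>

lemma distr_of_bits: "distr (PiM UNIV (\<lambda>_. coin)) borel of_bits = unif01"
proof -
  have "distr (PiM UNIV (\<lambda>_. coin)) borel of_bits
      = distr (distr unif01 (PiM UNIV (\<lambda>_. coin)) bit_at) borel of_bits"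
    by (simp only: distr_bit_at)
  also have "\<dots> = distr unif01 borel (of_bits \<circ> bit_at)"
    by (rule distr_distr) (auto simp: measurable_bits)
  also have "\<dots> = distr unif01 borel (\<lambda>r. r)"
    by (rule distr_cong_AE) (auto intro!: eventually_mono[OF AE_unif01] simp: of_bits_bit_at
      measurable_comp[OF measurable_bits measurable_of_bits])
  also have "\<dots> = unif01" by (rule distr_id2) simp
  finally show ?thesis .
qed

text \<open>Selecting the positions \<open>prod_encode (i, k)\<close> is an injective reindexing,
  which preserves the law of a fair coin sequence.\<close>

lemma distr_label: "distr unif01 borel (label i) = unif01"
proof -
  have "distr (PiM UNIV (\<lambda>_. coin)) (PiM UNIV (\<lambda>_. coin)) (\<lambda>\<omega>. \<lambda>k\<in>UNIV. \<omega> (prod_encode (i, k))) = PiM UNIV (\<lambda>_. coin)"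
    by (rule distr_PiM_reindex) (auto intro: inj_onI prob_space_measure_pmf)
  then have "unif01 = distr (distr (distr unif01 (PiM UNIV (\<lambda>_. coin)) bit_at) (PiM UNIV (\<lambda>_. coin)) (\<lambda>\<omega> k. \<omega> (prod_encode (i, k)))) borel of_bits"
    by (simp add: distr_of_bits distr_bit_at restrict_def)
  also have "\<dots> = distr unif01 borel (of_bits \<circ> ((\<lambda>\<omega> k. \<omega> (prod_encode (i, k))) \<circ> bit_at))"
    by (subst distr_distr, (auto simp: measurable_bits intro!: measurable_PiM_single' distr_distr)[2])+
       (rule refl)
  also have "of_bits \<circ> ((\<lambda>\<omega> k. \<omega> (prod_encode (i, k))) \<circ> bit_at) = label i"
    by (simp add: label_def fun_eq_iff)
  finally show ?thesis ..
qed

text \<open>Since \<open>prod_encode\<close> is injective, distinct labels are functions of disjoint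
  blocks of independent digits, hence independent; together with the marginals from
  \<open>distr_label\<close> this determines the joint law.\<close>

lemma distr_labels:
  assumes "0 < n"
  shows "distr unif01 (PiM {..<n} (\<lambda>_. unif01)) (\<lambda>r. \<lambda>i\<in>{..<n}. label i r) = PiM {..<n} (\<lambda>_. unif01)"
proof -
  let ?K = "\<lambda>i::nat. range (\<lambda>k::nat. prod_encode (i, k))"
  have "unif01.indep_vars (\<lambda>_. coin) (\<lambda>k r. bit_at r k) UNIV"
  proof (subst unif01.indep_vars_iff_distr_eq_PiM')
    have *: "distr unif01 coin (\<lambda>r. bit_at r k) = coin" for k
    proof -
      interpret product_prob_space "\<lambda>_::nat. coin" UNIV by unfold_locales
      have "distr unif01 coin (\<lambda>r. bit_at r k) = distr (distr unif01 (PiM UNIV (\<lambda>_. coin)) bit_at) coin (\<lambda>\<omega>. \<omega> k)"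
        by (subst distr_distr) (auto simp: measurable_bits comp_def)
      also have "\<dots> = coin" unfolding distr_bit_at by (rule PiM_component) simp
      finally show ?thesis .
    qed
    show "distr unif01 (PiM UNIV (\<lambda>_. coin)) (\<lambda>r. \<lambda>k\<in>UNIV. bit_at r k) = (\<Pi>\<^sub>M k\<in>UNIV. distr unif01 coin (\<lambda>r. bit_at r k))"
      unfolding * using distr_bit_at by (simp add: restrict_def)
  qed auto
  then have "unif01.indep_vars (\<lambda>i. PiM (?K i) (\<lambda>_. coin)) (\<lambda>i r. restrict (\<lambda>k. bit_at r k) (?K i)) {..<n}"
    by (rule unif01.indep_vars_restrict) (auto simp: disjoint_family_on_def)
  then have "unif01.indep_vars (\<lambda>_. unif01) (\<lambda>i r. of_bits (\<lambda>k. restrict (\<lambda>k. bit_at r k) (?K i) (prod_encode (i, k)))) {..<n}"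
  proof (rule unif01.indep_vars_compose2)
    fix i :: nat
    have "(\<lambda>\<omega> k. \<omega> (prod_encode (i, k))) \<in> PiM (?K i) (\<lambda>_. coin) \<rightarrow>\<^sub>M PiM UNIV (\<lambda>_. coin)"
      by (rule measurable_PiM_single') (auto simp: space_PiM)
    from measurable_compose[OF this measurable_of_bits]
    show "(\<lambda>\<omega>. of_bits (\<lambda>k. \<omega> (prod_encode (i, k)))) \<in> PiM (?K i) (\<lambda>_. coin) \<rightarrow>\<^sub>M unif01"
      by simp
  qed
  then have "unif01.indep_vars (\<lambda>_. unif01) label {..<n}"
    by (simp add: label_def[abs_def])
  moreover have "distr unif01 unif01 (label i) = unif01" for i
    using distr_label[of i] by (simp cong: distr_cong)
  ultimately show ?thesis
    using assms by (subst (asm) unif01.indep_vars_iff_distr_eq_PiM') (auto)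
qed

section \<open>Winning probability for fixed values\<close>

text \<open>For fixed values and labels only the ranking of the items and their threshold times
  matter, so probabilities over the arrival times are computed for an abstract ranking
  \<open>lt\<close>.\<close>

definition strict_total_on :: "'i set \<Rightarrow> ('i \<Rightarrow> 'i \<Rightarrow> bool) \<Rightarrow> bool" where
  "strict_total_on J lt \<longleftrightarrow> asymp_on J lt \<and> transp_on J lt \<and> totalp_on J lt"

lemma strict_total_on_subset: "strict_total_on J lt \<Longrightarrow> I \<subseteq> J \<Longrightarrow> strict_total_on I lt"
  unfolding strict_total_on_def
  by (blast intro: asymp_on_subset transp_on_subset totalp_on_subset)

lemma strict_total_on_max:
  assumes "finite J" "J \<noteq> {}" "strict_total_on J lt"
  shows "\<exists>b\<in>J. \<forall>j\<in>J - {b}. lt j b"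
  using Finite_Set.bex_greatest_element[OF assms(1,2), of lt] assms(3)
  unfolding strict_total_on_def by blast

text \<open>If item \<open>b\<close> is acceptable from time \<open>T b\<close> on, this says that the best item arriving before \<open>\<tau>\<close>
  (if any) was not acceptable on its arrival. For thresholds \<open>T\<close> that are antitone in the rank this
  is equivalent to a threshold rule accepting nothing before \<open>\<tau>\<close>.\<close>

definition unaccepted :: "('i \<Rightarrow> 'i \<Rightarrow> bool) \<Rightarrow> 'i set \<Rightarrow> ('i \<Rightarrow> real) \<Rightarrow> real \<Rightarrow> ('i \<Rightarrow> real) \<Rightarrow> bool" where
  "unaccepted lt J T \<tau> t \<longleftrightarrow> (\<forall>b\<in>J. t b < \<tau> \<and> T b \<le> t b \<longrightarrow> (\<exists>j\<in>J. t j < \<tau> \<and> lt b j))"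

lemma measurable_unaccepted:
  assumes "finite J" "J \<subseteq> I"
  shows "Measurable.pred (PiM I (\<lambda>_. unif01)) (unaccepted lt J T \<tau>)"
proof -
  have [measurable]: "(\<lambda>t. t j) \<in> borel_measurable (PiM I (\<lambda>_. unif01))" if "j \<in> J" for j
    using measurable_component_singleton[of j I "\<lambda>_. unif01"] that assms by auto
  show ?thesis
    unfolding unaccepted_def using assms(1)
    by (intro pred_intros_finite pred_intros_logic) measurable
qed

lemma unaccepted_insert_max:
  assumes "\<forall>j\<in>J. lt j b \<and> \<not> lt b j" "b \<notin> J" "\<not> lt b b"
  shows "unaccepted lt (insert b J) T \<tau> (t(b := y)) \<longleftrightarrow>
    (if y < \<tau> then y < T b else unaccepted lt J T \<tau> t)"
proof -
  have [simp]: "(t(b := y)) j = t j" if "j \<in> J" for j using that assms(2) by auto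
  show ?thesis
    using assms unfolding unaccepted_def by (auto simp del: fun_upd_apply simp: fun_upd_same)
qed

lemma emeasure_lborel_atLeastLessThan_min:
  assumes "0 \<le> \<tau>" "0 \<le> c"
  shows "(\<integral>\<^sup>+s. indicator {0..<\<tau>} s * indicator {..<c} s \<partial>lborel) = ennreal (min \<tau> c)"
proof -
  have "(\<integral>\<^sup>+s. indicator {0..<\<tau>} s * indicator {..<c} s \<partial>lborel) = (\<integral>\<^sup>+s. indicator {0..<min \<tau> c} s \<partial>lborel)"
    by (intro nn_integral_cong) (auto simp: indicator_def)
  also have "\<dots> = ennreal (min \<tau> c)" using assms by simp
  finally show ?thesis .
qed

text \<open>The induction removes the best item \<open>b\<close>: if it arrives before \<open>\<tau>\<close> the event is just
  \<open>t b < T b\<close>, otherwise \<open>b\<close> is irrelevant.\<close>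

theorem nn_integral_unaccepted:
  fixes T :: "'i \<Rightarrow> real"
  assumes "finite J" "strict_total_on J lt" "\<And>i j. i \<in> J \<Longrightarrow> j \<in> J \<Longrightarrow> lt i j \<Longrightarrow> T j \<le> T i"
    and "\<And>i. i \<in> J \<Longrightarrow> 0 \<le> T i" and \<tau>: "0 < \<tau>" "\<tau> \<le> 1"
  shows "ennreal \<tau> * (\<integral>\<^sup>+t. indicator {t. unaccepted lt J T \<tau> t} t \<partial>PiM J (\<lambda>_. unif01))
    = (\<integral>\<^sup>+s. indicator {0..<\<tau>} s * ennreal (\<Prod>j\<in>J. 1 - \<tau> * of_bool (T j \<le> s)) \<partial>lborel)"
  using assms(1-4)
proof (induction "card J" arbitrary: J)
  case 0
  interpret prob_space "PiM {} (\<lambda>_::'i. unif01)" by (intro prob_space_PiM prob_space_unif01)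
  from 0 have "J = {}" by simp
  then show ?case
    using \<tau> emeasure_space_1 by (simp add: unaccepted_def)
next
  case (Suc m)
  then obtain b where b: "b \<in> J" "\<forall>j\<in>J - {b}. lt j b"
    using strict_total_on_max[of J lt] by fastforce
  define J' where "J' = J - {b}"
  have J: "J = insert b J'" "b \<notin> J'" "finite J'" "card J' = m"
    using b Suc.hyps(2) Suc.prems(1) by (auto simp: J'_def)
  have tot: "strict_total_on J' lt"
    using Suc.prems(2) J(1) strict_total_on_subset by blast
  have max: "\<forall>j\<in>J'. lt j b \<and> \<not> lt b j" "\<not> lt b b"
    using b Suc.prems(2) J(1) unfolding strict_total_on_def J'_def by (auto dest: asymp_onD)
  have Tb: "T b \<le> T j" if "j \<in> J'" for j
    using that Suc.prems(3)[of j b] b by (auto simp: J'_def)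
  define L where "L = (\<integral>\<^sup>+t. indicator {t. unaccepted lt J' T \<tau> t} t \<partial>PiM J' (\<lambda>_. unif01))"
  define p where "p s = (\<Prod>j\<in>J'. 1 - \<tau> * of_bool (T j \<le> s))" for s
  have p0: "0 \<le> p s" for s unfolding p_def using \<tau> by (intro prod_nonneg) auto
  have IH: "ennreal \<tau> * L = (\<integral>\<^sup>+s. indicator {0..<\<tau>} s * ennreal (p s) \<partial>lborel)"
    unfolding L_def p_def using Suc.hyps(1)[of J'] Suc.prems J tot by auto
  have [measurable]: "p \<in> borel_measurable borel"
    unfolding p_def[abs_def] by measurable
  interpret product_sigma_finite "\<lambda>_::'i. unif01" by unfold_locales
  interpret P: prob_space "PiM J' (\<lambda>_::'i. unif01)" by (intro prob_space_PiM prob_space_unif01)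
  have mJ: "(indicator {t. unaccepted lt (insert b J') T \<tau> t} :: _ \<Rightarrow> ennreal) \<in> borel_measurable (PiM (insert b J') (\<lambda>_. unif01))"
    using measurable_unaccepted[of "insert b J'" "insert b J'" lt T \<tau>] J(3)
    by (intro borel_measurable_indicator') (auto simp: pred_def)
  have "(\<integral>\<^sup>+t. indicator {t. unaccepted lt J T \<tau> t} t \<partial>PiM J (\<lambda>_. unif01))
     = (\<integral>\<^sup>+y. (\<integral>\<^sup>+t. indicator {t. unaccepted lt J T \<tau> t} (t(b := y)) \<partial>PiM J' (\<lambda>_. unif01)) \<partial>unif01)"
    unfolding J(1) by (rule product_nn_integral_insert_rev) (use J mJ in auto)
  also have "\<dots> = (\<integral>\<^sup>+y. indicator {..<\<tau>} y * indicator {..<T b} y + indicator {\<tau>..} y * L \<partial>unif01)"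
  proof (rule nn_integral_cong)
    fix y
    have "(\<integral>\<^sup>+t. indicator {t. unaccepted lt J T \<tau> t} (t(b := y)) \<partial>PiM J' (\<lambda>_. unif01))
      = (\<integral>\<^sup>+t. (if y < \<tau> then indicator {..<T b} y else indicator {t. unaccepted lt J' T \<tau> t} t) \<partial>PiM J' (\<lambda>_. unif01))"
      unfolding J(1) using unaccepted_insert_max[OF max(1) J(2) max(2), of T \<tau> _ y]
      by (intro nn_integral_cong) (simp add: indicator_def)
    also have "\<dots> = indicator {..<\<tau>} y * indicator {..<T b} y + indicator {\<tau>..} y * L"
      by (simp add: L_def P.emeasure_space_1 indicator_def)
    finally show "(\<integral>\<^sup>+t. indicator {t. unaccepted lt J T \<tau> t} (t(b := y)) \<partial>PiM J' (\<lambda>_. unif01))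
      = indicator {..<\<tau>} y * indicator {..<T b} y + indicator {\<tau>..} y * L" .
  qed
  also have "\<dots> = (\<integral>\<^sup>+y. indicator {0..<\<tau>} y * indicator {..<T b} y + indicator {\<tau>..1} y * L \<partial>lborel)"
    using \<tau> by (subst nn_integral_unif01) (auto intro!: nn_integral_cong simp: indicator_def)
  also have "\<dots> = ennreal (min \<tau> (T b)) + ennreal (1 - \<tau>) * L"
    using \<tau> Suc.prems(4) b
    by (subst nn_integral_add) (simp_all add: emeasure_lborel_atLeastLessThan_min nn_integral_multc)
  finally have *: "(\<integral>\<^sup>+t. indicator {t. unaccepted lt J T \<tau> t} t \<partial>PiM J (\<lambda>_. unif01))
     = ennreal (min \<tau> (T b)) + ennreal (1 - \<tau>) * L" .
  have "(\<integral>\<^sup>+s. indicator {0..<\<tau>} s * ennreal (\<Prod>j\<in>J. 1 - \<tau> * of_bool (T j \<le> s)) \<partial>lborel)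
     = (\<integral>\<^sup>+s. ennreal \<tau> * (indicator {0..<\<tau>} s * indicator {..<T b} s)
          + ennreal (1 - \<tau>) * (indicator {0..<\<tau>} s * ennreal (p s)) \<partial>lborel)"
  proof (rule nn_integral_cong)
    fix s
    have e: "(\<Prod>j\<in>J. 1 - \<tau> * of_bool (T j \<le> s)) = (1 - \<tau> * of_bool (T b \<le> s)) * p s"
      using J by (simp add: p_def)
    show "indicator {0..<\<tau>} s * ennreal (\<Prod>j\<in>J. 1 - \<tau> * of_bool (T j \<le> s))
      = ennreal \<tau> * (indicator {0..<\<tau>} s * indicator {..<T b} s)
          + ennreal (1 - \<tau>) * (indicator {0..<\<tau>} s * ennreal (p s))"
    \<comment> \<open>The best item has the smallest threshold, so for \<open>s < T b\<close> no
      threshold is at most \<open>s\<close> and the product over the other items is 1.\<close>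
    proof (cases "s < T b")
      case True
      then have "p s = 1" unfolding p_def using Tb by (intro prod.neutral) force
      then show ?thesis using True \<tau> e
        by (auto simp: indicator_def ennreal_plus[symmetric] simp del: ennreal_plus)
    next
      case False
      then show ?thesis using \<tau> e p0[of s]
        by (auto simp: indicator_def ennreal_mult)
    qed
  qed
  also have "\<dots> = ennreal \<tau> * ennreal (min \<tau> (T b)) + ennreal (1 - \<tau>) * (ennreal \<tau> * L)"
    using \<tau> Suc.prems(4) b unfolding IH
    by (subst nn_integral_add) (simp_all add: emeasure_lborel_atLeastLessThan_min nn_integral_cmult)
  finally show ?case unfolding * by (simp add: distrib_left ac_simps)
qed

text \<open>Refers to ranking, thresholds and arrival times only, not to the run of the rule;
  \<open>accepted_value_if_winning\<close> shows that in this event the run does stop at the best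
  item.\<close>

definition winning :: "nat \<Rightarrow> (nat \<Rightarrow> nat \<Rightarrow> bool) \<Rightarrow> (nat \<Rightarrow> real) \<Rightarrow> (nat \<Rightarrow> real) \<Rightarrow> bool" where
  "winning n lt T t \<longleftrightarrow> (\<exists>i<n. (\<forall>j<n. j \<noteq> i \<longrightarrow> lt j i) \<and> T i \<le> t i
     \<and> unaccepted lt ({..<n} - {i}) T (t i) t)"

text \<open>The arrival time \<open>y\<close> of the best item is integrated last; for fixed
  \<open>y\<close> the other items are handled by \<open>nn_integral_unaccepted\<close> with
  \<open>\<tau> = y\<close>. The null event \<open>y = 0\<close> is excluded because the formula is
  divided by \<open>y\<close>.\<close>

theorem nn_integral_winning:
  assumes tot: "strict_total_on {..<n} lt"
    and anti: "\<And>i j. i < n \<Longrightarrow> j < n \<Longrightarrow> lt i j \<Longrightarrow> T j \<le> T i"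
    and T0: "\<And>i. i < n \<Longrightarrow> 0 \<le> T i"
    and i: "i < n" "\<And>j. j < n \<Longrightarrow> j \<noteq> i \<Longrightarrow> lt j i"
    and meas: "Measurable.pred (PiM {..<n} (\<lambda>_. unif01)) (winning n lt T)"
  shows "(\<integral>\<^sup>+\<tau>. indicator {T i..1} \<tau> * ((\<integral>\<^sup>+s. indicator {0..<\<tau>} s *
        ennreal (\<Prod>j\<in>{..<n}-{i}. 1 - \<tau> * of_bool (T j \<le> s)) \<partial>lborel) / ennreal \<tau>) \<partial>lborel)
    \<le> (\<integral>\<^sup>+t. indicator {t. winning n lt T t} t \<partial>PiM {..<n} (\<lambda>_. unif01))"
proof -
  define J' where "J' = {..<n} - {i}"
  have J: "{..<n} = insert i J'" "i \<notin> J'" "finite J'" using i by (auto simp: J'_def)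
  have tot': "strict_total_on J' lt"
    unfolding J'_def by (rule strict_total_on_subset[OF tot]) auto
  interpret product_sigma_finite "\<lambda>_::nat. unif01" by unfold_locales
  have mJ: "(indicator {t. winning n lt T t} :: _ \<Rightarrow> ennreal) \<in> borel_measurable (PiM (insert i J') (\<lambda>_. unif01))"
    using meas unfolding J(1)
    by (intro borel_measurable_indicator') (auto simp: pred_def)
  have m1 [measurable]: "Measurable.pred (borel \<Otimes>\<^sub>M borel) (\<lambda>x::real\<times>real. T j \<le> snd x)" for j
    by measurable
  have m2 [measurable]: "(\<lambda>(\<tau>,s). indicator {0..<\<tau>} s * ennreal (\<Prod>j\<in>J'. 1 - \<tau> * of_bool (T j \<le> s))) \<in> borel_measurable (borel \<Otimes>\<^sub>M (lborel :: real measure))"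
    unfolding indicator_def atLeastLessThan_iff by measurable
  let ?R = "\<lambda>\<tau>. (\<integral>\<^sup>+s. indicator {0..<\<tau>} s * ennreal (\<Prod>j\<in>J'. 1 - \<tau> * of_bool (T j \<le> s)) \<partial>lborel)"
  have [measurable]: "?R \<in> borel_measurable borel"
    by (rule lborel.borel_measurable_nn_integral) (use m2 in simp)
  have "(\<integral>\<^sup>+\<tau>. indicator {T i..1} \<tau> * (?R \<tau> / ennreal \<tau>) \<partial>lborel)
      = (\<integral>\<^sup>+\<tau>. indicator {T i..1} \<tau> * (?R \<tau> / ennreal \<tau>) \<partial>unif01)"
    using T0[OF i(1)] by (subst nn_integral_unif01) (auto intro!: nn_integral_cong simp: indicator_def)
  also have "\<dots> \<le> (\<integral>\<^sup>+y. (\<integral>\<^sup>+t. indicator {t. winning n lt T t} (t(i := y)) \<partial>PiM J' (\<lambda>_. unif01)) \<partial>unif01)"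
  proof (rule nn_integral_mono_AE, rule eventually_mono[OF AE_unif01])
    fix y :: real assume y: "0 < y \<and> y < 1"
    let ?L = "\<integral>\<^sup>+t. indicator {t. unaccepted lt J' T y t} t \<partial>PiM J' (\<lambda>_. unif01)"
    have "ennreal y * ?L = ?R y"
    proof (rule nn_integral_unaccepted[OF J(3) tot'])
      show "T j \<le> T k" if "k \<in> J'" "j \<in> J'" "lt k j" for k j
        using that anti[of k j] by (simp add: J'_def)
      show "0 \<le> T k" if "k \<in> J'" for k
        using that T0[of k] by (simp add: J'_def)
    qed (use y in simp_all)
    then have "?R y / ennreal y = ?L * ennreal y / ennreal y" by (simp add: mult.commute)
    also have "\<dots> = ?L" using y by (intro ennreal_mult_divide_eq) auto
    finally have e: "?R y / ennreal y = ?L" .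
    have "indicator {T i..1} y * ?L \<le> (\<integral>\<^sup>+t. indicator {T i..1} y * indicator {t. unaccepted lt J' T y t} t \<partial>PiM J' (\<lambda>_. unif01))"
      by (auto simp: indicator_def)
    also have "\<dots> \<le> (\<integral>\<^sup>+t. indicator {t. winning n lt T t} (t(i := y)) \<partial>PiM J' (\<lambda>_. unif01))"
    proof (rule nn_integral_mono)
      fix t
      have "winning n lt T (t(i := y))" if "T i \<le> y" "unaccepted lt J' T y t"
      proof -
        have "unaccepted lt J' T y (t(i := y))"
          using that(2) J(2) unfolding unaccepted_def by (metis fun_upd_other)
        then show ?thesis unfolding winning_def using i that by (auto intro!: exI[of _ i] simp: J'_def)
      qed
      then show "indicator {T i..1} y * indicator {t. unaccepted lt J' T y t} t \<le> (indicator {t. winning n lt T t} (t(i := y)) :: ennreal)"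
        by (auto simp: indicator_def)
    qed
    finally show "indicator {T i..1} y * (?R y / ennreal y) \<le> (\<integral>\<^sup>+t. indicator {t. winning n lt T t} (t(i := y)) \<partial>PiM J' (\<lambda>_. unif01))"
      unfolding e .
  qed
  also have "\<dots> = (\<integral>\<^sup>+t. indicator {t. winning n lt T t} t \<partial>PiM {..<n} (\<lambda>_. unif01))"
    unfolding J(1) by (rule product_nn_integral_insert_rev[symmetric]) (use J mJ in auto)
  finally show ?thesis unfolding J'_def .
qed

lemma nn_integral_winning_ge_negxlnx:
  assumes tot: "strict_total_on {..<n} lt"
    and anti: "\<And>i j. i < n \<Longrightarrow> j < n \<Longrightarrow> lt i j \<Longrightarrow> T j \<le> T i"
    and T0: "\<And>i. i < n \<Longrightarrow> 0 \<le> T i"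
    and i: "i < n" "\<And>j. j < n \<Longrightarrow> j \<noteq> i \<Longrightarrow> lt j i" and T1: "T i \<le> 1"
    and meas: "Measurable.pred (PiM {..<n} (\<lambda>_. unif01)) (winning n lt T)"
  shows "ennreal (negxlnx (T i)) \<le> (\<integral>\<^sup>+t. indicator {t. winning n lt T t} t \<partial>PiM {..<n} (\<lambda>_. unif01))"
proof (cases "T i = 0")
  case True
  then show ?thesis by (simp add: negxlnx_def)
next
  case False
  then have pos: "0 < T i" using T0[OF i(1)] by simp
  have "ennreal (negxlnx (T i)) = ennreal (T i * ln 1 - T i * ln (T i))"
    using False by (simp add: negxlnx_def)
  also have "\<dots> = (\<integral>\<^sup>+\<tau>. ennreal (T i / \<tau>) * indicator {T i..1} \<tau> \<partial>lborel)"
    using pos T1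
    by (intro nn_integral_FTC_Icc[symmetric])
       (auto intro!: derivative_eq_intros simp: has_real_derivative_iff_has_vector_derivative[symmetric])
  also have "\<dots> \<le> (\<integral>\<^sup>+\<tau>. indicator {T i..1} \<tau> * ((\<integral>\<^sup>+s. indicator {0..<\<tau>} s *
        ennreal (\<Prod>j\<in>{..<n}-{i}. 1 - \<tau> * of_bool (T j \<le> s)) \<partial>lborel) / ennreal \<tau>) \<partial>lborel)"
  proof (rule nn_integral_mono)
    fix \<tau> :: real
    show "ennreal (T i / \<tau>) * indicator {T i..1} \<tau> \<le> indicator {T i..1} \<tau> * ((\<integral>\<^sup>+s. indicator {0..<\<tau>} s *
        ennreal (\<Prod>j\<in>{..<n}-{i}. 1 - \<tau> * of_bool (T j \<le> s)) \<partial>lborel) / ennreal \<tau>)"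
    proof (cases "\<tau> \<in> {T i..1}")
      case True
      have "ennreal (T i) = (\<integral>\<^sup>+s. indicator {0..<T i} s \<partial>lborel)" using pos by simp
      also have "\<dots> \<le> (\<integral>\<^sup>+s. indicator {0..<\<tau>} s *
        ennreal (\<Prod>j\<in>{..<n}-{i}. 1 - \<tau> * of_bool (T j \<le> s)) \<partial>lborel)"
      proof (rule nn_integral_mono)
        fix s
        have "(\<Prod>j\<in>{..<n}-{i}. 1 - \<tau> * of_bool (T j \<le> s)) = 1" if "s < T i"
          using that anti[OF _ i(1) i(2)] by (intro prod.neutral) force
        then show "indicator {0..<T i} s \<le> indicator {0..<\<tau>} s *
          ennreal (\<Prod>j\<in>{..<n}-{i}. 1 - \<tau> * of_bool (T j \<le> s))"
          using True by (auto simp: indicator_def)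
      qed
      finally have "ennreal (T i) / ennreal \<tau> \<le> (\<integral>\<^sup>+s. indicator {0..<\<tau>} s *
        ennreal (\<Prod>j\<in>{..<n}-{i}. 1 - \<tau> * of_bool (T j \<le> s)) \<partial>lborel) / ennreal \<tau>"
        by (rule divide_right_mono_ennreal)
      moreover have "ennreal (T i) / ennreal \<tau> = ennreal (T i / \<tau>)"
        using True pos by (intro divide_ennreal) auto
      ultimately show ?thesis using True by simp
    qed simp
  qed
  also have "\<dots> \<le> (\<integral>\<^sup>+t. indicator {t. winning n lt T t} t \<partial>PiM {..<n} (\<lambda>_. unif01))"
    by (rule nn_integral_winning) (use assms in auto)
  finally show ?thesis .
qed

section \<open>Threshold rules with random tie-breaking\<close>

definition key_less :: "real \<times> real \<Rightarrow> real \<times> real \<Rightarrow> bool" where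
  "key_less a b \<longleftrightarrow> fst a < fst b \<or> fst a = fst b \<and> snd a < snd b"

text \<open>The \<open>k\<close>-th arrival gets the \<open>k\<close>-th label, which breaks ties between equal values. Ties have to be broken
  by fresh randomness: comparing values only, strictly or weakly, is not robust for priors with atoms.\<close>

definition threshold_rule :: "(real \<times> real \<Rightarrow> real) \<Rightarrow> stop_rule" where
  "threshold_rule T r h = (let m = length h - 1; z = (\<lambda>k. (snd (h ! k), label k r)) in
     (\<forall>k<m. key_less (z k) (z m)) \<and> T (z m) \<le> fst (h ! m))"

section \<open>The run of a threshold rule on fixed values and times\<close>

lemma arrival_order_props:
  "length (arrival_order n t) = n" "distinct (arrival_order n t)" "set (arrival_order n t) = {..<n}"
  "sorted (map t (arrival_order n t))"
  by (auto simp: arrival_order_def)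

lemma bij_arrival_order: "bij_betw ((!) (arrival_order n t)) {..<n} {..<n}"
  using bij_betw_nth[OF arrival_order_props(2)] by (simp add: arrival_order_props)

text \<open>Item indices are invisible to the rule, so the label of item \<open>i\<close> is the one
  numbered by its arrival position, given by the inverse of the permutation
  \<open>arrival_order\<close>.\<close>

definition arrival_pos :: "nat \<Rightarrow> (nat \<Rightarrow> real) \<Rightarrow> nat \<Rightarrow> nat" where
  "arrival_pos n t = inv_into {..<n} ((!) (arrival_order n t))"

lemma bij_arrival_pos: "bij_betw (arrival_pos n t) {..<n} {..<n}"
  unfolding arrival_pos_def by (rule bij_betw_inv_into[OF bij_arrival_order])

lemma arrival_pos_nth: "k < n \<Longrightarrow> arrival_pos n t (arrival_order n t ! k) = k"
  unfolding arrival_pos_def by (rule bij_betw_inv_into_left[OF bij_arrival_order]) simp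

lemma nth_arrival_pos: "i < n \<Longrightarrow> arrival_order n t ! arrival_pos n t i = i"
  unfolding arrival_pos_def by (rule bij_betw_inv_into_right[OF bij_arrival_order]) simp

lemma arrival_pos_less: "i < n \<Longrightarrow> arrival_pos n t i < n"
  using bij_arrival_pos[of n t] by (auto simp: bij_betw_def)

lemma threshold_rule_history:
  fixes n k :: nat and x t :: "nat \<Rightarrow> real"
  assumes "k < n"
  defines "\<sigma> \<equiv> arrival_order n t"
  shows "threshold_rule T r (history n x t k) \<longleftrightarrow>
    (\<forall>m<k. key_less (x (\<sigma> ! m), label m r) (x (\<sigma> ! k), label k r))
    \<and> T (x (\<sigma> ! k), label k r) \<le> t (\<sigma> ! k)"
proof -
  have l: "length (history n x t k) = Suc k"
    using assms(1) by (simp add: history_def arrival_order_props)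
  have h: "history n x t k ! m = (t (\<sigma> ! m), x (\<sigma> ! m))" if "m \<le> k" for m
    using that assms(1) by (simp add: history_def arrival_order_props \<sigma>_def)
  show ?thesis unfolding threshold_rule_def Let_def l by (auto simp: h)
qed

text \<open>Suppose the run stops at \<open>j0\<close> before the best item \<open>i\<close>, and
  let \<open>b\<close> be the best item arriving before \<open>i\<close>. Being unaccepted,
  \<open>b\<close> arrives before its threshold, so it differs from \<open>j0\<close> and beats it.
  As \<open>j0\<close> was a record, \<open>b\<close> arrives no earlier than \<open>j0\<close>, and
  antitone thresholds give T b \<le> T j0 \<le> t j0 \<le> t b, a contradiction.\<close>

lemma accepted_value_if_winning:
  fixes n :: nat and x t u :: "nat \<Rightarrow> real" and r :: real and T :: "real \<times> real \<Rightarrow> real"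
  defines "z \<equiv> \<lambda>i. (x i, u i)"
  defines "lt \<equiv> \<lambda>i j. key_less (z i) (z j)"
  assumes u: "\<And>i. i < n \<Longrightarrow> u i = label (arrival_pos n t i) r"
    and inj: "inj_on t {..<n}" and tot: "strict_total_on {..<n} lt"
    and anti: "\<And>a b. key_less a b \<Longrightarrow> T b \<le> T a"
    and nonneg: "\<And>i. i < n \<Longrightarrow> 0 \<le> x i"
    and win: "winning n lt (\<lambda>i. T (z i)) t"
  shows "accepted_value n (threshold_rule T) r x t = opt_value n x"
proof -
  define \<sigma> where "\<sigma> = arrival_order n t"
  note \<sigma> = arrival_order_props[where n=n and t=t, folded \<sigma>_def]
  let ?acc = "\<lambda>k. threshold_rule T r (history n x t k)"
  have \<sigma>n: "\<sigma> ! k < n" if "k < n" for k using that \<sigma> nth_mem by fastforce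
  have u\<sigma>: "u (\<sigma> ! m) = label m r" if "m < n" for m
    using u[OF \<sigma>n[OF that]] arrival_pos_nth[OF that] by (simp add: \<sigma>_def)
  have acc: "?acc k \<longleftrightarrow> (\<forall>m<k. lt (\<sigma> ! m) (\<sigma> ! k)) \<and> T (z (\<sigma> ! k)) \<le> t (\<sigma> ! k)" if "k < n" for k
    using that threshold_rule_history[OF that, of T r x t]
    by (auto simp: lt_def z_def u\<sigma> simp flip: \<sigma>_def)
  obtain i where i: "i < n" "\<And>j. j < n \<Longrightarrow> j \<noteq> i \<Longrightarrow> lt j i" "T (z i) \<le> t i"
    and un: "unaccepted lt ({..<n} - {i}) (\<lambda>i. T (z i)) (t i) t"
    using win unfolding winning_def by blast
  obtain ki where ki: "ki < n" "\<sigma> ! ki = i"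
    using i(1) nth_arrival_pos arrival_pos_less unfolding \<sigma>_def by blast
  have eq_idx: "m = k" if "m < n" "k < n" "\<sigma> ! m = \<sigma> ! k" for m k
    using that \<sigma> by (simp add: nth_eq_iff_index_eq)
  have acc_ki: "?acc ki"
    unfolding acc[OF ki(1)] using i ki \<sigma>n eq_idx by (metis order.strict_trans less_irrefl)
  define k0 where "k0 = (LEAST k. k < n \<and> ?acc k)"
  have k0: "k0 < n" "?acc k0" "k0 \<le> ki"
    using LeastI[of "\<lambda>k. k < n \<and> ?acc k" ki] Least_le[of "\<lambda>k. k < n \<and> ?acc k" ki] acc_ki ki(1)
    by (auto simp: k0_def)
  have asym: "\<not> lt b a" if "lt a b" "a < n" "b < n" for a b
    using tot that unfolding strict_total_on_def by (auto dest: asymp_onD)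
  have mono: "t (\<sigma> ! m) \<le> t (\<sigma> ! k)" if "m \<le> k" "k < n" for m k
    using sorted_nth_mono[OF \<sigma>(4), of m k] that \<sigma>(1) by simp
  have "k0 = ki"
  proof (rule ccontr)
    assume "k0 \<noteq> ki"
    then have lt0: "k0 < ki" using k0 by simp
    define j0 where "j0 = \<sigma> ! k0"
    have j0: "j0 < n" "j0 \<noteq> i" using \<sigma>n[OF k0(1)] k0(1) eq_idx[of k0 ki] lt0 ki by (auto simp: j0_def)
    have tj0: "t j0 < t i"
      using mono[of k0 ki] lt0 ki j0 i(1) inj_onD[OF inj, of j0 i] by (force simp: j0_def)
    define B where "B = {j\<in>{..<n} - {i}. t j < t i}"
    have B: "finite B" "B \<noteq> {}" "B \<subseteq> {..<n}" using j0 tj0 by (auto simp: B_def)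
    obtain b where b: "b \<in> B" "\<And>j. j \<in> B \<Longrightarrow> j \<noteq> b \<Longrightarrow> lt j b"
      using strict_total_on_max[OF B(1,2) strict_total_on_subset[OF tot B(3)]] by auto
    have bn: "b < n" "b \<noteq> i" "t b < t i" using b by (auto simp: B_def)
    have "\<not> T (z b) \<le> t b"
    proof
      assume "T (z b) \<le> t b"
      then obtain j where j: "j \<in> {..<n} - {i}" "t j < t i" "lt b j"
        using un bn unfolding unaccepted_def by blast
      then have "j \<in> B" by (auto simp: B_def)
      moreover have "j \<noteq> b" using j asym bn by blast
      ultimately show False using b(2) asym j bn by blast
    qed
    moreover have acc0: "\<forall>m<k0. lt (\<sigma> ! m) j0" "T (z j0) \<le> t j0"
      using k0(2) acc[OF k0(1)] by (auto simp: j0_def)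
    ultimately have "b \<noteq> j0" by auto
    then have jb: "lt j0 b" using b(2)[of j0] j0 tj0 by (auto simp: B_def)
    then have "T (z b) \<le> T (z j0)" using anti by (auto simp: lt_def)
    obtain m where m: "m < n" "\<sigma> ! m = b"
      using bn nth_arrival_pos arrival_pos_less unfolding \<sigma>_def by blast
    have "\<not> m < k0" using acc0(1) m jb asym j0 bn by blast
    then have "t j0 \<le> t b" using mono[of k0 m] m by (simp add: j0_def)
    then show False using \<open>\<not> T (z b) \<le> t b\<close> \<open>T (z b) \<le> T (z j0)\<close> acc0(2) by simp
  qed
  then have "accepted_value n (threshold_rule T) r x t = x i"
    using k0 ki unfolding accepted_value_def k0_def \<sigma>_def by auto
  also have "x i = opt_value n x"
  proof -
    have "x j \<le> x i" if "j < n" for j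
      using i(2)[OF that] by (cases "j = i") (auto simp: lt_def z_def key_less_def)
    then show ?thesis
      unfolding opt_value_def using i(1) nonneg by (intro Max_eqI[symmetric]) auto
  qed
  finally show ?thesis .
qed

text \<open>Outside \<open>I\<close> the component is the constant \<open>undefined\<close>, so the
  claim holds for every index and later measurability proofs carry no index conditions.\<close>

lemma measurable_PiM_component_real:
  assumes "sets M = sets (borel :: real measure)"
  shows "(\<lambda>x. x i) \<in> borel_measurable (PiM I (\<lambda>_. M))"
proof (cases "i \<in> I")
  case True
  then show ?thesis
    using measurable_component_singleton[of i I "\<lambda>_. M"]
    by (simp add: measurable_cong_sets[OF refl assms[symmetric]])
next
  case False
  then have "x i = undefined" if "x \<in> space (PiM I (\<lambda>_. M))" for x
    using that by (auto simp: space_PiM PiE_def extensional_def)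
  then show ?thesis by (subst measurable_cong[of _ _ "\<lambda>_. undefined"]) auto
qed

text \<open>With all other coordinates fixed, one coordinate hits a given value with probability 0.
  This serves arrival times and labels alike.\<close>

lemma AE_PiM_unif01_inj:
  fixes n :: nat
  shows "AE t in PiM {..<n} (\<lambda>_. unif01). inj_on t {..<n}"
proof -
  interpret product_sigma_finite "\<lambda>_::nat. unif01" by unfold_locales
  have "AE t in PiM {..<n} (\<lambda>_. unif01). t i \<noteq> t j" if ij: "i < n" "j < n" "i \<noteq> j" for i j
  proof -
    define K where "K = {..<n} - {i}"
    have J: "{..<n} = insert i K" "finite K" "i \<notin> K" using ij by (auto simp: K_def)
    let ?A = "{t \<in> space (PiM (insert i K) (\<lambda>_. unif01)). t i = t j}"
    have [measurable]: "(\<lambda>t. t k) \<in> borel_measurable (PiM (insert i K) (\<lambda>_. unif01))" for k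
      by (rule measurable_PiM_component_real) simp
    have m: "?A \<in> sets (PiM (insert i K) (\<lambda>_. unif01))"
      by measurable
    have "emeasure (PiM (insert i K) (\<lambda>_. unif01)) ?A = (\<integral>\<^sup>+t. indicator ?A t \<partial>PiM (insert i K) (\<lambda>_. unif01))"
      by (rule nn_integral_indicator[OF m, symmetric])
    also have "\<dots> = (\<integral>\<^sup>+t. (\<integral>\<^sup>+y. indicator ?A (t(i := y)) \<partial>unif01) \<partial>PiM K (\<lambda>_. unif01))"
      by (rule product_nn_integral_insert[OF J(2,3)]) (rule borel_measurable_indicator[OF m])
    also have "\<dots> \<le> (\<integral>\<^sup>+t. (\<integral>\<^sup>+y. indicator {t j} y \<partial>unif01) \<partial>PiM K (\<lambda>_. unif01))"
      using ij by (intro nn_integral_mono) (auto simp: indicator_def)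
    also have "\<dots> = 0" by (simp add: emeasure_unif01_singleton)
    finally show ?thesis
      unfolding J(1) by (subst AE_iff_measurable[OF m]) auto
  qed
  then have "AE t in PiM {..<n} (\<lambda>_. unif01). \<forall>i\<in>{..<n}. \<forall>j\<in>{..<n}. i \<noteq> j \<longrightarrow> t i \<noteq> t j"
    by (intro AE_finite_allI finite_lessThan) auto
  then show ?thesis by eventually_elim (auto simp: inj_on_def)
qed

text \<open>For fixed arrival times \<open>\<pi>\<close> is the map from items to arrival positions;
  permuting i.i.d. labels keeps their law, so the labels are i.i.d. when indexed by item.\<close>

lemma distr_permuted_labels:
  assumes "0 < n" and \<pi>: "bij_betw \<pi> {..<n} {..<n}"
  shows "distr unif01 (PiM {..<n} (\<lambda>_. unif01)) (\<lambda>r. \<lambda>i\<in>{..<n}. label (\<pi> i) r) = PiM {..<n} (\<lambda>_. unif01)"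
proof -
  let ?P = "PiM {..<n} (\<lambda>_. unif01)"
  have \<pi>n: "\<pi> i < n" if "i < n" for i using \<pi> that by (auto simp: bij_betw_def)
  have m: "(\<lambda>r. \<lambda>i\<in>{..<n}. label i r) \<in> unif01 \<rightarrow>\<^sub>M ?P"
    by (rule measurable_restrict) auto
  have m': "(\<lambda>\<omega>. \<lambda>i\<in>{..<n}. \<omega> (\<pi> i)) \<in> ?P \<rightarrow>\<^sub>M ?P"
    by (rule measurable_restrict) (auto intro!: measurable_component_singleton \<pi>n)
  have "?P = distr ?P ?P (\<lambda>\<omega>. \<lambda>i\<in>{..<n}. \<omega> (\<pi> i))"
    using distr_PiM_reindex[of "{..<n}" "\<lambda>_. unif01" \<pi> "{..<n}"] \<pi> prob_space_unif01 \<pi>n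
    by (auto simp: bij_betw_def Pi_def)
  also have "\<dots> = distr (distr unif01 ?P (\<lambda>r. \<lambda>i\<in>{..<n}. label i r)) ?P (\<lambda>\<omega>. \<lambda>i\<in>{..<n}. \<omega> (\<pi> i))"
    by (simp only: distr_labels[OF assms(1)])
  also have "\<dots> = distr unif01 ?P ((\<lambda>\<omega>. \<lambda>i\<in>{..<n}. \<omega> (\<pi> i)) \<circ> (\<lambda>r. \<lambda>i\<in>{..<n}. label i r))"
    by (rule distr_distr[OF m' m])
  also have "((\<lambda>\<omega>. \<lambda>i\<in>{..<n}. \<omega> (\<pi> i)) \<circ> (\<lambda>r. \<lambda>i\<in>{..<n}. label i r)) = (\<lambda>r. \<lambda>i\<in>{..<n}. label (\<pi> i) r)"
    using \<pi>n by (auto simp: fun_eq_iff)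
  finally show ?thesis ..
qed

lemma measurable_key_less:
  assumes [measurable]: "f \<in> borel_measurable M" "g \<in> borel_measurable M" "f' \<in> borel_measurable M" "g' \<in> borel_measurable M"
  shows "Measurable.pred M (\<lambda>\<omega>. key_less (f \<omega>, g \<omega>) (f' \<omega>, g' \<omega>))"
  unfolding key_less_def fst_conv snd_conv by measurable

lemma measurable_winning:
  assumes "\<And>i. X i \<in> borel_measurable M" "\<And>i. U i \<in> borel_measurable M" "\<And>i. t i \<in> borel_measurable M"
    and T: "T \<in> borel_measurable borel"
  shows "Measurable.pred M (\<lambda>\<omega>. winning n (\<lambda>i j. key_less (X i \<omega>, U i \<omega>) (X j \<omega>, U j \<omega>))
    (\<lambda>i. T (X i \<omega>, U i \<omega>)) (\<lambda>i. t i \<omega>))"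
proof -
  note [measurable] = assms(1-3)
  have [measurable]: "Measurable.pred M (\<lambda>\<omega>. key_less (X i \<omega>, U i \<omega>) (X j \<omega>, U j \<omega>))" for i j
    by (rule measurable_key_less) (use assms in auto)
  have [measurable]: "(\<lambda>\<omega>. T (X i \<omega>, U i \<omega>)) \<in> borel_measurable M" for i
    by (rule measurable_compose[OF _ T]) (intro borel_measurable_Pair assms)
  show ?thesis
    unfolding winning_def unaccepted_def
    by (intro pred_intros_finite pred_intros_logic pred_intros_countable) measurable
qed

text \<open>Insertion sort: inserting into a constant list is measurable by comparisons, and the
  sorted tail takes only countably many values, so it may be substituted for the constant.\<close>

lemma measurable_sort_key:
  assumes "\<And>j. (\<lambda>\<omega>. t \<omega> j) \<in> borel_measurable M"
  shows "(\<lambda>\<omega>. sort_key (t \<omega> :: nat \<Rightarrow> real) xs) \<in> M \<rightarrow>\<^sub>M count_space UNIV"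
proof (induction xs)
  case Nil
  then show ?case by simp
next
  case (Cons a xs)
  note [measurable] = assms
  have ins: "(\<lambda>\<omega>. insort_key (t \<omega>) a l) \<in> M \<rightarrow>\<^sub>M count_space UNIV" for l
  proof (induction l)
    case Nil
    then show ?case by simp
  next
    case (Cons b l)
    have "(\<lambda>\<omega>. b # insort_key (t \<omega>) a l) \<in> M \<rightarrow>\<^sub>M count_space UNIV"
      by (rule measurable_compose[OF Cons]) simp
    then show ?case by simp measurable
  qed
  show ?case
    using measurable_compose_countable[OF ins Cons] by simp
qed

lemma strict_total_on_key_less:
  assumes "inj_on u I"
  shows "strict_total_on I (\<lambda>i j. key_less (x i, u i) (x j, u j))"
  unfolding strict_total_on_def
proof (intro conjI)
  show "asymp_on I (\<lambda>i j. key_less (x i, u i) (x j, u j))"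
    by (rule asymp_onI) (auto simp: key_less_def)
  show "transp_on I (\<lambda>i j. key_less (x i, u i) (x j, u j))"
    by (rule transp_onI) (auto simp: key_less_def)
  show "totalp_on I (\<lambda>i j. key_less (x i, u i) (x j, u j))"
  proof (rule totalp_onI)
    fix i j assume "i \<in> I" "j \<in> I" "i \<noteq> j"
    then have "u i \<noteq> u j" using assms by (auto dest: inj_onD)
    then show "key_less (x i, u i) (x j, u j) \<or> key_less (x j, u j) (x i, u i)"
      by (auto simp: key_less_def)
  qed
qed

lemma measurable_inj_on:
  fixes f :: "nat \<Rightarrow> 'a \<Rightarrow> real"
  assumes "\<And>i. f i \<in> borel_measurable M"
  shows "Measurable.pred M (\<lambda>\<omega>. inj_on (\<lambda>i. f i \<omega>) {..<n})"
proof -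
  note [measurable] = assms
  show ?thesis unfolding inj_on_def by measurable
qed

section \<open>Success of the rule on the instance space\<close>

abbreviation wins :: "nat \<Rightarrow> (real \<times> real \<Rightarrow> real) \<Rightarrow> (nat \<Rightarrow> real) \<Rightarrow> (nat \<Rightarrow> real) \<Rightarrow> (nat \<Rightarrow> real) \<Rightarrow> bool" where
  "wins n T x u t \<equiv> winning n (\<lambda>i j. key_less (x i, u i) (x j, u j)) (\<lambda>i. T (x i, u i)) t"

definition success :: "nat \<Rightarrow> stop_rule \<Rightarrow> (((nat \<Rightarrow> real) \<times> (nat \<Rightarrow> real)) \<times> real) \<Rightarrow> bool" where
  "success n A \<omega> \<longleftrightarrow> accepted_value n A (snd \<omega>) (fst (fst \<omega>)) (snd (fst \<omega>)) = opt_value n (fst (fst \<omega>))"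

text \<open>Indispensable, as \<open>measure\<close> is 0 on non-measurable sets. The run depends on
  the arrival order and the stopping index, both discrete, and on measurable comparisons once these
  are fixed.\<close>

lemma measurable_success:
  assumes F: "sets F = sets (borel :: real measure)" and T: "T \<in> borel_measurable borel"
  shows "Measurable.pred (instance_space n F) (success n (threshold_rule T))"
proof -
  let ?M = "instance_space n F"
  have [measurable]: "(\<lambda>\<omega>. fst (fst \<omega>) i) \<in> borel_measurable ?M" for i
    unfolding instance_space_def
    by (rule measurable_compose[OF measurable_compose[OF measurable_fst measurable_fst]])
       (rule measurable_PiM_component_real[OF F])
  have mt [measurable]: "(\<lambda>\<omega>. snd (fst \<omega>) i) \<in> borel_measurable ?M" for i
    unfolding instance_space_def
    by (rule measurable_compose[OF measurable_compose[OF measurable_fst measurable_snd]])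
       (rule measurable_PiM_component_real, simp)
  have "snd \<in> ?M \<rightarrow>\<^sub>M unif01" unfolding instance_space_def by simp
  then have [measurable]: "snd \<in> borel_measurable ?M"
    by (simp add: measurable_cong_sets[OF refl sets_unif01])
  have [measurable]: "(\<lambda>\<omega>. label m (snd \<omega>)) \<in> borel_measurable ?M" for m
    by (rule measurable_compose[OF _ measurable_label]) simp
  have key [measurable]: "Measurable.pred ?M (\<lambda>\<omega>. key_less (fst (fst \<omega>) a, label k (snd \<omega>)) (fst (fst \<omega>) b, label m (snd \<omega>)))" for a b k m
    by (rule measurable_key_less) measurable
  have [measurable]: "(\<lambda>\<omega>. T (fst (fst \<omega>) a, label k (snd \<omega>))) \<in> borel_measurable ?M" for a k
    by (rule measurable_compose[OF _ T]) (intro borel_measurable_Pair; measurable)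
  have order: "(\<lambda>\<omega>. arrival_order n (snd (fst \<omega>))) \<in> ?M \<rightarrow>\<^sub>M count_space UNIV"
    unfolding arrival_order_def by (rule measurable_sort_key) (rule mt)
  have acc: "Measurable.pred ?M (\<lambda>\<omega>. k < n \<and> threshold_rule T (snd \<omega>) (history n (fst (fst \<omega>)) (snd (fst \<omega>)) k))" for k
  proof (cases "k < n")
    case True
    \<comment> \<open>With a constant list in place of the arrival order, the condition is a finite
      conjunction of measurable comparisons; the actual order has countably many values.\<close>
    define P where "P = (\<lambda>(\<sigma> :: nat list) (\<omega> :: ((nat \<Rightarrow> real) \<times> (nat \<Rightarrow> real)) \<times> real). (\<forall>m<k. key_less (fst (fst \<omega>) (\<sigma> ! m), label m (snd \<omega>)) (fst (fst \<omega>) (\<sigma> ! k), label k (snd \<omega>)))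
      \<and> T (fst (fst \<omega>) (\<sigma> ! k), label k (snd \<omega>)) \<le> snd (fst \<omega>) (\<sigma> ! k))"
    have "Measurable.pred ?M (P \<sigma>)" for \<sigma> unfolding P_def by measurable
    from measurable_compose_countable[OF this order]
    have "Measurable.pred ?M (\<lambda>\<omega>. P (arrival_order n (snd (fst \<omega>))) \<omega>)" .
    moreover have "(k < n \<and> threshold_rule T (snd \<omega>) (history n (fst (fst \<omega>)) (snd (fst \<omega>)) k))
        = P (arrival_order n (snd (fst \<omega>))) \<omega>" for \<omega>
      unfolding P_def threshold_rule_history[OF True] using True by blast
    ultimately show ?thesis by (simp only:)
  qed simp
  have "(\<lambda>\<omega>. accepted_value n (threshold_rule T) (snd \<omega>) (fst (fst \<omega>)) (snd (fst \<omega>))) \<in> borel_measurable ?M"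
  proof -
    define L where "L \<omega> = (LEAST k. k < n \<and> threshold_rule T (snd \<omega>) (history n (fst (fst \<omega>)) (snd (fst \<omega>)) k))" for \<omega>
    have L: "L \<in> ?M \<rightarrow>\<^sub>M count_space UNIV"
      unfolding L_def[abs_def] by (rule measurable_Least) (rule acc)
    have "(\<lambda>\<omega>. fst (fst \<omega>) (arrival_order n (snd (fst \<omega>)) ! k)) \<in> borel_measurable ?M" for k
      by (rule measurable_compose_countable[OF _ order]) measurable
    from measurable_compose_countable[OF this L]
    have mL: "(\<lambda>\<omega>. fst (fst \<omega>) (arrival_order n (snd (fst \<omega>)) ! L \<omega>)) \<in> borel_measurable ?M" .
    have "Measurable.pred ?M (\<lambda>\<omega>. \<exists>k. k < n \<and> threshold_rule T (snd \<omega>) (history n (fst (fst \<omega>)) (snd (fst \<omega>)) k))"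
      by (intro pred_intros_countable acc)
    then show ?thesis
      unfolding accepted_value_def L_def[symmetric]
      by (intro measurable_If mL measurable_const) (simp_all only: pred_def space_borel UNIV_I)
  qed
  moreover have "(\<lambda>\<omega>. opt_value n (fst (fst \<omega>))) \<in> borel_measurable ?M"
  proof (cases "n = 0")
    case True
    then show ?thesis by (simp add: opt_value_def)
  next
    case False
    then have "opt_value n x = max 0 (Max ((\<lambda>i. x i) ` {..<n}))" for x
      unfolding opt_value_def by (subst Max_insert) auto
    moreover have "(\<lambda>\<omega>. max 0 (Max ((\<lambda>i. fst (fst \<omega>) i) ` {..<n}))) \<in> borel_measurable ?M"
      by measurable
    ultimately show ?thesis by simp
  qed
  ultimately show ?thesis
    unfolding success_def by measurable
qed

text \<open>The label of an item depends on the arrival times through its position. Exchanging the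
  integrals over \<open>u\<close> and \<open>t\<close> fixes the times first; the positions are then
  a constant permutation, and the independent labels \<open>u\<close> can be replaced by labels
  computed from the seed.\<close>

theorem emeasure_success_ge:
  assumes F: "nonneg_dist F" and T: "T \<in> borel_measurable borel"
    and anti: "\<And>a b. key_less a b \<Longrightarrow> T b \<le> T a" and n: "0 < n"
  shows "(\<integral>\<^sup>+x. (\<integral>\<^sup>+u. (\<integral>\<^sup>+t. indicator {t. wins n T x u t} t \<partial>PiM {..<n} (\<lambda>_. unif01)) \<partial>PiM {..<n} (\<lambda>_. unif01)) \<partial>PiM {..<n} (\<lambda>_. F))
    \<le> emeasure (instance_space n F) {\<omega> \<in> space (instance_space n F). success n (threshold_rule T) \<omega>}"
proof -
  let ?X = "PiM {..<n} (\<lambda>_. F)" and ?U = "PiM {..<n} (\<lambda>_. unif01)" and ?M = "instance_space n F"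
  have pF: "prob_space F" and sF: "sets F = sets borel" and F0: "measure F {0..} = 1"
    using F by (auto simp: nonneg_dist_def)
  interpret F: prob_space F by (rule pF)
  interpret X: prob_space ?X by (intro prob_space_PiM pF)
  interpret U: prob_space ?U by (intro prob_space_PiM prob_space_unif01)
  interpret UU: pair_sigma_finite ?U ?U ..
  let ?S = "{\<omega> \<in> space ?M. success n (threshold_rule T) \<omega>}"
  have S: "?S \<in> sets ?M" using measurable_success[OF sF T] by (simp add: pred_def)
  \<comment> \<open>\<open>opt_value\<close> is a maximum over \<open>insert 0\<close>, so the best
    item attains it only when the values are nonnegative.\<close>
  have "AE y in F. 0 \<le> y"
  proof -
    have "AE y in F. y \<in> {0..}"
      by (rule F.AE_prob_1[OF F0])
    then show ?thesis by simp
  qed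
  then have "AE x in ?X. \<forall>i\<in>{..<n}. 0 \<le> x i"
    using pF by (intro AE_finite_allI finite_lessThan AE_PiM_component) auto
  then have AEx: "AE x in ?X. \<forall>i<n. 0 \<le> x i" by (rule eventually_mono) auto
  have wins1: "Measurable.pred ?U (\<lambda>u. wins n T x u t)" for x t
    by (rule measurable_winning) (auto intro!: T measurable_PiM_component_real)
  have wins2: "Measurable.pred (?U \<Otimes>\<^sub>M ?U) (\<lambda>p. wins n T x (fst p) (snd p))" for x
    by (rule measurable_winning)
       (auto intro!: T measurable_PiM_component_real measurable_compose[OF measurable_fst] measurable_compose[OF measurable_snd])
  have "(\<integral>\<^sup>+x. (\<integral>\<^sup>+u. (\<integral>\<^sup>+t. indicator {t. wins n T x u t} t \<partial>?U) \<partial>?U) \<partial>?X)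
     = (\<integral>\<^sup>+x. (\<integral>\<^sup>+t. (\<integral>\<^sup>+u. indicator {t. wins n T x u t} t \<partial>?U) \<partial>?U) \<partial>?X)"
  proof (rule nn_integral_cong)
    fix x
    have "(\<lambda>(u, t). indicator {t. wins n T x u t} t :: ennreal) \<in> borel_measurable (?U \<Otimes>\<^sub>M ?U)"
      using wins2[of x] unfolding indicator_def mem_Collect_eq case_prod_beta by measurable
    from UU.Fubini'[OF this]
    show "(\<integral>\<^sup>+u. (\<integral>\<^sup>+t. indicator {t. wins n T x u t} t \<partial>?U) \<partial>?U) = (\<integral>\<^sup>+t. (\<integral>\<^sup>+u. indicator {t. wins n T x u t} t \<partial>?U) \<partial>?U)"
      by simp
  qed
  also have "\<dots> \<le> (\<integral>\<^sup>+x. (\<integral>\<^sup>+t. (\<integral>\<^sup>+r. indicator ?S ((x, t), r) \<partial>unif01) \<partial>?U) \<partial>?X)"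
  proof (intro nn_integral_mono_AE, use AEx AE_space in eventually_elim)
    fix x assume x: "\<forall>i<n. 0 \<le> x i" "x \<in> space ?X"
    show "(\<integral>\<^sup>+t. (\<integral>\<^sup>+u. indicator {t. wins n T x u t} t \<partial>?U) \<partial>?U) \<le> (\<integral>\<^sup>+t. (\<integral>\<^sup>+r. indicator ?S ((x, t), r) \<partial>unif01) \<partial>?U)"
    proof (intro nn_integral_mono_AE, use AE_PiM_unif01_inj AE_space in eventually_elim)
      fix t assume t: "inj_on t {..<n}" "t \<in> space ?U"
      let ?V = "\<lambda>r. \<lambda>i\<in>{..<n}. label (arrival_pos n t i) r"
      have V: "?V \<in> unif01 \<rightarrow>\<^sub>M ?U" by (rule measurable_restrict) auto
      have [measurable]: "Measurable.pred ?U (\<lambda>u. wins n T x u t \<and> inj_on (\<lambda>i. u i) {..<n})"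
        by (intro pred_intros_logic wins1 measurable_inj_on measurable_PiM_component_real sets_unif01)
      have "(\<integral>\<^sup>+u. indicator {t. wins n T x u t} t \<partial>?U) = (\<integral>\<^sup>+u. indicator {u. wins n T x u t \<and> inj_on u {..<n}} u \<partial>?U)"
        by (intro nn_integral_cong_AE, use AE_PiM_unif01_inj in eventually_elim) (simp add: indicator_def)
      also have "\<dots> = (\<integral>\<^sup>+u. indicator {u. wins n T x u t \<and> inj_on u {..<n}} u \<partial>distr unif01 ?U ?V)"
        by (simp only: distr_permuted_labels[OF n bij_arrival_pos])
      also have "\<dots> = (\<integral>\<^sup>+r. indicator {u. wins n T x u t \<and> inj_on u {..<n}} (?V r) \<partial>unif01)"
        unfolding indicator_def mem_Collect_eq by (rule nn_integral_distr[OF V]) measurable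
      also have "\<dots> \<le> (\<integral>\<^sup>+r. indicator ?S ((x, t), r) \<partial>unif01)"
      proof (rule nn_integral_mono)
        fix r
        have "((x, t), r) \<in> ?S" if "wins n T x (?V r) t" "inj_on (?V r) {..<n}"
        proof -
          have "accepted_value n (threshold_rule T) r x t = opt_value n x"
          proof (rule accepted_value_if_winning[where u = "?V r", OF _ t(1) _ anti _ that(1)])
            show "strict_total_on {..<n} (\<lambda>i j. key_less (x i, ?V r i) (x j, ?V r j))"
              by (rule strict_total_on_key_less[OF that(2)])
          qed (use x in simp_all)
          then show ?thesis
            using x t by (simp add: success_def instance_space_def space_pair_measure)
        qed
        then show "indicator {u. wins n T x u t \<and> inj_on u {..<n}} (?V r) \<le> (indicator ?S ((x, t), r) :: ennreal)"
          by (auto simp: indicator_def)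
      qed
      finally show "(\<integral>\<^sup>+u. indicator {t. wins n T x u t} t \<partial>?U) \<le> (\<integral>\<^sup>+r. indicator ?S ((x, t), r) \<partial>unif01)" .
    qed
  qed
  also have "\<dots> = (\<integral>\<^sup>+\<omega>. indicator ?S \<omega> \<partial>?M)"
  proof -
    have m: "(indicator ?S :: _ \<Rightarrow> ennreal) \<in> borel_measurable ((?X \<Otimes>\<^sub>M ?U) \<Otimes>\<^sub>M unif01)"
      using S unfolding instance_space_def by (rule borel_measurable_indicator)
    have m2: "(\<lambda>p. \<integral>\<^sup>+r. indicator ?S (p, r) \<partial>unif01) \<in> borel_measurable (?X \<Otimes>\<^sub>M ?U)"
      by (rule unif01.borel_measurable_nn_integral) (use m in simp)
    show ?thesis
      unfolding U.nn_integral_fst[OF m2]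
      by (simp only: instance_space_def unif01.nn_integral_fst[OF m[unfolded instance_space_def]])
  qed
  also have "\<dots> = emeasure ?M ?S" by (rule nn_integral_indicator[OF S])
  finally show ?thesis .
qed

section \<open>Randomized quantiles\<close>

text \<open>Clamping the label makes the quantile monotone in the key without a range assumption.\<close>

definition rand_quantile :: "real measure \<Rightarrow> real \<times> real \<Rightarrow> real" where
  "rand_quantile F z = measure F {..<fst z} + max 0 (min 1 (snd z)) * measure F {fst z}"

lemma emeasure_unif01:
  "A \<in> sets borel \<Longrightarrow> emeasure unif01 A = emeasure lborel ({0..1} \<inter> A)"
  unfolding unif01_def by (subst emeasure_uniform_measure) (auto simp: divide_ennreal_def)

lemma emeasure_unif01_clamp_less:
  assumes "0 \<le> d" "d \<le> 1"
  shows "emeasure unif01 {u. max 0 (min 1 u) < d} = ennreal d"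
proof -
  have "{0..1} \<inter> {u. max 0 (min 1 u) < d} = {0..<d}" using assms by auto
  then show ?thesis using assms by (subst emeasure_unif01) auto
qed

context
  fixes F :: "real measure"
  assumes F: "real_distribution F"
begin

interpretation F: real_distribution F by (rule F)

lemma measure_atMost_split: "measure F {..x} = measure F {..<x} + measure F {x}"
proof -
  have "{..x} = {..<x} \<union> {x}" by auto
  also have "measure F \<dots> = measure F {..<x} + measure F {x}"
    by (rule F.finite_measure_Union) auto
  finally show ?thesis .
qed

lemma rand_quantile_bounds:
  "measure F {..<x} \<le> rand_quantile F (x, u)" "rand_quantile F (x, u) \<le> measure F {..x}"
proof -
  have "max 0 (min 1 u) * measure F {x} \<le> 1 * measure F {x}"
    by (intro mult_right_mono) auto
  then show "rand_quantile F (x, u) \<le> measure F {..x}"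
    by (simp add: rand_quantile_def measure_atMost_split)
qed (simp add: rand_quantile_def)

lemma rand_quantile_mono:
  assumes "key_less a b"
  shows "rand_quantile F a \<le> rand_quantile F b"
proof (cases "fst a < fst b")
  case True
  have "rand_quantile F a \<le> measure F {..fst a}"
    using rand_quantile_bounds(2)[of "fst a" "snd a"] by simp
  also have "\<dots> \<le> measure F {..<fst b}"
    using True by (intro F.finite_measure_mono) auto
  also have "\<dots> \<le> rand_quantile F b"
    using rand_quantile_bounds(1)[of "fst b" "snd b"] by simp
  finally show ?thesis .
next
  case False
  then show ?thesis using assms
    by (auto simp: key_less_def rand_quantile_def intro!: mult_right_mono)
qed

lemma measurable_rand_quantile [measurable]: "rand_quantile F \<in> borel_measurable borel"
proof -
  have 1 [measurable]: "(\<lambda>x. measure F {..<x}) \<in> borel_measurable borel"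
    by (intro borel_measurable_mono monoI F.finite_measure_mono) auto
  have 2 [measurable]: "(\<lambda>x. measure F {..x}) \<in> borel_measurable borel"
    by (intro borel_measurable_mono monoI F.finite_measure_mono) auto
  \<comment> \<open>The mass of an atom is not monotone in its position, but it is a difference of
    two monotone functions.\<close>
  have eq: "(\<lambda>x. measure F {x}) = (\<lambda>x. measure F {..x} - measure F {..<x})"
    by (simp add: measure_atMost_split)
  have 3 [measurable]: "(\<lambda>x. measure F {x}) \<in> borel_measurable borel"
    unfolding eq by measurable
  have "rand_quantile F \<in> borel_measurable (borel \<Otimes>\<^sub>M borel)"
    unfolding rand_quantile_def[abs_def] by measurable
  then show ?thesis by (simp add: borel_prod)
qed

text \<open>\<open>q\<close> is the generalized inverse of the cdf at \<open>c\<close>. Values below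
  \<open>q\<close> always have quantile below \<open>c\<close>, values above \<open>q\<close> never
  do, and at \<open>q\<close> itself the label decides, supplying exactly the missing mass
  \<open>c - a\<close>.\<close>

lemma emeasure_rand_quantile_less:
  assumes c: "0 < c" "c < 1"
  shows "emeasure (F \<Otimes>\<^sub>M unif01) {z. rand_quantile F z < c} = ennreal c"
proof -
  define S where "S = {x. c \<le> cdf F x}"
  define q where "q = Inf S"
  have "\<forall>\<^sub>F x in at_top. c < cdf F x"
    using F.cdf_lim_at_top_prob c(2) by (rule order_tendstoD)
  then obtain y where "c < cdf F y"
    unfolding eventually_at_top_linorder by blast
  then have S1: "S \<noteq> {}" unfolding S_def by (auto intro: less_imp_le)
  have "\<forall>\<^sub>F x in at_bot. cdf F x < c"
    using F.cdf_lim_at_bot c(1) by (rule order_tendstoD)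
  then obtain l where "\<And>x. x \<le> l \<Longrightarrow> cdf F x < c"
    unfolding eventually_at_bot_linorder by blast
  then have S2: "bdd_below S" unfolding S_def
    by (intro bdd_belowI[of _ l]) (metis linorder_not_less mem_Collect_eq linear)
  have below: "cdf F x < c" if "x < q" for x
    using that cInf_lower[OF _ S2, of x] unfolding q_def S_def by force
  have above: "c \<le> cdf F x" if "q < x" for x
  proof -
    have "\<exists>y\<in>S. y < x" using that cInf_less_iff[OF S1 S2, of x] by (simp add: q_def)
    then obtain y where "y \<in> S" "y < x" by blast
    then show ?thesis using F.cdf_nondecreasing[of y x] unfolding S_def by simp
  qed
  have at_q: "c \<le> cdf F q"
  proof (rule tendsto_lowerbound)
    show "(cdf F \<longlongrightarrow> cdf F q) (at_right q)"
      using F.cdf_is_right_cont[of q] by (simp add: continuous_within)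
    show "\<forall>\<^sub>F x in at_right q. c \<le> cdf F x"
      using above by (simp add: eventually_at_right_less eventually_mono[OF eventually_at_right_less])
  qed simp
  define a where "a = measure F {..<q}"
  define p where "p = measure F {q}"
  have a_le: "a \<le> c" unfolding a_def
  proof (rule tendsto_upperbound[OF F.cdf_at_left])
    show "\<forall>\<^sub>F x in at_left q. cdf F x \<le> c"
      unfolding eventually_at_left_field using below by (intro exI[of _ "q - 1"]) (auto intro: less_imp_le)
  qed simp
  have ap: "c \<le> a + p"
    using at_q by (simp add: a_def p_def cdf_def measure_atMost_split)
  define e where "e = emeasure unif01 {u. rand_quantile F (q, u) < c}"
  \<comment> \<open>If \<open>q\<close> carries no atom, then a \<le> c \<le> a + p forces
    \<open>c = a\<close> and both sides are 0; otherwise the label lies below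
    \<open>(c - a) / p\<close> with just that probability.\<close>
  have pe: "ennreal p * e = ennreal (c - a)"
  proof (cases "p = 0")
    case True
    then show ?thesis using a_le ap by simp
  next
    case False
    then have p: "0 < p" by (simp add: p_def zero_less_measure_iff)
    have "{u. rand_quantile F (q, u) < c} = {u. max 0 (min 1 u) < (c - a) / p}"
      by (simp add: rand_quantile_def a_def[symmetric] p_def[symmetric] pos_less_divide_eq[OF p] less_diff_eq add.commute)
    then have "e = ennreal ((c - a) / p)"
      unfolding e_def using p a_le ap
      by (subst emeasure_unif01_clamp_less[symmetric]) (auto simp: field_simps)
    then show ?thesis using p a_le by (simp add: ennreal_mult[symmetric])
  qed
  have "emeasure (F \<Otimes>\<^sub>M unif01) {z. rand_quantile F z < c}
     = (\<integral>\<^sup>+x. emeasure unif01 (Pair x -` {z. rand_quantile F z < c}) \<partial>F)"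
  proof (rule unif01.emeasure_pair_measure_alt)
    have "sets (F \<Otimes>\<^sub>M unif01) = sets (borel :: (real \<times> real) measure)"
      by (simp add: borel_prod[symmetric] cong: sets_pair_measure_cong)
    then show "{z. rand_quantile F z < c} \<in> sets (F \<Otimes>\<^sub>M unif01)" by simp
  qed
  also have "\<dots> = (\<integral>\<^sup>+x. indicator {..<q} x + e * indicator {q} x \<partial>F)"
  proof (rule nn_integral_cong)
    fix x
    consider "x < q" | "x = q" | "q < x" by linarith
    then show "emeasure unif01 (Pair x -` {z. rand_quantile F z < c}) = indicator {..<q} x + e * indicator {q} x"
    proof cases
      case 1
      have "rand_quantile F (x, u) < c" for u
        using rand_quantile_bounds(2)[of x u] below[OF 1] by (simp add: cdf_def)
      then have "Pair x -` {z. rand_quantile F z < c} = UNIV" by auto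
      then show ?thesis using 1 unif01.emeasure_space_1 by simp
    next
      case 2
      then show ?thesis by (simp add: e_def vimage_def)
    next
      case 3
      have "measure F {..q} \<le> measure F {..<x}" using 3 by (intro F.finite_measure_mono) auto
      then have "c \<le> rand_quantile F (x, u)" for u
        using rand_quantile_bounds(1)[of x u] at_q by (simp add: cdf_def)
      then have "Pair x -` {z. rand_quantile F z < c} = {}" by (auto simp: not_less)
      then show ?thesis using 3 by simp
    qed
  qed
  also have "\<dots> = ennreal a + ennreal p * e"
    by (subst nn_integral_add) (auto simp: nn_integral_cmult a_def p_def F.emeasure_eq_measure mult.commute)
  also have "\<dots> = ennreal c"
    unfolding pe using a_le by (simp add: a_def ennreal_plus[symmetric] del: ennreal_plus)
  finally show ?thesis .
qed

end

text \<open>The hypothesis is about open half-lines, the cdf about closed ones; squeezing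
  \<open>x\<close> between nearby values of \<open>c\<close> bridges the gap without excluding atoms
  beforehand.\<close>

lemma cdf_uniform:
  assumes M: "real_distribution M" and *: "\<And>c. 0 < c \<Longrightarrow> c < 1 \<Longrightarrow> emeasure M {..<c} = ennreal c"
  shows "cdf M x = max 0 (min 1 x)"
proof -
  interpret real_distribution M by (rule M)
  have m: "measure M {..<c} = c" if "0 < c" "c < 1" for c
    using *[OF that] that by (simp add: measure_def)
  have le: "cdf M x \<le> c" if "x < c" "0 < c" "c < 1" for c
    unfolding cdf_def by (subst m[OF that(2,3), symmetric]) (use that in \<open>auto intro!: finite_measure_mono\<close>)
  have ge: "c \<le> cdf M x" if "c \<le> x" "0 < c" "c < 1" for c
    unfolding cdf_def by (subst m[OF that(2,3), symmetric]) (use that in \<open>auto intro!: finite_measure_mono\<close>)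
  have b: "0 \<le> cdf M x" "cdf M x \<le> 1" by (simp_all add: cdf_nonneg cdf_bounded_prob)
  have "cdf M x \<le> max 0 x" if "x < 1"
    by (rule dense_ge_bounded[where x = 1]) (use that le in auto)
  moreover have "min 1 x \<le> cdf M x" if "0 < x"
    by (rule dense_le_bounded[where x = 0]) (use that ge in auto)
  ultimately show ?thesis using b by (cases "x \<le> 0"; cases "x < 1") auto
qed

text \<open>Both laws have the cdf given by \<open>cdf_uniform\<close>, so they coincide. Atoms of
  \<open>F\<close> do no harm, since the label spreads each of them over its jump of the
  cdf.\<close>

lemma nn_integral_rand_quantile:
  assumes F: "real_distribution F" and f [measurable]: "f \<in> borel_measurable borel"
  shows "(\<integral>\<^sup>+x. (\<integral>\<^sup>+u. f (rand_quantile F (x, u)) \<partial>unif01) \<partial>F) = (\<integral>\<^sup>+q. f q \<partial>unif01)"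
proof -
  interpret F: real_distribution F by (rule F)
  interpret FU: pair_prob_space F unif01 ..
  have sets: "sets (F \<Otimes>\<^sub>M unif01) = sets (borel :: (real \<times> real) measure)"
    by (simp add: borel_prod[symmetric] cong: sets_pair_measure_cong)
  have Q: "rand_quantile F \<in> F \<Otimes>\<^sub>M unif01 \<rightarrow>\<^sub>M borel"
    using measurable_rand_quantile[OF F] by (simp add: measurable_cong_sets[OF sets refl])
  have rd: "real_distribution (distr (F \<Otimes>\<^sub>M unif01) borel (rand_quantile F))"
    unfolding real_distribution_def real_distribution_axioms_def
    by (simp add: FU.prob_space_distr[OF Q])
  have rdU: "real_distribution unif01"
    unfolding real_distribution_def real_distribution_axioms_def by (simp add: prob_space_unif01)
  have "cdf (distr (F \<Otimes>\<^sub>M unif01) borel (rand_quantile F)) x = max 0 (min 1 x)" for x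
  proof (rule cdf_uniform[OF rd])
    fix c :: real assume "0 < c" "c < 1"
    then show "emeasure (distr (F \<Otimes>\<^sub>M unif01) borel (rand_quantile F)) {..<c} = ennreal c"
      using emeasure_rand_quantile_less[OF F, of c] by (simp add: emeasure_distr[OF Q] vimage_def space_pair_measure)
  qed
  moreover have "cdf unif01 x = max 0 (min 1 x)" for x
  proof (rule cdf_uniform[OF rdU])
    fix c :: real assume c: "0 < c" "c < 1"
    have "emeasure unif01 {..<c} = emeasure lborel ({0..1} \<inter> {..<c})"
      by (rule emeasure_unif01) simp
    also have "{0..1} \<inter> {..<c} = {0..<c}" using c by auto
    finally show "emeasure unif01 {..<c} = ennreal c" using c by simp
  qed
  ultimately have "distr (F \<Otimes>\<^sub>M unif01) borel (rand_quantile F) = unif01"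
    by (intro cdf_unique rd rdU) (simp add: fun_eq_iff)
  then have "(\<integral>\<^sup>+q. f q \<partial>unif01) = (\<integral>\<^sup>+q. f q \<partial>distr (F \<Otimes>\<^sub>M unif01) borel (rand_quantile F))" by simp
  also have "\<dots> = (\<integral>\<^sup>+z. f (rand_quantile F z) \<partial>(F \<Otimes>\<^sub>M unif01))"
    by (rule nn_integral_distr[OF Q]) simp
  also have "\<dots> = (\<integral>\<^sup>+x. (\<integral>\<^sup>+u. f (rand_quantile F (x, u)) \<partial>unif01) \<partial>F)"
    by (rule unif01.nn_integral_fst[symmetric]) (rule measurable_compose[OF Q f])
  finally show ?thesis ..
qed

section \<open>Integral estimates\<close>

text \<open>Here \<open>a \<ge> b\<close> are the quantile thresholds at an earlier time and at time \<open>\<tau>\<close>. The term with \<open>b\<close> is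
  on the right so that no subtraction of extended reals occurs.\<close>

lemma nn_integral_quantile_ge:
  fixes a b \<tau> :: real
  assumes "0 \<le> b" "b \<le> a" "a \<le> 1" "0 < \<tau>" "\<tau> < 1" "0 < n"
  shows "ennreal (((1 - \<tau> + \<tau> * a) ^ n - \<tau> * a ^ n) / ((1 - \<tau>) * \<tau>))
    \<le> (\<integral>\<^sup>+y. indicator {0<..<1} y * indicator {b..} y *
          ennreal (real n * ((1 - \<tau>) * y + \<tau> * min y a) ^ (n - 1) / \<tau>) \<partial>lborel) + ennreal (b ^ n / \<tau>)"
proof -
  let ?f = "\<lambda>y::real. real n * y ^ (n - 1) / \<tau>" and ?g = "\<lambda>y::real. real n * ((1 - \<tau>) * y + \<tau> * a) ^ (n - 1) / \<tau>"
  define X where "X = a ^ n / \<tau> - b ^ n / \<tau>"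
  define Y where "Y = ((1 - \<tau>) * 1 + \<tau> * a) ^ n / ((1 - \<tau>) * \<tau>) - ((1 - \<tau>) * a + \<tau> * a) ^ n / ((1 - \<tau>) * \<tau>)"
  define Z where "Z = b ^ n / \<tau>"
  have f: "(\<integral>\<^sup>+y. ennreal (?f y) * indicator {b..a} y \<partial>lborel) = ennreal X"
    unfolding X_def using assms by (intro nn_integral_FTC_Icc)
      (auto intro!: derivative_eq_intros simp: has_real_derivative_iff_has_vector_derivative[symmetric])
  have g: "(\<integral>\<^sup>+y. ennreal (?g y) * indicator {a..1} y \<partial>lborel) = ennreal Y"
    unfolding Y_def using assms by (intro nn_integral_FTC_Icc)
      (auto intro!: derivative_eq_intros simp: has_real_derivative_iff_has_vector_derivative[symmetric])
  \<comment> \<open>The integral is split at \<open>y = a\<close>, where \<open>min y a\<close>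
    changes form. Over the common denominator the two boundary terms in \<open>a ^ n\<close> have
    coefficients 1 - \<tau> and -1, which add up to -\<tau>.\<close>
  have eq: "((1 - \<tau> + \<tau> * a) ^ n - \<tau> * a ^ n) / ((1 - \<tau>) * \<tau>) = X + Y + Z"
  proof -
    have "(1 - \<tau>) * a + \<tau> * a = a" by (simp add: algebra_simps)
    moreover have "a ^ n / \<tau> = (1 - \<tau>) * a ^ n / ((1 - \<tau>) * \<tau>)" using assms by simp
    ultimately show ?thesis by (simp add: X_def Y_def Z_def diff_divide_distrib left_diff_distrib)
  qed
  have "b ^ n \<le> a ^ n" using assms by (intro power_mono) auto
  then have X0: "0 \<le> X" using assms by (simp add: X_def divide_right_mono)
  have "((1 - \<tau>) * a + \<tau> * a) ^ n \<le> ((1 - \<tau>) * 1 + \<tau> * a) ^ n"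
    using assms by (intro power_mono add_mono mult_left_mono) auto
  then have Y0: "0 \<le> Y" using assms by (simp add: Y_def divide_right_mono)
  have Z0: "0 \<le> Z" using assms by (simp add: Z_def)
  have "ennreal (((1 - \<tau> + \<tau> * a) ^ n - \<tau> * a ^ n) / ((1 - \<tau>) * \<tau>)) = ennreal X + ennreal Y + ennreal Z"
    unfolding eq using X0 Y0 Z0 by simp
  also have "\<dots> = (\<integral>\<^sup>+y. ennreal (?f y) * indicator {b..a} y + ennreal (?g y) * indicator {a..1} y \<partial>lborel) + ennreal Z"
    unfolding f[symmetric] g[symmetric] by (subst nn_integral_add) auto
  also have "\<dots> \<le> (\<integral>\<^sup>+y. indicator {0<..<1} y * indicator {b..} y *
          ennreal (real n * ((1 - \<tau>) * y + \<tau> * min y a) ^ (n - 1) / \<tau>) \<partial>lborel) + ennreal Z"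
  proof (intro add_right_mono nn_integral_mono_AE)
    have "AE y in lborel. y \<noteq> 0 \<and> y \<noteq> 1 \<and> y \<noteq> a"
      using AE_lborel_singleton[of 0] AE_lborel_singleton[of 1] AE_lborel_singleton[of a]
      by eventually_elim auto
    then show "AE y in lborel. ennreal (?f y) * indicator {b..a} y + ennreal (?g y) * indicator {a..1} y
      \<le> indicator {0<..<1} y * indicator {b..} y * ennreal (real n * ((1 - \<tau>) * y + \<tau> * min y a) ^ (n - 1) / \<tau>)"
    proof eventually_elim
      case (elim y)
      consider "y < b" | "b \<le> y" "y < a" | "b \<le> y" "a < y" "y < 1" | "1 < y" using elim by linarith
      then show ?case
      proof cases
        case 2
        then have "(1 - \<tau>) * y + \<tau> * min y a = y" by (simp add: algebra_simps)
        then show ?thesis using 2 elim assms by (simp add: indicator_def)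
      next
        case 3
        then have "(1 - \<tau>) * y + \<tau> * min y a = (1 - \<tau>) * y + \<tau> * a" by simp
        then show ?thesis using 3 elim assms by (simp add: indicator_def)
      qed (use assms in \<open>auto simp: indicator_def\<close>)
    qed
  qed
  finally show ?thesis unfolding Z_def .
qed

lemma exp_mult_le:
  fixes x \<tau> :: real
  assumes "0 \<le> \<tau>" "\<tau> \<le> 1"
  shows "exp (\<tau> * x) \<le> 1 - \<tau> + \<tau> * exp x"
  using convex_onD[OF exp_convex, of \<tau> 0 x] assms by simp

text \<open>The left-hand side is the limit of the right-hand side for \<open>n \<rightarrow> \<infinity>\<close>; convexity of the exponential
  makes the bound hold for every \<open>n\<close>.\<close>

lemma gain_ge:
  fixes c \<tau> :: real
  assumes "0 < \<tau>" "\<tau> < 1" "0 < n"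
  defines "a \<equiv> exp (- c / real n)"
  shows "exp (- c * \<tau>) / \<tau> + (exp (- c * \<tau>) - exp (- c)) / (1 - \<tau>)
    \<le> ((1 - \<tau> + \<tau> * a) ^ n - \<tau> * a ^ n) / ((1 - \<tau>) * \<tau>)"
proof -
  have an: "a ^ n = exp (- c)" unfolding a_def using assms(3) by (simp add: exp_of_nat_mult[symmetric])
  have "exp (- c * \<tau>) = exp (\<tau> * (- c / real n)) ^ n"
    using assms(3) by (simp add: exp_of_nat_mult[symmetric])
  also have "\<dots> \<le> (1 - \<tau> + \<tau> * a) ^ n"
    unfolding a_def using assms by (intro power_mono exp_mult_le) auto
  finally have "(exp (- c * \<tau>) - \<tau> * exp (- c)) / ((1 - \<tau>) * \<tau>) \<le> ((1 - \<tau> + \<tau> * a) ^ n - \<tau> * a ^ n) / ((1 - \<tau>) * \<tau>)"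
    unfolding an using assms by (intro divide_right_mono) auto
  also have "(exp (- c * \<tau>) - \<tau> * exp (- c)) / ((1 - \<tau>) * \<tau>) = exp (- c * \<tau>) / \<tau> + (exp (- c * \<tau>) - exp (- c)) / (1 - \<tau>)"
    using assms by (simp add: field_simps)
  finally show ?thesis .
qed

text \<open>This is where the defining equation of \<open>\<kappa>\<close> enters.\<close>

lemma nn_integral_exp_diff_quotient:
  fixes s \<kappa> :: real
  assumes s: "0 \<le> s" "s < 1" and \<kappa>: "0 < \<kappa>"
    and sums: "(\<lambda>k. \<kappa> ^ Suc k / (fact (Suc k) * real (Suc k))) sums 1"
  defines "c \<equiv> \<kappa> / (1 - s)"
  shows "(\<integral>\<^sup>+\<tau>. indicator {s<..<1} \<tau> * ennreal ((exp (- c * \<tau>) - exp (- c)) / (1 - \<tau>)) \<partial>lborel) = ennreal (exp (- c))"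
proof -
  have c: "0 < c" "c * (1 - s) = \<kappa>" using s \<kappa> by (simp_all add: c_def)
  \<comment> \<open>These are the terms of the power series of (exp (c (1 - \<tau>)) - 1) / (1 -
    \<tau>). Integration over \<open>[s, 1]\<close> contributes (1 - s) ^ (k + 1) / (k + 1), and
    \<open>c * (1 - s) = \<kappa>\<close> turns the result into the series that defines
    \<kappa>.\<close>
  let ?a = "\<lambda>k \<tau>. c ^ Suc k / fact (Suc k) * (1 - \<tau>) ^ k"
  have int: "(\<integral>\<^sup>+\<tau>. ennreal (?a k \<tau>) * indicator {s..1} \<tau> \<partial>lborel) = ennreal (\<kappa> ^ Suc k / (fact (Suc k) * real (Suc k)))" for k
  proof -
    have "(\<integral>\<^sup>+\<tau>. ennreal (?a k \<tau>) * indicator {s..1} \<tau> \<partial>lborel)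
      = - (c ^ Suc k / fact (Suc k) * (1 - 1) ^ Suc k / Suc k) - - (c ^ Suc k / fact (Suc k) * (1 - s) ^ Suc k / Suc k)"
      using s c by (intro nn_integral_FTC_Icc)
        (auto intro!: derivative_eq_intros simp: has_real_derivative_iff_has_vector_derivative[symmetric] simp del: fact_Suc power_Suc)
    also have "\<dots> = \<kappa> ^ Suc k / (fact (Suc k) * real (Suc k))"
      unfolding c(2)[symmetric] power_mult_distrib by (simp del: fact_Suc)
    finally show ?thesis .
  qed
  have ptw: "ennreal ((exp (- c * \<tau>) - exp (- c)) / (1 - \<tau>)) = ennreal (exp (- c)) * (\<Sum>k. ennreal (?a k \<tau>))"
    if "\<tau> < 1" for \<tau>
  proof -
    have "(\<lambda>k. (c * (1 - \<tau>)) ^ k / fact k) sums exp (c * (1 - \<tau>))"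
      using exp_converges[of "c * (1 - \<tau>)"] by (simp add: field_simps)
    then have "(\<lambda>k. (c * (1 - \<tau>)) ^ Suc k / fact (Suc k)) sums (exp (c * (1 - \<tau>)) - 1)"
      by (subst sums_Suc_iff) simp
    then have "(\<lambda>k. (c * (1 - \<tau>)) ^ Suc k / fact (Suc k) / (1 - \<tau>)) sums ((exp (c * (1 - \<tau>)) - 1) / (1 - \<tau>))"
      by (rule sums_divide)
    moreover have "(c * (1 - \<tau>)) ^ Suc k / fact (Suc k) / (1 - \<tau>) = ?a k \<tau>" for k
      using that by (simp add: power_mult_distrib del: fact_Suc)
    ultimately have "(\<lambda>k. ?a k \<tau>) sums ((exp (c * (1 - \<tau>)) - 1) / (1 - \<tau>))" by simp
    then have "(\<Sum>k. ennreal (?a k \<tau>)) = ennreal ((exp (c * (1 - \<tau>)) - 1) / (1 - \<tau>))"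
      using that c by (intro suminf_ennreal_eq) auto
    moreover have "(exp (- c * \<tau>) - exp (- c)) / (1 - \<tau>) = exp (- c) * ((exp (c * (1 - \<tau>)) - 1) / (1 - \<tau>))"
      by (simp add: right_diff_distrib exp_add[symmetric])
    ultimately show ?thesis by (simp only: ennreal_mult'[OF exp_ge_zero])
  qed
  have "(\<integral>\<^sup>+\<tau>. indicator {s<..<1} \<tau> * ennreal ((exp (- c * \<tau>) - exp (- c)) / (1 - \<tau>)) \<partial>lborel)
    = (\<integral>\<^sup>+\<tau>. ennreal (exp (- c)) * (\<Sum>k. ennreal (?a k \<tau>) * indicator {s..1} \<tau>) \<partial>lborel)"
  proof (rule nn_integral_cong_AE)
    have "AE \<tau> in lborel. \<tau> \<noteq> s \<and> \<tau> \<noteq> 1"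
      using AE_lborel_singleton[of s] AE_lborel_singleton[of 1] by eventually_elim auto
    then show "AE \<tau> in lborel. indicator {s<..<1} \<tau> * ennreal ((exp (- c * \<tau>) - exp (- c)) / (1 - \<tau>))
      = ennreal (exp (- c)) * (\<Sum>k. ennreal (?a k \<tau>) * indicator {s..1} \<tau>)"
    proof eventually_elim
      case (elim \<tau>)
      then consider "\<tau> \<in> {s<..<1}" | "\<tau> \<notin> {s..1}" by force
      then show ?case
      proof cases
        case 1
        then show ?thesis using ptw[of \<tau>] by (simp add: indicator_def)
      next
        case 2
        then show ?thesis by (auto simp: indicator_def)
      qed
    qed
  qed
  also have "\<dots> = ennreal (exp (- c)) * (\<integral>\<^sup>+\<tau>. (\<Sum>k. ennreal (?a k \<tau>) * indicator {s..1} \<tau>) \<partial>lborel)"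
    by (rule nn_integral_cmult) measurable
  also have "(\<integral>\<^sup>+\<tau>. (\<Sum>k. ennreal (?a k \<tau>) * indicator {s..1} \<tau>) \<partial>lborel) = (\<Sum>k. \<integral>\<^sup>+\<tau>. ennreal (?a k \<tau>) * indicator {s..1} \<tau> \<partial>lborel)"
    by (rule nn_integral_suminf) measurable
  also have "\<dots> = (\<Sum>k. ennreal (\<kappa> ^ Suc k / (fact (Suc k) * real (Suc k))))"
    by (simp only: int)
  also have "(\<Sum>k. ennreal (\<kappa> ^ Suc k / (fact (Suc k) * real (Suc k)))) = ennreal 1"
    using \<kappa> by (intro suminf_ennreal_eq[OF _ sums]) auto
  finally show ?thesis by simp
qed

text \<open>With the order of integration exchanged, the slice in \<open>s\<close> at height \<tau>
  has length \<open>min l \<tau>\<close>: this gives 1 for \<tau> below \<open>l\<close> and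
  \<open>l / \<tau>\<close> above. For \<open>l = l1\<close> it is the contribution of the times at
  which the quantile threshold equals 1.\<close>

lemma nn_integral_inverse_triangle:
  fixes l :: real
  assumes "0 \<le> l" "l \<le> 1"
  shows "(\<integral>\<^sup>+s. indicator {0..<l} s * (\<integral>\<^sup>+\<tau>. indicator {s<..<1} \<tau> * ennreal (1 / \<tau>) \<partial>lborel) \<partial>lborel)
     = ennreal (l + negxlnx l)"
proof (cases "l = 0")
  case True
  then show ?thesis by (simp add: negxlnx_def)
next
  case False
  then have l: "0 < l" using assms by simp
  have [measurable]: "Measurable.pred (lborel \<Otimes>\<^sub>M lborel) (\<lambda>(s, \<tau>). s < (\<tau> :: real))" by measurable
  have m: "(\<lambda>(s, \<tau>). indicator {0..<l} s * (indicator {s<..<1} \<tau> * ennreal (1 / \<tau>))) \<in> borel_measurable (lborel \<Otimes>\<^sub>M (lborel :: real measure))"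
    unfolding indicator_def greaterThanLessThan_iff by measurable
  have "(\<integral>\<^sup>+s. indicator {0..<l} s * (\<integral>\<^sup>+\<tau>. indicator {s<..<1} \<tau> * ennreal (1 / \<tau>) \<partial>lborel) \<partial>lborel)
     = (\<integral>\<^sup>+s. (\<integral>\<^sup>+\<tau>. indicator {0..<l} s * (indicator {s<..<1} \<tau> * ennreal (1 / \<tau>)) \<partial>lborel) \<partial>lborel)"
    by (intro nn_integral_cong nn_integral_cmult[symmetric]) measurable
  also have "\<dots> = (\<integral>\<^sup>+\<tau>. (\<integral>\<^sup>+s. indicator {0..<l} s * (indicator {s<..<1} \<tau> * ennreal (1 / \<tau>)) \<partial>lborel) \<partial>lborel)"
    using lborel_pair.Fubini'[OF m] by simp
  also have "\<dots> = (\<integral>\<^sup>+\<tau>. indicator {0..<l} \<tau> + ennreal (l / \<tau>) * indicator {l..1} \<tau> \<partial>lborel)"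
  proof (rule nn_integral_cong_AE)
    have "AE \<tau> in lborel. \<tau> \<noteq> 0 \<and> \<tau> \<noteq> (1::real)"
      using AE_lborel_singleton[of 0] AE_lborel_singleton[of 1] by eventually_elim auto
    then show "AE \<tau> in lborel. (\<integral>\<^sup>+s. indicator {0..<l} s * (indicator {s<..<1} \<tau> * ennreal (1 / \<tau>)) \<partial>lborel)
      = indicator {0..<l} \<tau> + ennreal (l / \<tau>) * indicator {l..1} \<tau>"
    proof eventually_elim
      case (elim \<tau>)
      have "(\<integral>\<^sup>+s. indicator {0..<l} s * (indicator {s<..<1} \<tau> * ennreal (1 / \<tau>)) \<partial>lborel)
         = (\<integral>\<^sup>+s. (indicator {0<..<1} \<tau> * ennreal (1 / \<tau>)) * indicator {0..<min l \<tau>} s \<partial>lborel)"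
        by (intro nn_integral_cong) (auto simp: indicator_def)
      also have "\<dots> = (indicator {0<..<1} \<tau> * ennreal (1 / \<tau>)) * emeasure lborel {0..<min l \<tau>}"
        by (rule nn_integral_cmult_indicator) simp
      also have "\<dots> = indicator {0..<l} \<tau> + ennreal (l / \<tau>) * indicator {l..1} \<tau>"
      proof (cases "0 < \<tau> \<and> \<tau> < 1")
        case True
        then have "emeasure lborel {0..<min l \<tau>} = ennreal (min l \<tau>)" using l by simp
        then show ?thesis using True l by (cases "\<tau> < l") (auto simp: indicator_def ennreal_mult[symmetric])
      next
        case False
        then show ?thesis using elim l assms by (auto simp: indicator_def)
      qed
      finally show ?case .
    qed
  qed
  also have "\<dots> = ennreal l + (\<integral>\<^sup>+\<tau>. ennreal (l / \<tau>) * indicator {l..1} \<tau> \<partial>lborel)"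
    using l by (subst nn_integral_add) auto
  also have "(\<integral>\<^sup>+\<tau>. ennreal (l / \<tau>) * indicator {l..1} \<tau> \<partial>lborel) = ennreal (l * ln 1 - l * ln l)"
    using l assms by (intro nn_integral_FTC_Icc)
       (auto intro!: derivative_eq_intros simp: has_real_derivative_iff_has_vector_derivative[symmetric])
  also have "ennreal l + \<dots> = ennreal (l + negxlnx l)"
    using l assms by (subst ennreal_plus[symmetric]) (auto simp: negxlnx_def mult_nonneg_nonpos)
  finally show ?thesis .
qed

section \<open>Averaging over uniform quantiles\<close>

text \<open>On boxes the integral over values and labels factors over the items, each factor being
  uniform by \<open>nn_integral_rand_quantile\<close>; boxes determine the product measure.\<close>

lemma nn_integral_quantile_PiM:
  assumes F: "real_distribution F" and \<Phi>: "\<Phi> \<in> borel_measurable (PiM {..<n::nat} (\<lambda>_. unif01))"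
  shows "(\<integral>\<^sup>+x. (\<integral>\<^sup>+u. \<Phi> (\<lambda>i\<in>{..<n}. rand_quantile F (x i, u i)) \<partial>PiM {..<n} (\<lambda>_. unif01)) \<partial>PiM {..<n} (\<lambda>_. F))
    = (\<integral>\<^sup>+q. \<Phi> q \<partial>PiM {..<n} (\<lambda>_. unif01))"
proof -
  interpret F: real_distribution F by (rule F)
  let ?X = "PiM {..<n} (\<lambda>_. F)" and ?U = "PiM {..<n} (\<lambda>_. unif01)"
  interpret pX: product_sigma_finite "\<lambda>_::nat. F" by unfold_locales
  interpret pU: product_sigma_finite "\<lambda>_::nat. unif01" by unfold_locales
  interpret U: prob_space ?U by (intro prob_space_PiM prob_space_unif01)
  let ?f = "\<lambda>p. \<lambda>i\<in>{..<n}. rand_quantile F (fst p i, snd p i)"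
  have mQ: "(\<lambda>p. rand_quantile F (fst p i, snd p i)) \<in> borel_measurable (?X \<Otimes>\<^sub>M ?U)" for i
    by (rule measurable_compose[OF _ measurable_rand_quantile[OF F]])
       (intro borel_measurable_Pair measurable_compose[OF measurable_fst] measurable_compose[OF measurable_snd]
          measurable_PiM_component_real F.events_eq_borel sets_unif01)
  have f: "?f \<in> ?X \<Otimes>\<^sub>M ?U \<rightarrow>\<^sub>M ?U"
    by (rule measurable_restrict) (use mQ in \<open>simp add: measurable_cong_sets[OF refl sets_unif01]\<close>)
  have mQ1: "(\<lambda>u. rand_quantile F (x, u)) \<in> borel_measurable unif01" for x
    by (rule measurable_compose[OF _ measurable_rand_quantile[OF F]])
       (intro borel_measurable_Pair measurable_const measurable_ident_sets[OF sets_unif01], simp)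
  have mQ2: "(\<lambda>p. rand_quantile F p) \<in> borel_measurable (F \<Otimes>\<^sub>M unif01)"
  proof -
    have sets: "sets (F \<Otimes>\<^sub>M unif01) = sets (borel :: (real \<times> real) measure)"
      by (simp add: borel_prod[symmetric] cong: sets_pair_measure_cong)
    show ?thesis using measurable_rand_quantile[OF F] by (simp add: measurable_cong_sets[OF sets refl])
  qed
  have "distr (?X \<Otimes>\<^sub>M ?U) ?U ?f = ?U"
  proof (rule pU.PiM_eqI)
    fix A :: "nat \<Rightarrow> real set" assume A: "\<And>i. i \<in> {..<n} \<Longrightarrow> A i \<in> sets unif01"
    have PA: "PiE {..<n} A \<in> sets ?U" using A by (intro sets_PiM_I_finite) auto
    have m1: "(\<lambda>q. indicator (A i) q :: ennreal) \<in> borel_measurable borel" if "i < n" for i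
      using A that by simp
    have "emeasure (distr (?X \<Otimes>\<^sub>M ?U) ?U ?f) (PiE {..<n} A) = (\<integral>\<^sup>+p. indicator (PiE {..<n} A) (?f p) \<partial>(?X \<Otimes>\<^sub>M ?U))"
      using PA by (simp add: nn_integral_distr[OF f, symmetric])
    also have "\<dots> = (\<integral>\<^sup>+x. (\<integral>\<^sup>+u. indicator (PiE {..<n} A) (?f (x, u)) \<partial>?U) \<partial>?X)"
      by (rule U.nn_integral_fst[symmetric]) (intro measurable_compose[OF f] borel_measurable_indicator PA)
    also have "\<dots> = (\<integral>\<^sup>+x. (\<integral>\<^sup>+u. (\<Prod>i<n. indicator (A i) (rand_quantile F (x i, u i))) \<partial>?U) \<partial>?X)"
      by (intro nn_integral_cong) (auto simp: indicator_def PiE_def Pi_def intro: prod_zero)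
    also have "\<dots> = (\<integral>\<^sup>+x. (\<Prod>i<n. \<integral>\<^sup>+u. indicator (A i) (rand_quantile F (x i, u)) \<partial>unif01) \<partial>?X)"
      by (intro nn_integral_cong pU.product_nn_integral_prod)
         (auto intro!: measurable_compose[OF mQ1] m1)
    also have "\<dots> = (\<Prod>i<n. \<integral>\<^sup>+x. (\<integral>\<^sup>+u. indicator (A i) (rand_quantile F (x, u)) \<partial>unif01) \<partial>F)"
    proof (rule pX.product_nn_integral_prod[OF finite_lessThan])
      fix i assume "i \<in> {..<n}"
      then have "(\<lambda>p. indicator (A i) (rand_quantile F p) :: ennreal) \<in> borel_measurable (F \<Otimes>\<^sub>M unif01)"
        by (intro measurable_compose[OF mQ2] m1) simp
      then show "(\<lambda>x. \<integral>\<^sup>+u. indicator (A i) (rand_quantile F (x, u)) \<partial>unif01) \<in> borel_measurable F"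
        by (intro unif01.borel_measurable_nn_integral) simp
    qed
    also have "\<dots> = (\<Prod>i<n. emeasure unif01 (A i))"
      using A by (intro prod.cong refl) (simp add: nn_integral_rand_quantile[OF F m1])
    finally show "emeasure (distr (?X \<Otimes>\<^sub>M ?U) ?U ?f) (PiE {..<n} A) = (\<Prod>i<n. emeasure unif01 (A i))" .
  qed simp_all
  then have "(\<integral>\<^sup>+q. \<Phi> q \<partial>?U) = (\<integral>\<^sup>+q. \<Phi> q \<partial>distr (?X \<Otimes>\<^sub>M ?U) ?U ?f)" by simp
  also have "\<dots> = (\<integral>\<^sup>+p. \<Phi> (?f p) \<partial>(?X \<Otimes>\<^sub>M ?U))" by (subst nn_integral_distr[OF f]) (use \<Phi> in simp_all)
  also have "\<dots> = (\<integral>\<^sup>+x. (\<integral>\<^sup>+u. \<Phi> (?f (x, u)) \<partial>?U) \<partial>?X)"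
    by (rule U.nn_integral_fst[symmetric]) (rule measurable_compose[OF f \<Phi>])
  finally show ?thesis by simp
qed

text \<open>In terms of the quantiles \<open>q\<close>: the probability over the arrival times that item \<open>i\<close> is the best one and wins.\<close>

definition gain :: "nat \<Rightarrow> (real \<Rightarrow> real) \<Rightarrow> (nat \<Rightarrow> real) \<Rightarrow> nat \<Rightarrow> ennreal" where
  "gain n tau q i = (\<Prod>j\<in>{..<n}-{i}. indicator {..<q i} (q j)) *
     (\<integral>\<^sup>+\<tau>. indicator {tau (q i)..1} \<tau> * ((\<integral>\<^sup>+s. indicator {0..<\<tau>} s *
        ennreal (\<Prod>j\<in>{..<n}-{i}. 1 - \<tau> * of_bool (tau (q j) \<le> s)) \<partial>lborel) / ennreal \<tau>) \<partial>lborel)"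

lemma gain_cong:
  assumes "\<And>j. j < n \<Longrightarrow> q j = q' j" "i < n"
  shows "gain n tau q i = gain n tau q' i"
proof -
  have 1: "(\<Prod>j\<in>{..<n}-{i}. indicator {..<q i} (q j) :: ennreal) = (\<Prod>j\<in>{..<n}-{i}. indicator {..<q' i} (q' j))"
    using assms by (intro prod.cong) auto
  have 2: "(\<Prod>j\<in>{..<n}-{i}. 1 - \<tau> * of_bool (tau (q j) \<le> s)) = (\<Prod>j\<in>{..<n}-{i}. 1 - \<tau> * of_bool (tau (q' j) \<le> s))" for \<tau> s :: real
    using assms by (intro prod.cong) auto
  show ?thesis unfolding gain_def 1 2 by (simp only: assms(1)[OF assms(2)])
qed

lemma measurable_gain:
  assumes [measurable]: "tau \<in> borel_measurable borel"
  shows "(\<lambda>q. gain n tau q i) \<in> borel_measurable (PiM {..<n} (\<lambda>_. unif01))"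
proof -
  let ?U = "PiM {..<n} (\<lambda>_. unif01)"
  have [measurable]: "(\<lambda>q. q j) \<in> borel_measurable ?U" for j
    by (rule measurable_PiM_component_real) simp
  have "(\<lambda>(p, s). indicator {0..<snd p} s * ennreal (\<Prod>j\<in>{..<n}-{i}. 1 - snd p * of_bool (tau (fst p j) \<le> s)))
     \<in> borel_measurable ((?U \<Otimes>\<^sub>M lborel) \<Otimes>\<^sub>M (lborel :: real measure))"
    unfolding indicator_def atLeastLessThan_iff case_prod_beta by measurable
  define G where "G p = (\<integral>\<^sup>+s. indicator {0..<snd p} s * ennreal (\<Prod>j\<in>{..<n}-{i}. 1 - snd p * of_bool (tau (fst p j) \<le> s)) \<partial>lborel)" for p
  have [measurable]: "G \<in> borel_measurable (?U \<Otimes>\<^sub>M lborel)"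
    unfolding G_def[abs_def] by (rule lborel.borel_measurable_nn_integral) fact
  have "(\<lambda>(q, \<tau>). indicator {tau (q i)..1} \<tau> * (G (q, \<tau>) / ennreal \<tau>)) \<in> borel_measurable (?U \<Otimes>\<^sub>M lborel)"
    unfolding indicator_def atLeastAtMost_iff case_prod_beta by measurable
  then have "(\<lambda>q. \<integral>\<^sup>+\<tau>. indicator {tau (q i)..1} \<tau> * (G (q, \<tau>) / ennreal \<tau>) \<partial>lborel) \<in> borel_measurable ?U"
    by (rule lborel.borel_measurable_nn_integral)
  then have [measurable]: "(\<lambda>q. \<integral>\<^sup>+\<tau>. indicator {tau (q i)..1} \<tau> * ((\<integral>\<^sup>+s. indicator {0..<\<tau>} s *
        ennreal (\<Prod>j\<in>{..<n}-{i}. 1 - \<tau> * of_bool (tau (q j) \<le> s)) \<partial>lborel) / ennreal \<tau>) \<partial>lborel) \<in> borel_measurable ?U"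
    unfolding G_def fst_conv snd_conv .
  have [measurable]: "(\<lambda>q. \<Prod>j\<in>{..<n}-{i}. indicator {..<q i} (q j) :: ennreal) \<in> borel_measurable ?U"
    unfolding indicator_def lessThan_iff by measurable
  show ?thesis unfolding gain_def by measurable
qed

text \<open>A nonzero \<open>gain\<close> requires a strictly largest quantile, so at most one
  summand survives, and by monotonicity of the quantile that item also has the largest key. When
  quantiles tie at the top the sum is 0 and the inequality is trivial.\<close>

lemma nn_integral_wins_ge_gain:
  assumes F: "real_distribution F" and tau: "tau \<in> borel_measurable borel"
    and anti: "\<And>p q. p \<le> q \<Longrightarrow> tau q \<le> tau p" and nonneg: "\<And>q. 0 \<le> tau q"
  shows "(\<Sum>i<n. \<integral>\<^sup>+q. gain n tau q i \<partial>PiM {..<n} (\<lambda>_. unif01))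
    \<le> (\<integral>\<^sup>+x. (\<integral>\<^sup>+u. (\<integral>\<^sup>+t. indicator {t. wins n (\<lambda>z. tau (rand_quantile F z)) x u t} t
         \<partial>PiM {..<n} (\<lambda>_. unif01)) \<partial>PiM {..<n} (\<lambda>_. unif01)) \<partial>PiM {..<n} (\<lambda>_. F))"
proof -
  let ?U = "PiM {..<n} (\<lambda>_. unif01)" and ?T = "\<lambda>z. tau (rand_quantile F z)"
  have T: "?T \<in> borel_measurable borel"
    by (rule measurable_compose[OF measurable_rand_quantile[OF F] tau])
  have "(\<Sum>i<n. \<integral>\<^sup>+q. gain n tau q i \<partial>?U) = (\<integral>\<^sup>+q. (\<Sum>i<n. gain n tau q i) \<partial>?U)"
    by (rule nn_integral_sum[symmetric]) (rule measurable_gain[OF tau])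
  also have "\<dots> = (\<integral>\<^sup>+x. (\<integral>\<^sup>+u. (\<Sum>i<n. gain n tau (\<lambda>i\<in>{..<n}. rand_quantile F (x i, u i)) i) \<partial>?U) \<partial>PiM {..<n} (\<lambda>_. F))"
    by (rule nn_integral_quantile_PiM[OF F, symmetric]) (intro borel_measurable_sum measurable_gain tau)
  also have "\<dots> \<le> (\<integral>\<^sup>+x. (\<integral>\<^sup>+u. (\<integral>\<^sup>+t. indicator {t. wins n ?T x u t} t \<partial>?U) \<partial>?U) \<partial>PiM {..<n} (\<lambda>_. F))"
  proof (rule nn_integral_mono, rule nn_integral_mono_AE, rule eventually_mono[OF AE_PiM_unif01_inj])
    fix x u :: "nat \<Rightarrow> real" assume u: "inj_on u {..<n}"
    define q where "q = (\<lambda>i. rand_quantile F (x i, u i))"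
    have g: "gain n tau (\<lambda>i\<in>{..<n}. rand_quantile F (x i, u i)) i = gain n tau q i" if "i < n" for i
      using that by (intro gain_cong) (simp_all add: q_def)
    show "(\<Sum>i<n. gain n tau (\<lambda>i\<in>{..<n}. rand_quantile F (x i, u i)) i) \<le> (\<integral>\<^sup>+t. indicator {t. wins n ?T x u t} t \<partial>?U)"
    proof (cases "\<exists>i<n. \<forall>j<n. j \<noteq> i \<longrightarrow> q j < q i")
      case False
      have "gain n tau q i = 0" if "i < n" for i
      proof -
        obtain j where "j < n" "j \<noteq> i" "\<not> q j < q i" using False \<open>i < n\<close> by blast
        then have "(\<Prod>j\<in>{..<n}-{i}. indicator {..<q i} (q j) :: ennreal) = 0"
          by (intro prod_zero) (auto intro!: bexI[of _ j])
        then show ?thesis unfolding gain_def by simp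
      qed
      then show ?thesis by (simp add: g)
    next
      case True
      then obtain i where i: "i < n" "\<And>j. j < n \<Longrightarrow> j \<noteq> i \<Longrightarrow> q j < q i" by blast
      have tot: "strict_total_on {..<n} (\<lambda>i j. key_less (x i, u i) (x j, u j))"
        by (rule strict_total_on_key_less[OF u])
      have top: "key_less (x j, u j) (x i, u i)" if "j < n" "j \<noteq> i" for j
      proof -
        have "\<not> key_less (x i, u i) (x j, u j)"
          using rand_quantile_mono[OF F, of "(x i, u i)" "(x j, u j)"] i(2)[OF that] by (auto simp: q_def)
        then show ?thesis
          using tot that i(1) unfolding strict_total_on_def totalp_on_def by blast
      qed
      have "gain n tau q j = 0" if "j < n" "j \<noteq> i" for j
      proof -
        have "\<not> q i < q j" using i(2)[OF that] by simp
        then have "(\<Prod>k\<in>{..<n}-{j}. indicator {..<q j} (q k) :: ennreal) = 0"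
          using i(1) that by (intro prod_zero) (auto intro!: bexI[of _ i])
        then show ?thesis unfolding gain_def by simp
      qed
      then have "(\<Sum>j<n. gain n tau q j) = (\<Sum>j<n. if j = i then gain n tau q i else 0)"
        by (intro sum.cong) auto
      also have "\<dots> = gain n tau q i" using i(1) by (simp add: sum.delta)
      also have "\<dots> = (\<integral>\<^sup>+\<tau>. indicator {tau (q i)..1} \<tau> * ((\<integral>\<^sup>+s. indicator {0..<\<tau>} s *
        ennreal (\<Prod>j\<in>{..<n}-{i}. 1 - \<tau> * of_bool (tau (q j) \<le> s)) \<partial>lborel) / ennreal \<tau>) \<partial>lborel)"
      proof -
        have "(\<Prod>j\<in>{..<n}-{i}. indicator {..<q i} (q j) :: ennreal) = 1"
          using i(2) by (intro prod.neutral) auto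
        then show ?thesis unfolding gain_def by simp
      qed
      also have "\<dots> \<le> (\<integral>\<^sup>+t. indicator {t. wins n ?T x u t} t \<partial>?U)"
        unfolding q_def
      proof (rule nn_integral_winning[OF tot _ _ i(1) top])
        show "Measurable.pred ?U (wins n ?T x u)"
          by (rule measurable_winning) (auto intro!: T measurable_PiM_component_real)
        show "tau (rand_quantile F (x k, u k)) \<le> tau (rand_quantile F (x j, u j))"
          if "key_less (x j, u j) (x k, u k)" for j k
          using that by (intro anti rand_quantile_mono[OF F])
      qed (use nonneg in auto)
      finally show ?thesis by (simp add: g)
    qed
  qed
  finally show ?thesis .
qed

section \<open>Expected gain for a threshold time and its generalized inverse\<close>

context
  fixes tau \<Theta> :: "real \<Rightarrow> real"
  assumes tau_meas [measurable]: "tau \<in> borel_measurable borel"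
    and \<Theta>_meas [measurable]: "\<Theta> \<in> borel_measurable borel"
    and tau_iff: "\<And>q s. 0 < q \<Longrightarrow> q < 1 \<Longrightarrow> tau q \<le> s \<longleftrightarrow> \<Theta> s \<le> q"
    and \<Theta>_bounds: "\<And>s. 0 \<le> \<Theta> s" "\<And>s. \<Theta> s \<le> 1"
begin

text \<open>The factor of one competitor of an item with quantile \<open>y\<close>. It splits into 1
  - \<tau>, for arriving after \<tau> with any quantile below \<open>y\<close>, and \<tau>, for
  arriving earlier with a quantile also below \<open>\<Theta> s\<close>.\<close>

lemma nn_integral_below_threshold:
  assumes y: "0 < y" "y < 1" and \<tau>: "0 \<le> \<tau>" "\<tau> \<le> 1"
  shows "(\<integral>\<^sup>+q. indicator {..<y} q * ennreal (1 - \<tau> * of_bool (tau q \<le> s)) \<partial>unif01)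
    = ennreal ((1 - \<tau>) * y + \<tau> * min y (\<Theta> s))"
proof -
  let ?m = "min y (\<Theta> s)"
  have "(\<integral>\<^sup>+q. indicator {..<y} q * ennreal (1 - \<tau> * of_bool (tau q \<le> s)) \<partial>unif01)
     = (\<integral>\<^sup>+q. indicator {..<y} q * ennreal (1 - \<tau> * of_bool (\<Theta> s \<le> q)) \<partial>unif01)"
    by (rule nn_integral_cong_AE, rule eventually_mono[OF AE_unif01]) (simp add: tau_iff)
  also have "\<dots> = (\<integral>\<^sup>+q. indicator {..<y} q * ennreal (1 - \<tau> * of_bool (\<Theta> s \<le> q)) * indicator {0..1} q \<partial>lborel)"
    by (rule nn_integral_unif01) measurable
  also have "\<dots> = (\<integral>\<^sup>+q. ennreal (1 - \<tau>) * indicator {0..<y} q + ennreal \<tau> * indicator {0..<?m} q \<partial>lborel)"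
  proof (rule nn_integral_cong)
    fix q
    have e: "ennreal (1 - \<tau>) + ennreal \<tau> = 1" using \<tau> by (simp add: ennreal_plus[symmetric] del: ennreal_plus)
    show "indicator {..<y} q * ennreal (1 - \<tau> * of_bool (\<Theta> s \<le> q)) * indicator {0..1} q
      = ennreal (1 - \<tau>) * indicator {0..<y} q + ennreal \<tau> * indicator {0..<?m} q"
      using y e by (cases "0 \<le> q \<and> q < y") (auto simp: indicator_def)
  qed
  also have "\<dots> = ennreal (1 - \<tau>) * ennreal y + ennreal \<tau> * ennreal ?m"
    using y \<Theta>_bounds(1)[of s] by (subst nn_integral_add) (simp_all add: nn_integral_cmult)
  also have "\<dots> = ennreal ((1 - \<tau>) * y + \<tau> * ?m)"
    using y \<tau> \<Theta>_bounds(1)[of s] by (simp add: ennreal_mult)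
  finally show ?thesis .
qed

text \<open>For fixed \<open>y\<close>, \<tau> and \<open>s\<close> the integrand is a product over
  the other \<open>n - 1\<close> independent quantiles. Fubini moves their integration innermost,
  where it becomes a power of the single factor from
  \<open>nn_integral_below_threshold\<close>.\<close>

lemma nn_integral_gain:
  assumes i: "i < n" and tau_nonneg: "\<And>q. 0 \<le> tau q"
  shows "(\<integral>\<^sup>+q. gain n tau q i \<partial>PiM {..<n} (\<lambda>_. unif01))
    = (\<integral>\<^sup>+y. (\<integral>\<^sup>+\<tau>. indicator {tau y..1} \<tau> * ((\<integral>\<^sup>+s. indicator {0..<\<tau>} s *
        ennreal (((1 - \<tau>) * y + \<tau> * min y (\<Theta> s)) ^ (n - 1)) \<partial>lborel) / ennreal \<tau>) \<partial>lborel) \<partial>unif01)"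
proof -
  define J where "J = {..<n} - {i}"
  have J: "{..<n} = insert i J" "finite J" "i \<notin> J" "card J = n - 1" using i by (auto simp: J_def)
  interpret product_sigma_finite "\<lambda>_::nat. unif01" by unfold_locales
  interpret P: prob_space "PiM J (\<lambda>_. unif01)" by (intro prob_space_PiM prob_space_unif01)
  interpret PL: pair_sigma_finite "PiM J (\<lambda>_. unif01)" "lborel :: real measure" ..
  have m1: "(\<lambda>s. indicator {0..<\<tau>} s * ennreal (((1 - \<tau>) * y + \<tau> * min y (\<Theta> s)) ^ (n - 1))) \<in> borel_measurable lborel" for \<tau> y
    by measurable
  have m2: "(\<lambda>\<tau>. indicator {tau y..1} \<tau> * (G \<tau> / ennreal \<tau>)) \<in> borel_measurable lborel"
    if [measurable]: "G \<in> borel_measurable borel" for G y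
    by measurable
  have [measurable]: "(\<lambda>q. q j) \<in> borel_measurable (PiM J (\<lambda>_. unif01))" for j
    by (rule measurable_PiM_component_real) simp
  have "(\<integral>\<^sup>+q. gain n tau q i \<partial>PiM {..<n} (\<lambda>_. unif01))
     = (\<integral>\<^sup>+y. (\<integral>\<^sup>+q. gain n tau (q(i := y)) i \<partial>PiM J (\<lambda>_. unif01)) \<partial>unif01)"
    using measurable_gain[OF tau_meas, of n i] unfolding J(1)
    by (intro product_nn_integral_insert_rev J)
  also have "\<dots> = (\<integral>\<^sup>+y. (\<integral>\<^sup>+\<tau>. indicator {tau y..1} \<tau> * ((\<integral>\<^sup>+s. indicator {0..<\<tau>} s *
        ennreal (((1 - \<tau>) * y + \<tau> * min y (\<Theta> s)) ^ (n - 1)) \<partial>lborel) / ennreal \<tau>) \<partial>lborel) \<partial>unif01)"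
  proof (rule nn_integral_cong_AE, rule eventually_mono[OF AE_unif01])
    fix y :: real assume y: "0 < y \<and> y < 1"
    define g where "g \<tau> s q = indicator {..<y} q * ennreal (1 - \<tau> * of_bool (tau q \<le> s))" for \<tau> s q :: real
    \<comment> \<open>Everything that does not depend on the other quantiles, with the division
      written as multiplication by an inverse so that it can pass through the integrals.\<close>
    define w where "w \<tau> s = indicator {tau y..1} \<tau> * indicator {0..<\<tau>} s * inverse (ennreal \<tau>)" for \<tau> s :: real
    have [measurable]: "(\<lambda>p. w (fst p) (snd p)) \<in> borel_measurable (borel \<Otimes>\<^sub>M borel)"
      unfolding w_def indicator_def atLeastLessThan_iff atLeastAtMost_iff by measurable
    have gmeas: "(\<lambda>p. g (fst p) (fst (snd p)) (snd (snd p))) \<in> borel_measurable (borel \<Otimes>\<^sub>M borel \<Otimes>\<^sub>M borel)"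
      unfolding g_def indicator_def lessThan_iff by measurable
    have gm [measurable (raw)]: "(\<lambda>p. g (f p) (h p) (k p)) \<in> borel_measurable M"
      if "f \<in> borel_measurable M" "h \<in> borel_measurable M" "k \<in> borel_measurable M" for f h k M
      using measurable_compose[OF _ gmeas, of "\<lambda>p. (f p, h p, k p)" M] that by simp
    have wm [measurable (raw)]: "(\<lambda>p. w (f p) (h p)) \<in> borel_measurable M"
      if "f \<in> borel_measurable M" "h \<in> borel_measurable M" for f h M
      using measurable_compose[OF _ \<open>(\<lambda>p. w (fst p) (snd p)) \<in> _\<close>, of "\<lambda>p. (f p, h p)" M] that by simp
    have "gain n tau (q(i := y)) i = (\<integral>\<^sup>+\<tau>. (\<integral>\<^sup>+s. w \<tau> s * (\<Prod>j\<in>J. g \<tau> s (q j)) \<partial>lborel) \<partial>lborel)" for q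
    proof -
      have upd: "(q(i := y)) j = q j" if "j \<in> J" for j using that J by auto
      have p1: "(\<Prod>j\<in>J. indicator {..<(q(i := y)) i} ((q(i := y)) j) :: ennreal) = (\<Prod>j\<in>J. indicator {..<y} (q j))"
        by (intro prod.cong refl) (simp only: upd fun_upd_same)
      have p2: "(\<Prod>j\<in>J. 1 - \<tau> * of_bool (tau ((q(i := y)) j) \<le> s)) = (\<Prod>j\<in>J. 1 - \<tau> * of_bool (tau (q j) \<le> s))" for \<tau> s :: real
        by (intro prod.cong refl) (simp only: upd)
      have "gain n tau (q(i := y)) i = (\<Prod>j\<in>J. indicator {..<y} (q j)) *
         (\<integral>\<^sup>+\<tau>. indicator {tau y..1} \<tau> * ((\<integral>\<^sup>+s. indicator {0..<\<tau>} s * ennreal (\<Prod>j\<in>J. 1 - \<tau> * of_bool (tau (q j) \<le> s)) \<partial>lborel) / ennreal \<tau>) \<partial>lborel)"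
        unfolding gain_def J_def[symmetric] p1 p2 by simp
      also have "\<dots> = (\<integral>\<^sup>+\<tau>. (\<Prod>j\<in>J. indicator {..<y} (q j)) * (indicator {tau y..1} \<tau> * ((\<integral>\<^sup>+s. indicator {0..<\<tau>} s * ennreal (\<Prod>j\<in>J. 1 - \<tau> * of_bool (tau (q j) \<le> s)) \<partial>lborel) / ennreal \<tau>)) \<partial>lborel)"
      proof (rule nn_integral_cmult[symmetric])
        have "(\<lambda>p. indicator {0..<fst p} (snd p) * ennreal (\<Prod>j\<in>J. 1 - fst p * of_bool (tau (q j) \<le> snd p))) \<in> borel_measurable (borel \<Otimes>\<^sub>M (lborel :: real measure))"
          unfolding indicator_def atLeastLessThan_iff by measurable
        then have "(\<lambda>\<tau>. \<integral>\<^sup>+s. indicator {0..<\<tau>} s * ennreal (\<Prod>j\<in>J. 1 - \<tau> * of_bool (tau (q j) \<le> s)) \<partial>lborel) \<in> borel_measurable borel"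
          by (intro lborel.borel_measurable_nn_integral) (simp add: case_prod_beta)
        then show "(\<lambda>\<tau>. indicator {tau y..1} \<tau> * ((\<integral>\<^sup>+s. indicator {0..<\<tau>} s * ennreal (\<Prod>j\<in>J. 1 - \<tau> * of_bool (tau (q j) \<le> s)) \<partial>lborel) / ennreal \<tau>)) \<in> borel_measurable lborel"
          by (rule m2)
      qed
      also have "\<dots> = (\<integral>\<^sup>+\<tau>. (\<integral>\<^sup>+s. w \<tau> s * (\<Prod>j\<in>J. g \<tau> s (q j)) \<partial>lborel) \<partial>lborel)"
      proof (rule nn_integral_cong)
        fix \<tau> :: real
        let ?P = "\<Prod>j\<in>J. indicator {..<y} (q j) :: ennreal"
        let ?h = "\<lambda>s. indicator {0..<\<tau>} s * ennreal (\<Prod>j\<in>J. 1 - \<tau> * of_bool (tau (q j) \<le> s))"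
        have "?P * (indicator {tau y..1} \<tau> * ((\<integral>\<^sup>+s. ?h s \<partial>lborel) / ennreal \<tau>))
          = (?P * indicator {tau y..1} \<tau> * inverse (ennreal \<tau>)) * (\<integral>\<^sup>+s. ?h s \<partial>lborel)"
          by (simp add: divide_ennreal_def ac_simps)
        also have "\<dots> = (\<integral>\<^sup>+s. (?P * indicator {tau y..1} \<tau> * inverse (ennreal \<tau>)) * ?h s \<partial>lborel)"
          by (rule nn_integral_cmult[symmetric]) measurable
        also have "\<dots> = (\<integral>\<^sup>+s. w \<tau> s * (\<Prod>j\<in>J. g \<tau> s (q j)) \<partial>lborel)"
        proof (rule nn_integral_cong)
          fix s :: real
          show "(?P * indicator {tau y..1} \<tau> * inverse (ennreal \<tau>)) * ?h s = w \<tau> s * (\<Prod>j\<in>J. g \<tau> s (q j))"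
          \<comment> \<open>Pulling \<open>ennreal\<close> out of the product needs nonnegative
            factors, hence \<tau> \<le> 1; outside this range both sides vanish.\<close>
          proof (cases "\<tau> \<in> {tau y..1}")
            case True
            then have "0 \<le> \<tau>" "\<tau> \<le> 1" using tau_nonneg[of y] by auto
            then have "(\<Prod>j\<in>J. g \<tau> s (q j)) = ?P * ennreal (\<Prod>j\<in>J. 1 - \<tau> * of_bool (tau (q j) \<le> s))"
              unfolding g_def prod.distrib by (subst prod_ennreal) auto
            then show ?thesis by (simp add: w_def ac_simps)
          qed (simp add: w_def)
        qed
        finally show "?P * (indicator {tau y..1} \<tau> * ((\<integral>\<^sup>+s. ?h s \<partial>lborel) / ennreal \<tau>)) = (\<integral>\<^sup>+s. w \<tau> s * (\<Prod>j\<in>J. g \<tau> s (q j)) \<partial>lborel)" .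
      qed
      finally show ?thesis .
    qed
    then have "(\<integral>\<^sup>+q. gain n tau (q(i := y)) i \<partial>PiM J (\<lambda>_. unif01))
       = (\<integral>\<^sup>+q. (\<integral>\<^sup>+\<tau>. (\<integral>\<^sup>+s. w \<tau> s * (\<Prod>j\<in>J. g \<tau> s (q j)) \<partial>lborel) \<partial>lborel) \<partial>PiM J (\<lambda>_. unif01))" by simp
    also have "\<dots> = (\<integral>\<^sup>+\<tau>. (\<integral>\<^sup>+q. (\<integral>\<^sup>+s. w \<tau> s * (\<Prod>j\<in>J. g \<tau> s (q j)) \<partial>lborel) \<partial>PiM J (\<lambda>_. unif01)) \<partial>lborel)"
    proof (rule PL.Fubini'[symmetric])
      show "(\<lambda>(q, \<tau>). \<integral>\<^sup>+s. w \<tau> s * (\<Prod>j\<in>J. g \<tau> s (q j)) \<partial>lborel) \<in> borel_measurable (PiM J (\<lambda>_. unif01) \<Otimes>\<^sub>M lborel)"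
        unfolding case_prod_beta
        by (rule lborel.borel_measurable_nn_integral) (unfold case_prod_beta, measurable)
    qed
    also have "\<dots> = (\<integral>\<^sup>+\<tau>. (\<integral>\<^sup>+s. w \<tau> s * ennreal (((1 - \<tau>) * y + \<tau> * min y (\<Theta> s)) ^ (n - 1)) \<partial>lborel) \<partial>lborel)"
    proof (rule nn_integral_cong)
      fix \<tau> :: real
      have "(\<integral>\<^sup>+q. (\<integral>\<^sup>+s. w \<tau> s * (\<Prod>j\<in>J. g \<tau> s (q j)) \<partial>lborel) \<partial>PiM J (\<lambda>_. unif01))
         = (\<integral>\<^sup>+s. (\<integral>\<^sup>+q. w \<tau> s * (\<Prod>j\<in>J. g \<tau> s (q j)) \<partial>PiM J (\<lambda>_. unif01)) \<partial>lborel)"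
        by (rule PL.Fubini'[symmetric]) (unfold case_prod_beta, measurable)
      also have "\<dots> = (\<integral>\<^sup>+s. w \<tau> s * ennreal (((1 - \<tau>) * y + \<tau> * min y (\<Theta> s)) ^ (n - 1)) \<partial>lborel)"
      proof (rule nn_integral_cong)
        fix s :: real
        show "(\<integral>\<^sup>+q. w \<tau> s * (\<Prod>j\<in>J. g \<tau> s (q j)) \<partial>PiM J (\<lambda>_. unif01)) = w \<tau> s * ennreal (((1 - \<tau>) * y + \<tau> * min y (\<Theta> s)) ^ (n - 1))"
        proof (cases "\<tau> \<in> {tau y..1}")
          case True
          then have \<tau>: "0 \<le> \<tau>" "\<tau> \<le> 1" using tau_nonneg[of y] by auto
          have "(\<integral>\<^sup>+q. w \<tau> s * (\<Prod>j\<in>J. g \<tau> s (q j)) \<partial>PiM J (\<lambda>_. unif01)) = w \<tau> s * (\<integral>\<^sup>+q. (\<Prod>j\<in>J. g \<tau> s (q j)) \<partial>PiM J (\<lambda>_. unif01))"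
            by (rule nn_integral_cmult) measurable
          also have "(\<integral>\<^sup>+q. (\<Prod>j\<in>J. g \<tau> s (q j)) \<partial>PiM J (\<lambda>_. unif01)) = (\<Prod>j\<in>J. \<integral>\<^sup>+q. g \<tau> s q \<partial>unif01)"
            by (rule product_nn_integral_prod[OF J(2)]) (auto intro!: gm measurable_ident_sets[OF sets_unif01])
          also have "\<dots> = ennreal ((1 - \<tau>) * y + \<tau> * min y (\<Theta> s)) ^ (n - 1)"
            unfolding g_def using nn_integral_below_threshold[of y \<tau> s] y \<tau> J(4) by simp
          also have "\<dots> = ennreal (((1 - \<tau>) * y + \<tau> * min y (\<Theta> s)) ^ (n - 1))"
            using y \<tau> \<Theta>_bounds by (intro ennreal_power) auto
          finally show ?thesis .
        qed (simp add: w_def)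
      qed
      finally show "(\<integral>\<^sup>+q. (\<integral>\<^sup>+s. w \<tau> s * (\<Prod>j\<in>J. g \<tau> s (q j)) \<partial>lborel) \<partial>PiM J (\<lambda>_. unif01))
         = (\<integral>\<^sup>+s. w \<tau> s * ennreal (((1 - \<tau>) * y + \<tau> * min y (\<Theta> s)) ^ (n - 1)) \<partial>lborel)" .
    qed
    also have "\<dots> = (\<integral>\<^sup>+\<tau>. indicator {tau y..1} \<tau> * ((\<integral>\<^sup>+s. indicator {0..<\<tau>} s *
        ennreal (((1 - \<tau>) * y + \<tau> * min y (\<Theta> s)) ^ (n - 1)) \<partial>lborel) / ennreal \<tau>) \<partial>lborel)"
    proof (rule nn_integral_cong)
      fix \<tau> :: real
      have "(\<integral>\<^sup>+s. w \<tau> s * ennreal (((1 - \<tau>) * y + \<tau> * min y (\<Theta> s)) ^ (n - 1)) \<partial>lborel)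
        = (\<integral>\<^sup>+s. (indicator {tau y..1} \<tau> * inverse (ennreal \<tau>)) * (indicator {0..<\<tau>} s * ennreal (((1 - \<tau>) * y + \<tau> * min y (\<Theta> s)) ^ (n - 1))) \<partial>lborel)"
        by (simp add: w_def ac_simps)
      also have "\<dots> = (indicator {tau y..1} \<tau> * inverse (ennreal \<tau>)) * (\<integral>\<^sup>+s. indicator {0..<\<tau>} s * ennreal (((1 - \<tau>) * y + \<tau> * min y (\<Theta> s)) ^ (n - 1)) \<partial>lborel)"
        by (rule nn_integral_cmult[OF m1])
      finally show "(\<integral>\<^sup>+s. w \<tau> s * ennreal (((1 - \<tau>) * y + \<tau> * min y (\<Theta> s)) ^ (n - 1)) \<partial>lborel)
        = indicator {tau y..1} \<tau> * ((\<integral>\<^sup>+s. indicator {0..<\<tau>} s * ennreal (((1 - \<tau>) * y + \<tau> * min y (\<Theta> s)) ^ (n - 1)) \<partial>lborel) / ennreal \<tau>)"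
        by (simp add: divide_ennreal_def ac_simps)
    qed
    finally show "(\<integral>\<^sup>+q. gain n tau (q(i := y)) i \<partial>PiM J (\<lambda>_. unif01))
      = (\<integral>\<^sup>+\<tau>. indicator {tau y..1} \<tau> * ((\<integral>\<^sup>+s. indicator {0..<\<tau>} s *
        ennreal (((1 - \<tau>) * y + \<tau> * min y (\<Theta> s)) ^ (n - 1)) \<partial>lborel) / ennreal \<tau>) \<partial>lborel)" .
  qed
  finally show ?thesis .
qed

end

text \<open>Solving \<open>q = exp (- \<kappa> / (n * (1 - s)))\<close> for \<open>s\<close> gives
  \<open>1 + \<kappa> / (n * ln q)\<close>, which is clamped to \<open>[l1, l2]\<close> for
  robustness. For \<open>1 \<le> q\<close> the bare formula would be at least 1 and destroy
  monotonicity, hence the explicit cases.\<close>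

definition time_threshold :: "real \<Rightarrow> real \<Rightarrow> real \<Rightarrow> nat \<Rightarrow> real \<Rightarrow> real" where
  "time_threshold l1 l2 \<kappa> n q =
     (if q \<le> 0 then l2 else if 1 \<le> q then l1 else max l1 (min l2 (1 + \<kappa> / (n * ln q))))"

text \<open>The generalized inverse of \<open>time_threshold\<close> in \<open>q\<close>, see \<open>time_threshold_le_iff\<close>.\<close>

definition quantile_threshold :: "real \<Rightarrow> real \<Rightarrow> real \<Rightarrow> nat \<Rightarrow> real \<Rightarrow> real" where
  "quantile_threshold l1 l2 \<kappa> n s =
     (if s < l1 then 1 else if s < l2 then exp (- (\<kappa> / (1 - s)) / n) else 0)"

section \<open>The consistency bound for the chosen thresholds\<close>

context
  fixes l1 l2 \<kappa> :: real and n :: nat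
  assumes l: "0 \<le> l1" "l1 \<le> l2" "l2 \<le> 1" and \<kappa>: "0 < \<kappa>" and n: "0 < n"
begin

abbreviation "tau \<equiv> time_threshold l1 l2 \<kappa> n"
abbreviation "Theta \<equiv> quantile_threshold l1 l2 \<kappa> n"

lemma measurable_time_threshold [measurable]: "tau \<in> borel_measurable borel"
  unfolding time_threshold_def[abs_def] by measurable

lemma measurable_quantile_threshold [measurable]: "Theta \<in> borel_measurable borel"
  unfolding quantile_threshold_def[abs_def] by measurable

lemma time_threshold_le_iff:
  assumes q: "0 < q" "q < 1"
  shows "tau q \<le> s \<longleftrightarrow> Theta s \<le> q"
proof -
  consider "s < l1" | "l2 \<le> s" "l1 \<le> s" | "l1 \<le> s" "s < l2" by linarith
  then show ?thesis
  proof cases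
    case 3
    then have s: "0 < 1 - s" using l by simp
    have lq: "ln q < 0" using q by simp
    have "tau q \<le> s \<longleftrightarrow> 1 + \<kappa> / (n * ln q) \<le> s"
      using q 3 by (auto simp: time_threshold_def)
    also have "\<dots> \<longleftrightarrow> - \<kappa> \<le> (1 - s) * (n * ln q)"
      using lq n s by (simp add: field_simps mult_less_0_iff)
    also have "\<dots> \<longleftrightarrow> - (\<kappa> / (1 - s)) / n \<le> ln q"
      using s n by (simp add: field_simps)
    also have "\<dots> \<longleftrightarrow> exp (- (\<kappa> / (1 - s)) / n) \<le> q"
      using q by (simp add: ln_ge_iff)
    finally show ?thesis using 3 by (simp add: quantile_threshold_def)
  qed (use q l in \<open>auto simp: time_threshold_def quantile_threshold_def\<close>)
qed

lemma time_threshold_bounds: "l1 \<le> tau q" "tau q \<le> l2"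
  using l by (auto simp: time_threshold_def)

lemma time_threshold_antimono:
  assumes "p \<le> q"
  shows "tau q \<le> tau p"
proof -
  consider "p \<le> 0" | "1 \<le> q" | "0 < p" "p < 1" "0 < q" "q < 1" using assms by linarith
  then show ?thesis
  proof cases
    case 1
    then show ?thesis using time_threshold_bounds(2)[of q] by (simp add: time_threshold_def)
  next
    case 2
    then show ?thesis using time_threshold_bounds(1)[of p] by (simp add: time_threshold_def)
  next
    case 3
    \<comment> \<open>The equivalence at the time \<open>tau p\<close> suffices: it gives
      \<open>Theta (tau p) \<le> p \<le> q\<close>, and back again
      \<open>tau q \<le> tau p\<close>.\<close>
    then show ?thesis using time_threshold_le_iff[of p "tau p"] time_threshold_le_iff[of q "tau p"] assms by simp
  qed
qed

lemma quantile_threshold_bounds: "0 \<le> Theta s" "Theta s \<le> 1"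
proof -
  have "- (\<kappa> / (1 - s)) / real n \<le> 0" if "s < l2"
    using that l \<kappa> n by (auto simp: divide_nonneg_nonneg)
  then show "0 \<le> Theta s" "Theta s \<le> 1" by (auto simp: quantile_threshold_def)
qed

lemma quantile_threshold_antimono:
  assumes "s \<le> t"
  shows "Theta t \<le> Theta s"
proof -
  consider "s < l1" | "l2 \<le> t" | "l1 \<le> s" "t < l2" by linarith
  then show ?thesis
  proof cases
    case 1
    then show ?thesis using quantile_threshold_bounds(2)[of t] by (simp add: quantile_threshold_def)
  next
    case 2
    then show ?thesis using quantile_threshold_bounds(1)[of s] l by (simp add: quantile_threshold_def)
  next
    case 3
    then have "\<kappa> / (1 - s) / n \<le> \<kappa> / (1 - t) / n"
      using assms l \<kappa> n by (intro divide_right_mono divide_left_mono) auto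
    then show ?thesis using 3 assms by (simp add: quantile_threshold_def)
  qed
qed

lemma quantile_threshold_power:
  assumes "l1 \<le> s" "s < l2"
  shows "Theta s ^ n = exp (- (\<kappa> / (1 - s)))"
  using assms n by (simp add: quantile_threshold_def exp_of_nat_mult[symmetric])

text \<open>The integrand of \<open>nn_integral_gain\<close> summed over the \<open>n\<close>
  equally likely items. The condition \<open>tau y \<le> \<tau>\<close> appears as
  \<open>Theta \<tau> \<le> y\<close>, which makes it a lower limit for the integral over
  \<open>y\<close>.\<close>

definition payoff :: "real \<Rightarrow> real \<Rightarrow> real \<Rightarrow> ennreal" where
  "payoff y \<tau> s = indicator {0<..<1} y * indicator {Theta \<tau>..} y *
     ennreal (real n * ((1 - \<tau>) * y + \<tau> * min y (Theta s)) ^ (n - 1) / \<tau>)"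

lemma measurable_payoff [measurable (raw)]:
  assumes [measurable]: "f \<in> borel_measurable M" "g \<in> borel_measurable M" "h \<in> borel_measurable M"
  shows "(\<lambda>p. payoff (f p) (g p) (h p)) \<in> borel_measurable M"
  unfolding payoff_def indicator_def greaterThanLessThan_iff atLeast_iff by measurable

text \<open>The triangle of pairs with 0 \<le> s < \<tau> < 1 as a weight, so that every order of
  integration ranges over whole lines.\<close>

definition domain_ind :: "real \<Rightarrow> real \<Rightarrow> ennreal" where
  "domain_ind \<tau> s = indicator {0<..<1} \<tau> * indicator {0..<\<tau>} s"

lemma measurable_domain_ind [measurable (raw)]:
  assumes [measurable]: "f \<in> borel_measurable M" "g \<in> borel_measurable M"
  shows "(\<lambda>p. domain_ind (f p) (g p)) \<in> borel_measurable M"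
  unfolding domain_ind_def indicator_def greaterThanLessThan_iff atLeastLessThan_iff by measurable

text \<open>All items have the same expected gain, whence the factor \<open>n\<close>. Reordering
  makes \<open>y\<close> the innermost variable, where the integral is elementary, and
  \<open>s\<close> the outermost, over which the target bound is an integral.\<close>

lemma sum_nn_integral_gain_ge:
  "(\<integral>\<^sup>+s. (\<integral>\<^sup>+\<tau>. domain_ind \<tau> s * (\<integral>\<^sup>+y. payoff y \<tau> s \<partial>lborel) \<partial>lborel) \<partial>lborel)
    \<le> (\<Sum>i<n. \<integral>\<^sup>+q. gain n tau q i \<partial>PiM {..<n} (\<lambda>_. unif01))"
proof -
  define k :: "real \<Rightarrow> real \<Rightarrow> real \<Rightarrow> ennreal" where "k y \<tau> s = indicator {0..<\<tau>} s * ennreal (((1 - \<tau>) * y + \<tau> * min y (Theta s)) ^ (n - 1))" for y \<tau> s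
  have k [measurable (raw)]: "(\<lambda>p. k (f p) (g p) (h p)) \<in> borel_measurable M"
    if [measurable]: "f \<in> borel_measurable M" "g \<in> borel_measurable M" "h \<in> borel_measurable M" for f g h M
    unfolding k_def indicator_def atLeastLessThan_iff by measurable
  define K where "K y \<tau> = (\<integral>\<^sup>+s. k y \<tau> s \<partial>lborel)" for y \<tau>
  have K [measurable (raw)]: "(\<lambda>p. K (f p) (g p)) \<in> borel_measurable M"
    if [measurable]: "f \<in> borel_measurable M" "g \<in> borel_measurable M" for f g M
    unfolding K_def by measurable
  define V where "V y = (\<integral>\<^sup>+\<tau>. indicator {tau y..1} \<tau> * (K y \<tau> / ennreal \<tau>) \<partial>lborel)" for y
  have V [measurable]: "V \<in> borel_measurable borel"
    unfolding V_def indicator_def atLeastAtMost_iff by measurable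
  have "(\<Sum>i<n. \<integral>\<^sup>+q. gain n tau q i \<partial>PiM {..<n} (\<lambda>_. unif01)) = (\<Sum>i<n. \<integral>\<^sup>+y. V y \<partial>unif01)"
    unfolding V_def K_def k_def using l time_threshold_bounds(1)
    by (intro sum.cong refl nn_integral_gain time_threshold_le_iff quantile_threshold_bounds)
       (auto intro: order_trans)
  also have "\<dots> = of_nat n * (\<integral>\<^sup>+y. V y \<partial>unif01)" by simp
  also have "\<dots> = (\<integral>\<^sup>+y. of_nat n * V y \<partial>unif01)"
    by (rule nn_integral_cmult[symmetric]) simp
  also have "\<dots> = (\<integral>\<^sup>+y. of_nat n * V y * indicator {0..1} y \<partial>lborel)"
    by (rule nn_integral_unif01) measurable
  also have "\<dots> \<ge> (\<integral>\<^sup>+y. (\<integral>\<^sup>+\<tau>. (\<integral>\<^sup>+s. domain_ind \<tau> s * payoff y \<tau> s \<partial>lborel) \<partial>lborel) \<partial>lborel)"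
  proof (rule nn_integral_mono)
    fix y :: real
    show "(\<integral>\<^sup>+\<tau>. (\<integral>\<^sup>+s. domain_ind \<tau> s * payoff y \<tau> s \<partial>lborel) \<partial>lborel) \<le> of_nat n * V y * indicator {0..1} y"
    proof (cases "0 < y \<and> y < 1")
      case False
      then have "payoff y \<tau> s = 0" for \<tau> s by (auto simp: payoff_def)
      then show ?thesis by simp
    next
      case True
      have "(\<integral>\<^sup>+\<tau>. (\<integral>\<^sup>+s. domain_ind \<tau> s * payoff y \<tau> s \<partial>lborel) \<partial>lborel)
        \<le> (\<integral>\<^sup>+\<tau>. of_nat n * (indicator {tau y..1} \<tau> * (K y \<tau> / ennreal \<tau>)) \<partial>lborel)"
      proof (rule nn_integral_mono)
        fix \<tau> :: real
        have "(\<integral>\<^sup>+s. domain_ind \<tau> s * payoff y \<tau> s \<partial>lborel) \<le> (\<integral>\<^sup>+s. of_nat n * indicator {tau y..1} \<tau> * inverse (ennreal \<tau>) * k y \<tau> s \<partial>lborel)"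
        proof (rule nn_integral_mono)
          fix s :: real
          show "domain_ind \<tau> s * payoff y \<tau> s \<le> of_nat n * indicator {tau y..1} \<tau> * inverse (ennreal \<tau>) * k y \<tau> s"
          proof (cases "0 < \<tau> \<and> \<tau> < 1 \<and> Theta \<tau> \<le> y \<and> 0 \<le> s \<and> s < \<tau>")
            case t: True
            let ?x = "((1 - \<tau>) * y + \<tau> * min y (Theta s)) ^ (n - 1)"
            have "0 \<le> ?x" using t True quantile_threshold_bounds(1)[of s] by (intro zero_le_power) auto
            then have "ennreal (real n * ?x / \<tau>) = of_nat n * inverse (ennreal \<tau>) * ennreal ?x"
              using t by (simp add: ennreal_mult divide_inverse inverse_ennreal ennreal_of_nat_eq_real_of_nat ac_simps)
            then show ?thesis
              using t True time_threshold_le_iff[of y \<tau>]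
              by (simp add: domain_ind_def payoff_def k_def)
          qed (auto simp: domain_ind_def payoff_def)
        qed
        also have "\<dots> = of_nat n * indicator {tau y..1} \<tau> * inverse (ennreal \<tau>) * K y \<tau>"
          unfolding K_def by (rule nn_integral_cmult) measurable
        finally show "(\<integral>\<^sup>+s. domain_ind \<tau> s * payoff y \<tau> s \<partial>lborel) \<le> of_nat n * (indicator {tau y..1} \<tau> * (K y \<tau> / ennreal \<tau>))"
          by (simp add: divide_ennreal_def ac_simps)
      qed
      also have "\<dots> = of_nat n * V y"
        unfolding V_def by (rule nn_integral_cmult) measurable
      finally show ?thesis using True by simp
    qed
  qed
  also (xtrans) have "(\<integral>\<^sup>+y. (\<integral>\<^sup>+\<tau>. (\<integral>\<^sup>+s. domain_ind \<tau> s * payoff y \<tau> s \<partial>lborel) \<partial>lborel) \<partial>lborel)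
      = (\<integral>\<^sup>+\<tau>. (\<integral>\<^sup>+y. (\<integral>\<^sup>+s. domain_ind \<tau> s * payoff y \<tau> s \<partial>lborel) \<partial>lborel) \<partial>lborel)"
    by (rule lborel_pair.Fubini'[symmetric]) (unfold case_prod_beta, measurable)
  also (xtrans) have "\<dots> = (\<integral>\<^sup>+\<tau>. (\<integral>\<^sup>+s. domain_ind \<tau> s * (\<integral>\<^sup>+y. payoff y \<tau> s \<partial>lborel) \<partial>lborel) \<partial>lborel)"
  proof (rule nn_integral_cong)
    fix \<tau> :: real
    have "(\<integral>\<^sup>+y. (\<integral>\<^sup>+s. domain_ind \<tau> s * payoff y \<tau> s \<partial>lborel) \<partial>lborel) = (\<integral>\<^sup>+s. (\<integral>\<^sup>+y. domain_ind \<tau> s * payoff y \<tau> s \<partial>lborel) \<partial>lborel)"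
      by (rule lborel_pair.Fubini'[symmetric]) (unfold case_prod_beta, measurable)
    also have "\<dots> = (\<integral>\<^sup>+s. domain_ind \<tau> s * (\<integral>\<^sup>+y. payoff y \<tau> s \<partial>lborel) \<partial>lborel)"
      by (intro nn_integral_cong nn_integral_cmult) measurable
    finally show "(\<integral>\<^sup>+y. (\<integral>\<^sup>+s. domain_ind \<tau> s * payoff y \<tau> s \<partial>lborel) \<partial>lborel) = (\<integral>\<^sup>+s. domain_ind \<tau> s * (\<integral>\<^sup>+y. payoff y \<tau> s \<partial>lborel) \<partial>lborel)" .
  qed
  also (xtrans) have "\<dots> = (\<integral>\<^sup>+s. (\<integral>\<^sup>+\<tau>. domain_ind \<tau> s * (\<integral>\<^sup>+y. payoff y \<tau> s \<partial>lborel) \<partial>lborel) \<partial>lborel)"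
    by (rule lborel_pair.Fubini'[symmetric]) (unfold case_prod_beta, measurable)
  finally show ?thesis .
qed

text \<open>A balance in which \<open>l1 + E\<close> occurs on both sides. The boundary terms of
  \<open>nn_integral_quantile_ge\<close> cost at most \<open>l1 + E\<close> in total. Times
  \<open>s < l1\<close> earn \<open>l1\<close> plus \<open>negxlnx l1\<close>; times in
  \<open>[l1, l2)\<close> earn the target integral plus \<open>E\<close>, by the equation of
  \<kappa>; the gain of later times is dropped.\<close>

lemma nn_integral_payoff_ge:
  assumes sums: "(\<lambda>k. \<kappa> ^ Suc k / (fact (Suc k) * real (Suc k))) sums 1"
  shows "ennreal (negxlnx l1) + (\<integral>\<^sup>+s. indicator {l1..<l2} s *
      (\<integral>\<^sup>+\<tau>. indicator {s<..<1} \<tau> * ennreal (exp (- \<kappa> * \<tau> / (1 - s)) / \<tau>) \<partial>lborel) \<partial>lborel)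
    \<le> (\<integral>\<^sup>+s. (\<integral>\<^sup>+\<tau>. domain_ind \<tau> s * (\<integral>\<^sup>+y. payoff y \<tau> s \<partial>lborel) \<partial>lborel) \<partial>lborel)"
    (is "?\<beta> + (\<integral>\<^sup>+s. _ * ?I s \<partial>lborel) \<le> ?A")
proof -
  have Ib [measurable (raw)]: "(\<lambda>p. indicator {f p<..<1} (g p) :: ennreal) \<in> borel_measurable M"
    if [measurable]: "f \<in> borel_measurable M" "g \<in> borel_measurable M" for f g :: "'a \<Rightarrow> real" and M
    unfolding indicator_def greaterThanLessThan_iff by measurable
  have [measurable]: "?I \<in> borel_measurable borel" by measurable
  define E where "E = (\<integral>\<^sup>+s. indicator {l1..<l2} s * ennreal (exp (- (\<kappa> / (1 - s)))) \<partial>lborel)"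
  have E_le: "E \<le> 1"
  proof -
    have "E \<le> (\<integral>\<^sup>+s. indicator {0..1::real} s \<partial>lborel)"
      unfolding E_def using l \<kappa> by (intro nn_integral_mono) (auto simp: indicator_def)
    then show ?thesis by simp
  qed
  define B where "B = (\<integral>\<^sup>+s. (\<integral>\<^sup>+\<tau>. domain_ind \<tau> s * ennreal (Theta \<tau> ^ n / \<tau>) \<partial>lborel) \<partial>lborel)"
  have B_le: "B \<le> ennreal l1 + E"
  proof -
    have "B = (\<integral>\<^sup>+\<tau>. (\<integral>\<^sup>+s. domain_ind \<tau> s * ennreal (Theta \<tau> ^ n / \<tau>) \<partial>lborel) \<partial>lborel)"
      unfolding B_def by (rule lborel_pair.Fubini') (unfold case_prod_beta, measurable)
    \<comment> \<open>The slice in \<open>s\<close> has length \<tau>, which cancels the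
      denominator.\<close>
    also have "\<dots> = (\<integral>\<^sup>+\<tau>. indicator {0<..<1} \<tau> * ennreal (Theta \<tau> ^ n) \<partial>lborel)"
    proof (rule nn_integral_cong)
      fix \<tau> :: real
      have "(\<integral>\<^sup>+s. domain_ind \<tau> s * ennreal (Theta \<tau> ^ n / \<tau>) \<partial>lborel)
        = (\<integral>\<^sup>+s. (indicator {0<..<1} \<tau> * ennreal (Theta \<tau> ^ n / \<tau>)) * indicator {0..<\<tau>} s \<partial>lborel)"
        by (simp add: domain_ind_def ac_simps)
      also have "\<dots> = (indicator {0<..<1} \<tau> * ennreal (Theta \<tau> ^ n / \<tau>)) * emeasure lborel {0..<\<tau>}"
        by (rule nn_integral_cmult_indicator) simp
      also have "\<dots> = indicator {0<..<1} \<tau> * ennreal (Theta \<tau> ^ n)"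
        using quantile_threshold_bounds[of \<tau>]
        by (cases "0 < \<tau> \<and> \<tau> < 1") (auto simp: indicator_def ennreal_mult[symmetric])
      finally show "(\<integral>\<^sup>+s. domain_ind \<tau> s * ennreal (Theta \<tau> ^ n / \<tau>) \<partial>lborel) = indicator {0<..<1} \<tau> * ennreal (Theta \<tau> ^ n)" .
    qed
    also have "\<dots> \<le> (\<integral>\<^sup>+s. indicator {0..<l1} s + indicator {l1..<l2} s * ennreal (exp (- (\<kappa> / (1 - s)))) \<partial>lborel)"
    proof (rule nn_integral_mono)
      fix s :: real
      consider "s < l1" | "l1 \<le> s" "s < l2" | "l2 \<le> s" by linarith
      then show "indicator {0<..<1} s * ennreal (Theta s ^ n) \<le> indicator {0..<l1} s + indicator {l1..<l2} s * ennreal (exp (- (\<kappa> / (1 - s))))"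
      proof cases
        case 1
        then show ?thesis by (auto simp: indicator_def quantile_threshold_def)
      next
        case 2
        then show ?thesis using quantile_threshold_power[OF 2] by (auto simp: indicator_def)
      next
        case 3
        then show ?thesis using n l by (auto simp: indicator_def quantile_threshold_def)
      qed
    qed
    also have "\<dots> = ennreal l1 + E"
      unfolding E_def using l by (subst nn_integral_add) auto
    finally show ?thesis .
  qed
  have "ennreal (l1 + negxlnx l1) + ((\<integral>\<^sup>+s. indicator {l1..<l2} s * ?I s \<partial>lborel) + E)
    = (\<integral>\<^sup>+s. indicator {0..<l1} s * (\<integral>\<^sup>+\<tau>. indicator {s<..<1} \<tau> * ennreal (1 / \<tau>) \<partial>lborel)
        + (indicator {l1..<l2} s * ?I s + indicator {l1..<l2} s * ennreal (exp (- (\<kappa> / (1 - s))))) \<partial>lborel)"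
  proof -
    have l1: "l1 \<le> 1" using l by simp
    show ?thesis
      unfolding E_def nn_integral_inverse_triangle[OF l(1) l1, symmetric]
      by (simp add: nn_integral_add)
  qed
  also have "\<dots> \<le> (\<integral>\<^sup>+s. (\<integral>\<^sup>+\<tau>. domain_ind \<tau> s * (\<integral>\<^sup>+y. payoff y \<tau> s \<partial>lborel) + domain_ind \<tau> s * ennreal (Theta \<tau> ^ n / \<tau>) \<partial>lborel) \<partial>lborel)"
  proof (rule nn_integral_mono)
    fix s :: real
    have gain: "ennreal (((1 - \<tau> + \<tau> * Theta s) ^ n - \<tau> * Theta s ^ n) / ((1 - \<tau>) * \<tau>))
       \<le> (\<integral>\<^sup>+y. payoff y \<tau> s \<partial>lborel) + ennreal (Theta \<tau> ^ n / \<tau>)" if "s < \<tau>" "0 < \<tau>" "\<tau> < 1" for \<tau>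
      unfolding payoff_def
      using that quantile_threshold_bounds quantile_threshold_antimono[of s \<tau>] n
      by (intro nn_integral_quantile_ge) auto
    consider "0 \<le> s" "s < l1" | "l1 \<le> s" "s < l2" | "s < 0 \<or> l2 \<le> s" by linarith
    then show "indicator {0..<l1} s * (\<integral>\<^sup>+\<tau>. indicator {s<..<1} \<tau> * ennreal (1 / \<tau>) \<partial>lborel)
        + (indicator {l1..<l2} s * ?I s + indicator {l1..<l2} s * ennreal (exp (- (\<kappa> / (1 - s)))))
      \<le> (\<integral>\<^sup>+\<tau>. domain_ind \<tau> s * (\<integral>\<^sup>+y. payoff y \<tau> s \<partial>lborel) + domain_ind \<tau> s * ennreal (Theta \<tau> ^ n / \<tau>) \<partial>lborel)"
    proof cases
      case 1
      have "(\<integral>\<^sup>+\<tau>. indicator {s<..<1} \<tau> * ennreal (1 / \<tau>) \<partial>lborel)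
        \<le> (\<integral>\<^sup>+\<tau>. domain_ind \<tau> s * (\<integral>\<^sup>+y. payoff y \<tau> s \<partial>lborel) + domain_ind \<tau> s * ennreal (Theta \<tau> ^ n / \<tau>) \<partial>lborel)"
      proof (rule nn_integral_mono)
        fix \<tau> :: real
        show "indicator {s<..<1} \<tau> * ennreal (1 / \<tau>) \<le> domain_ind \<tau> s * (\<integral>\<^sup>+y. payoff y \<tau> s \<partial>lborel) + domain_ind \<tau> s * ennreal (Theta \<tau> ^ n / \<tau>)"
        proof (cases "s < \<tau> \<and> \<tau> < 1")
          case True
          \<comment> \<open>Before \<open>l1\<close> every quantile in (0, 1) is below the
            threshold, and the gain collapses to \<open>1 / \<tau>\<close>.\<close>
          have "Theta s = 1" using 1 by (simp add: quantile_threshold_def)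
          then have "((1 - \<tau> + \<tau> * Theta s) ^ n - \<tau> * Theta s ^ n) / ((1 - \<tau>) * \<tau>) = 1 / \<tau>"
            using True by simp
          then show ?thesis using gain[of \<tau>] True 1 by (simp add: domain_ind_def indicator_def)
        qed simp
      qed
      then show ?thesis using 1 by simp
    next
      case 2
      then have s: "0 \<le> s" "s < 1" using l by auto
      define c where "c = \<kappa> / (1 - s)"
      have "ennreal (exp (- (\<kappa> / (1 - s)))) = (\<integral>\<^sup>+\<tau>. indicator {s<..<1} \<tau> * ennreal ((exp (- c * \<tau>) - exp (- c)) / (1 - \<tau>)) \<partial>lborel)"
        unfolding c_def by (rule nn_integral_exp_diff_quotient[OF s \<kappa> sums, symmetric])
      then have "?I s + ennreal (exp (- (\<kappa> / (1 - s))))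
        = (\<integral>\<^sup>+\<tau>. indicator {s<..<1} \<tau> * ennreal (exp (- \<kappa> * \<tau> / (1 - s)) / \<tau>)
            + indicator {s<..<1} \<tau> * ennreal ((exp (- c * \<tau>) - exp (- c)) / (1 - \<tau>)) \<partial>lborel)"
        by (simp add: nn_integral_add)
      also have "\<dots> \<le> (\<integral>\<^sup>+\<tau>. domain_ind \<tau> s * (\<integral>\<^sup>+y. payoff y \<tau> s \<partial>lborel) + domain_ind \<tau> s * ennreal (Theta \<tau> ^ n / \<tau>) \<partial>lborel)"
      proof (rule nn_integral_mono)
        fix \<tau> :: real
        show "indicator {s<..<1} \<tau> * ennreal (exp (- \<kappa> * \<tau> / (1 - s)) / \<tau>)
            + indicator {s<..<1} \<tau> * ennreal ((exp (- c * \<tau>) - exp (- c)) / (1 - \<tau>))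
          \<le> domain_ind \<tau> s * (\<integral>\<^sup>+y. payoff y \<tau> s \<partial>lborel) + domain_ind \<tau> s * ennreal (Theta \<tau> ^ n / \<tau>)"
        proof (cases "s < \<tau> \<and> \<tau> < 1")
          case True
          then have \<tau>: "0 < \<tau>" "\<tau> < 1" using s by auto
          have c0: "0 < c" using s \<kappa> by (simp add: c_def)
          have "- c \<le> - c * \<tau>" using c0 \<tau> by simp
          then have d0: "0 \<le> (exp (- c * \<tau>) - exp (- c)) / (1 - \<tau>)" using \<tau> by simp
          have th: "Theta s = exp (- c / real n)" using 2 by (simp add: quantile_threshold_def c_def)
          have ex: "- \<kappa> * \<tau> / (1 - s) = - c * \<tau>" by (simp add: c_def)
          have "ennreal (exp (- \<kappa> * \<tau> / (1 - s)) / \<tau>) + ennreal ((exp (- c * \<tau>) - exp (- c)) / (1 - \<tau>))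
            = ennreal (exp (- c * \<tau>) / \<tau> + (exp (- c * \<tau>) - exp (- c)) / (1 - \<tau>))"
            unfolding ex using \<tau> d0 by (intro ennreal_plus[symmetric]) auto
          also have "\<dots> \<le> ennreal (((1 - \<tau> + \<tau> * Theta s) ^ n - \<tau> * Theta s ^ n) / ((1 - \<tau>) * \<tau>))"
            unfolding th by (intro ennreal_leI gain_ge \<tau> n)
          also note gain[of \<tau>]
          finally show ?thesis using True \<tau> s by (simp add: domain_ind_def indicator_def)
        qed simp
      qed
      finally show ?thesis using 2 by simp
    next
      case 3
      then show ?thesis using l by (auto simp: indicator_def)
    qed
  qed
  also have "\<dots> = ?A + B"
    unfolding B_def by (simp add: nn_integral_add)
  also have "\<dots> \<le> ?A + (ennreal l1 + E)" by (intro add_left_mono B_le)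
  finally have "ennreal (l1 + negxlnx l1) + ((\<integral>\<^sup>+s. indicator {l1..<l2} s * ?I s \<partial>lborel) + E) \<le> ?A + (ennreal l1 + E)" .
  moreover have "ennreal (l1 + negxlnx l1) = ennreal l1 + ?\<beta>"
    using l by (auto simp: negxlnx_def mult_nonneg_nonpos)
  ultimately have "(ennreal l1 + E) + (?\<beta> + (\<integral>\<^sup>+s. indicator {l1..<l2} s * ?I s \<partial>lborel)) \<le> (ennreal l1 + E) + ?A"
    by (simp only: ac_simps)
  \<comment> \<open>Cancellation in the extended nonnegative reals is valid only for a finite
    summand.\<close>
  moreover have "ennreal l1 + E \<noteq> \<infinity>" using E_le by (auto simp: top_unique)
  ultimately show ?thesis by (simp only: ennreal_add_left_cancel_le) simp
qed

end

text \<open>Without integrability the Lebesgue integral is 0 by convention, so the bound still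
  holds; this spares integrability proofs for the nested integrals of the theorem.\<close>

lemma ennreal_integral_le_nn_integral:
  fixes f :: "'a \<Rightarrow> real"
  assumes "AE x in M. 0 \<le> f x"
  shows "ennreal (integral\<^sup>L M f) \<le> (\<integral>\<^sup>+x. ennreal (f x) \<partial>M)"
proof (cases "integrable M f")
  case True
  then show ?thesis using assms by (simp add: nn_integral_eq_integral)
next
  case False
  then show ?thesis by (simp add: not_integrable_integral_eq)
qed

lemma ennreal_interval_integral_le:
  fixes f :: "real \<Rightarrow> real" and a b :: real
  assumes "a \<le> b" "\<And>x. a < x \<Longrightarrow> x < b \<Longrightarrow> 0 \<le> f x"
  shows "0 \<le> (LBINT x=a..b. f x)"
    and "ennreal (LBINT x=a..b. f x) \<le> (\<integral>\<^sup>+x. indicator {a<..<b} x * ennreal (f x) \<partial>lborel)"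
proof -
  have eq: "(LBINT x=a..b. f x) = (LINT x|lborel. indicator {a<..<b} x * f x)"
    using assms(1) by (simp add: interval_lebesgue_integral_def set_lebesgue_integral_def)
  have nonneg: "0 \<le> indicator {a<..<b} x * f x" for x
    using assms(2) by (simp add: indicator_def)
  show "0 \<le> (LBINT x=a..b. f x)" unfolding eq using nonneg by simp
  have "ennreal (LBINT x=a..b. f x) \<le> (\<integral>\<^sup>+x. ennreal (indicator {a<..<b} x * f x) \<partial>lborel)"
    unfolding eq using nonneg by (intro ennreal_integral_le_nn_integral) simp
  also have "\<dots> = (\<integral>\<^sup>+x. indicator {a<..<b} x * ennreal (f x) \<partial>lborel)"
    by (intro nn_integral_cong) (simp add: indicator_def)
  finally show "ennreal (LBINT x=a..b. f x) \<le> (\<integral>\<^sup>+x. indicator {a<..<b} x * ennreal (f x) \<partial>lborel)" .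
qed

section \<open>Consistency and robustness\<close>

lemma negxlnx_ge_between:
  assumes "0 \<le> a" "a \<le> x" "x \<le> b" "b \<le> 1" "negxlnx a = c" "negxlnx b = c"
  shows "c \<le> negxlnx x"
\<comment> \<open>Convexity of \<open>x * ln x\<close> is used on the open half-line only. A root
  \<open>a = 0\<close> forces \<open>c = 0\<close>, where nonnegativity of \<open>negxlnx\<close> is
  enough.\<close>
proof (cases "a = 0 \<or> a = b")
  case True
  moreover have "0 \<le> negxlnx x" using assms by (auto simp: negxlnx_def mult_nonneg_nonpos)
  ultimately show ?thesis using assms by (auto simp: negxlnx_def)
next
  case False
  then have ab: "0 < a" "a < b" using assms by auto
  have "convex_on {0<..} (\<lambda>x::real. x * ln x)"
  proof (rule f''_ge0_imp_convex)
    show "((\<lambda>x. x * ln x) has_real_derivative ln x + 1) (at x)" if "x \<in> {0<..}" for x :: real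
      using that by (auto intro!: derivative_eq_intros)
    show "((\<lambda>x. ln x + 1) has_real_derivative 1 / x) (at x)" if "x \<in> {0<..}" for x :: real
      using that by (auto intro!: derivative_eq_intros)
  qed auto
  moreover define t where "t = (x - a) / (b - a)"
  then have t: "0 \<le> t" "t \<le> 1" "x = a + t * (b - a)"
    using ab assms by auto
  then have "x = (1 - t) * a + t * b" by (simp add: algebra_simps)
  ultimately have "x * ln x \<le> (1 - t) * (a * ln a) + t * (b * ln b)"
    using convex_onD[of "{0<..}" "\<lambda>x. x * ln x" t a b] ab t(1,2) by simp
  also have "\<dots> = (1 - t) * (- c) + t * (- c)"
    using assms ab by (auto simp: negxlnx_def)
  also have "\<dots> = - c" by (simp add: algebra_simps)
  finally show ?thesis using ab assms by (simp add: negxlnx_def)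
qed

lemma nonneg_dist_real_distribution: "nonneg_dist F \<Longrightarrow> real_distribution F"
  unfolding nonneg_dist_def real_distribution_def real_distribution_axioms_def by simp

lemma prob_space_instance_space:
  assumes "nonneg_dist F"
  shows "prob_space (instance_space n F)"
proof -
  have F: "prob_space F" using assms by (simp add: nonneg_dist_def)
  interpret X: prob_space "PiM {..<n} (\<lambda>_. F)" by (intro prob_space_PiM F)
  interpret U: prob_space "PiM {..<n} (\<lambda>_. unif01)" by (intro prob_space_PiM prob_space_unif01)
  interpret XU: pair_prob_space "PiM {..<n} (\<lambda>_. F)" "PiM {..<n} (\<lambda>_. unif01)" ..
  interpret XUU: pair_prob_space "PiM {..<n} (\<lambda>_. F) \<Otimes>\<^sub>M PiM {..<n} (\<lambda>_. unif01)" unif01 ..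
  show ?thesis unfolding instance_space_def by unfold_locales
qed

lemma maxprob_ratio_ge:
  assumes F: "nonneg_dist F" and T: "T \<in> borel_measurable borel"
    and anti: "\<And>a b. key_less a b \<Longrightarrow> T b \<le> T a" and n: "0 < n"
    and le: "ennreal c \<le> (\<integral>\<^sup>+x. (\<integral>\<^sup>+u. (\<integral>\<^sup>+t. indicator {t. wins n T x u t} t
      \<partial>PiM {..<n} (\<lambda>_. unif01)) \<partial>PiM {..<n} (\<lambda>_. unif01)) \<partial>PiM {..<n} (\<lambda>_. F))"
  shows "c \<le> maxprob_ratio n (threshold_rule T) F"
proof -
  interpret prob_space "instance_space n F" by (rule prob_space_instance_space[OF F])
  have "ennreal c \<le> emeasure (instance_space n F) {\<omega> \<in> space (instance_space n F). success n (threshold_rule T) \<omega>}"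
    using le emeasure_success_ge[OF F T anti n] by (rule order_trans)
  also have "\<dots> = ennreal (maxprob_ratio n (threshold_rule T) F)"
    unfolding maxprob_ratio_def success_def emeasure_eq_measure ..
  finally show ?thesis by (simp add: maxprob_ratio_def)
qed

context
  fixes \<beta> l1 l2 \<kappa> :: real and n :: nat
  assumes l: "0 \<le> l1" "l1 \<le> l2" "l2 \<le> 1" and \<kappa>: "0 < \<kappa>" and n: "0 < n"
    and roots: "negxlnx l1 = \<beta>" "negxlnx l2 = \<beta>"
begin

definition key_threshold :: "real measure \<Rightarrow> real \<times> real \<Rightarrow> real" where
  "key_threshold F z = time_threshold l1 l2 \<kappa> n (rand_quantile F z)"

lemma measurable_key_threshold:
  assumes "nonneg_dist F"
  shows "key_threshold F \<in> borel_measurable borel"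
  unfolding key_threshold_def[abs_def]
  by (rule measurable_compose[OF measurable_rand_quantile measurable_time_threshold])
     (use l \<kappa> n nonneg_dist_real_distribution[OF assms] in auto)

lemma key_threshold_antimono:
  assumes "nonneg_dist F" "key_less a b"
  shows "key_threshold F b \<le> key_threshold F a"
  unfolding key_threshold_def
  by (rule time_threshold_antimono[OF l \<kappa> n], rule rand_quantile_mono)
     (use nonneg_dist_real_distribution[OF assms(1)] assms(2) in auto)

text \<open>The bound already holds for each fixed vector of values with distinct labels. The
  prediction enters only through a threshold of the best item in \<open>[l1, l2]\<close>, so
  averaging over any true prior preserves the bound.\<close>

lemma robust_threshold_rule:
  assumes F: "nonneg_dist F" and Fp: "nonneg_dist Fp"
  shows "\<beta> \<le> maxprob_ratio n (threshold_rule (key_threshold Fp)) F"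
proof (rule maxprob_ratio_ge[OF F measurable_key_threshold[OF Fp] key_threshold_antimono[OF Fp] n])
  let ?U = "PiM {..<n} (\<lambda>_. unif01)" and ?X = "PiM {..<n} (\<lambda>_. F)" and ?T = "key_threshold Fp"
  interpret X: prob_space ?X using F by (intro prob_space_PiM) (simp add: nonneg_dist_def)
  interpret U: prob_space ?U by (intro prob_space_PiM prob_space_unif01)
  have "ennreal \<beta> = (\<integral>\<^sup>+x. (\<integral>\<^sup>+u. ennreal \<beta> \<partial>?U) \<partial>?X)"
    by (simp add: X.emeasure_space_1 U.emeasure_space_1)
  also have "\<dots> \<le> (\<integral>\<^sup>+x. (\<integral>\<^sup>+u. (\<integral>\<^sup>+t. indicator {t. wins n ?T x u t} t \<partial>?U) \<partial>?U) \<partial>?X)"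
  proof (rule nn_integral_mono, rule nn_integral_mono_AE, rule eventually_mono[OF AE_PiM_unif01_inj])
    fix x u :: "nat \<Rightarrow> real" assume u: "inj_on u {..<n}"
    have tot: "strict_total_on {..<n} (\<lambda>i j. key_less (x i, u i) (x j, u j))"
      by (rule strict_total_on_key_less[OF u])
    obtain i where i: "i < n" "\<And>j. j < n \<Longrightarrow> j \<noteq> i \<Longrightarrow> key_less (x j, u j) (x i, u i)"
      using strict_total_on_max[OF finite_lessThan _ tot] n by (auto simp: lessThan_empty_iff)
    have b: "l1 \<le> ?T z" "?T z \<le> l2" for z
      unfolding key_threshold_def by (rule time_threshold_bounds[OF l \<kappa> n])+
    have "\<beta> \<le> negxlnx (?T (x i, u i))"
      by (rule negxlnx_ge_between[OF l(1) b l(3) roots])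
    then have "ennreal \<beta> \<le> ennreal (negxlnx (?T (x i, u i)))" by (rule ennreal_leI)
    also have "\<dots> \<le> (\<integral>\<^sup>+t. indicator {t. wins n ?T x u t} t \<partial>?U)"
    proof (rule nn_integral_winning_ge_negxlnx[OF tot _ _ i(1) i(2)])
      show "Measurable.pred ?U (wins n ?T x u)"
        by (rule measurable_winning) (auto intro!: measurable_key_threshold Fp measurable_PiM_component_real)
      show "?T (x k, u k) \<le> ?T (x j, u j)" if "key_less (x j, u j) (x k, u k)" for j k
        by (rule key_threshold_antimono[OF Fp that])
      show "0 \<le> ?T (x j, u j)" for j using b(1)[of "(x j, u j)"] l by simp
      show "?T (x i, u i) \<le> 1" using b(2)[of "(x i, u i)"] l by simp
    qed
    finally show "ennreal \<beta> \<le> (\<integral>\<^sup>+t. indicator {t. wins n ?T x u t} t \<partial>?U)" .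
  qed
  finally show "ennreal \<beta> \<le> (\<integral>\<^sup>+x. (\<integral>\<^sup>+u. (\<integral>\<^sup>+t. indicator {t. wins n ?T x u t} t \<partial>?U) \<partial>?U) \<partial>?X)" .
qed

lemma consistent_threshold_rule:
  assumes F: "nonneg_dist F"
    and sums: "(\<lambda>k. \<kappa> ^ Suc k / (fact (Suc k) * real (Suc k))) sums 1"
  shows "\<beta> + (LBINT s=l1..l2. (LBINT t=s..1. exp (- \<kappa> * t / (1 - s)) / t))
    \<le> maxprob_ratio n (threshold_rule (key_threshold F)) F"
proof (rule maxprob_ratio_ge[OF F measurable_key_threshold[OF F] key_threshold_antimono[OF F] n])
  let ?U = "PiM {..<n} (\<lambda>_. unif01)" and ?X = "PiM {..<n} (\<lambda>_. F)" and ?T = "key_threshold F"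
  let ?i = "\<lambda>s. (LBINT t=ereal s..ereal 1. exp (- \<kappa> * t / (1 - s)) / t)"
  let ?I = "\<lambda>s. \<integral>\<^sup>+t. indicator {s<..<1} t * ennreal (exp (- \<kappa> * t / (1 - s)) / t) \<partial>lborel"
  have inner: "0 \<le> ?i s" "ennreal (?i s) \<le> ?I s" if "l1 < s" "s < l2" for s
    using that l by (intro ennreal_interval_integral_le; simp)+
  have outer: "0 \<le> (LBINT s=ereal l1..ereal l2. ?i s)"
    "ennreal (LBINT s=ereal l1..ereal l2. ?i s) \<le> (\<integral>\<^sup>+s. indicator {l1<..<l2} s * ennreal (?i s) \<partial>lborel)"
    using l inner(1) by (intro ennreal_interval_integral_le; simp)+
  have \<beta>: "0 \<le> \<beta>" unfolding roots(1)[symmetric] using l by (auto simp: negxlnx_def mult_nonneg_nonpos)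
  have "ennreal (\<beta> + (LBINT s=ereal l1..ereal l2. ?i s)) = ennreal (negxlnx l1) + ennreal (LBINT s=ereal l1..ereal l2. ?i s)"
    unfolding roots(1) by (rule ennreal_plus[OF \<beta> outer(1)])
  also have "\<dots> \<le> ennreal (negxlnx l1) + (\<integral>\<^sup>+s. indicator {l1..<l2} s * ?I s \<partial>lborel)"
  proof (rule add_left_mono, rule order_trans[OF outer(2)], rule nn_integral_mono)
    fix s :: real
    show "indicator {l1<..<l2} s * ennreal (?i s) \<le> indicator {l1..<l2} s * ?I s"
      using inner(2)[of s] by (auto simp: indicator_def)
  qed
  also note nn_integral_payoff_ge[OF l \<kappa> n sums]
  also note sum_nn_integral_gain_ge[OF l \<kappa> n]
  also have "(\<Sum>i<n. \<integral>\<^sup>+q. gain n (time_threshold l1 l2 \<kappa> n) q i \<partial>?U)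
    \<le> (\<integral>\<^sup>+x. (\<integral>\<^sup>+u. (\<integral>\<^sup>+t. indicator {t. wins n ?T x u t} t \<partial>?U) \<partial>?U) \<partial>?X)"
    unfolding key_threshold_def
    using time_threshold_bounds(1)[OF l \<kappa> n] l
    by (intro nn_integral_wins_ge_gain nonneg_dist_real_distribution F measurable_time_threshold[OF l \<kappa> n]
          time_threshold_antimono[OF l \<kappa> n]) (auto intro: order_trans)
  finally show "ennreal (\<beta> + (LBINT s=l1..l2. (LBINT t=s..1. exp (- \<kappa> * t / (1 - s)) / t)))
    \<le> (\<integral>\<^sup>+x. (\<integral>\<^sup>+u. (\<integral>\<^sup>+t. indicator {t. wins n ?T x u t} t \<partial>?U) \<partial>?U) \<partial>?X)" by (simp only: one_ereal_def)
qed

end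

lemma maxprob_ratio_0:
  assumes "nonneg_dist F"
  shows "maxprob_ratio 0 A F = 1"
proof -
  interpret prob_space "instance_space 0 F" by (rule prob_space_instance_space[OF assms])
  have "{\<omega> \<in> space (instance_space 0 F). accepted_value 0 A (snd \<omega>) (fst (fst \<omega>)) (snd (fst \<omega>)) = opt_value 0 (fst (fst \<omega>))}
    = space (instance_space 0 F)"
    by (auto simp: accepted_value_def opt_value_def)
  then show ?thesis unfolding maxprob_ratio_def by (simp only: prob_space)
qed

lemma maxprob_ratio_le_1:
  assumes "nonneg_dist F"
  shows "maxprob_ratio n A F \<le> 1"
proof -
  interpret prob_space "instance_space n F" by (rule prob_space_instance_space[OF assms])
  show ?thesis unfolding maxprob_ratio_def by (rule prob_le_1)
qed

theorem mainTheorem2: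
  fixes \<beta> l1 l2 \<kappa> :: real and n :: nat
  assumes "0 \<le> \<beta>" and "\<beta> \<le> exp (-1)"
    and "l1 \<le> l2" and "{y \<in> {0..1}. negxlnx y = \<beta>} = {l1, l2}"
    and "\<kappa> > 0"
    and "(\<lambda>k. \<kappa> ^ Suc k / (fact (Suc k) * real (Suc k))) sums 1"
  shows "\<exists>ALG. consistent n ALG
                 (\<beta> + (LBINT s=l1..l2. (LBINT t=s..1. exp (- \<kappa> * t / (1 - s)) / t)))
            \<and> robust n ALG \<beta>"
proof -
  have "l1 \<in> {y \<in> {0..1}. negxlnx y = \<beta>}" "l2 \<in> {y \<in> {0..1}. negxlnx y = \<beta>}"
    unfolding assms(4) by simp_all
  then have l: "0 \<le> l1" "l1 \<le> l2" "l2 \<le> 1" and roots: "negxlnx l1 = \<beta>" "negxlnx l2 = \<beta>"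
    using assms(3) by auto
  let ?ALG = "\<lambda>n F. threshold_rule (key_threshold l1 l2 \<kappa> n F)"
  have cons: "consistent n (?ALG n) (\<beta> + (LBINT s=l1..l2. (LBINT t=s..1. exp (- \<kappa> * t / (1 - s)) / t)))"
    and rob: "robust n (?ALG n) \<beta>" if "0 < n" for n
    unfolding consistent_def robust_def
    using consistent_threshold_rule[OF l assms(5) that roots _ assms(6)]
      robust_threshold_rule[OF l assms(5) that roots] by auto
  show ?thesis
  proof (cases "n = 0")
    case False
    then show ?thesis using cons rob by blast
  next
    case True
    \<comment> \<open>With no values every rule has ratio 1, so it remains to see that both target
      numbers are at most 1. They do not depend on \<open>n\<close>, and for \<open>n = 1\<close> a
      probability dominates them; any prior will do as a witness, here
      \<open>unif01\<close>.\<close>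
    have "measure unif01 {0..} = 1"
      using emeasure_unif01[of "{0..}"] by (simp add: measure_def Int_absorb2)
    then have U: "nonneg_dist unif01"
      by (simp add: nonneg_dist_def prob_space_unif01)
    have "\<beta> + (LBINT s=l1..l2. (LBINT t=s..1. exp (- \<kappa> * t / (1 - s)) / t)) \<le> 1" "\<beta> \<le> 1"
      using cons[of 1] rob[of 1] U maxprob_ratio_le_1[OF U, of 1 "?ALG 1 unif01"]
      unfolding consistent_def robust_def by (force intro: order_trans)+
    then show ?thesis
      unfolding True consistent_def robust_def by (simp add: maxprob_ratio_0)
  qed
qed

end
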